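(* If $X\subseteq\widehat D^n$ is nonempty and openly Eulerian, then its procounting measure $\mu_X$ exists and is given by the formula $$\mu_X=\bigotimes_{\mathfrak p}\frac{1}{\mu_{\widehat D_{\mathfrak p}^n}\big(X(\mathfrak p)\big)}\,\mathbf 1_{X(\mathfrak p)}\,\mu_{\widehat D_{\mathfrak p}^n},$$ the product being over all non-zero prime ideals $\mathfrak p$ of $D$.
   Context: $F$ is a global field, $\mathcal S$ a nonempty finite set of places of $F$ containing the archimedean ones, $D$ the ring of $\mathcal S$-integers of $F$. $\widehat D=\varprojlim D/\mathfrak a$ over non-zero ideals $\mathfrak a$, and $\widehat D_{\mathfrak p}=\varprojlim D/\mathfrak p^j$ for each non-zero prime $\mathfrak p$, so that $\widehat D=\prod_{\mathfrak p}\widehat D_{\mathfrak p}$; $\widehat\pi_{\mathfrak a}\colon\widehat D^n\to(D/\mathfrak a)^n$ and $\widehat\pi_{\mathfrak p^\infty}\colon\widehat D^n\to\widehat D_{\mathfrak p}^n$ are the projections. $\mu_{\widehat D^n}$, $\mu_{\widehat D^n_{\mathfrak p}}$ are the normalized Haar measures. For $X\subseteq\widehat D^n$, $\widehat X$ denotes its closure and $X(\mathfrak p)$ the closure of $\widehat\pi_{\mathfrak p^\infty}(X)$ in $\widehat D_{\mathfrak p}^n$. $X$ is Eulerian if $\widehat X=\prod_{\mathfrak p}X(\mathfrak p)$, and openly Eulerian if moreover every $X(\mathfrak p)$ is open. Procounting measure. For nonempty $S\subseteq\widehat D^n$ let $\widetilde\mu_{S,\mathfrak a}:=\frac{|D/\mathfrak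 a|^n}{|\widehat\pi_{\mathfrak a}(S)|}\mathbf 1_{\widehat\pi_{\mathfrak a}^{-1}(\widehat\pi_{\mathfrak a}(S))}\cdot\mu_{\widehat D^n}$; then $\mu_S:=\lim_{\mathfrak a\to0}\widetilde\mu_{S,\mathfrak a}$ (if it exists), the net being indexed by non-zero ideals ordered by divisibility and the limit being in the weak-* sense (convergence of $\widetilde\mu_{S,\mathfrak a}(U)$ for every compact open $U$). The product $\bigotimes_{\mathfrak p}\mu_{\mathfrak p}$ of probability measures is the measure with $(\bigotimes_{\mathfrak p}\mu_{\mathfrak p})(\prod_{\mathfrak p}U_{\mathfrak p})=\prod_{\mathfrak p}\mu_{\mathfrak p}(U_{\mathfrak p})$ for all compact open $U_{\mathfrak p}\subseteq\widehat D^n_{\mathfrak p}$ with $U_{\mathfrak p}=\widehat D_{\mathfrak p}^n$ for almost all $\mathfrak p$. *)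

theory Defs
  imports "HOL-Analysis.Analysis" "HOL-Algebra.Algebra"
begin

section \<open>Global fields, places and rings of S-integers\<close>

text \<open>\<^term>\<open>generate_field F {}\<close> is the prime subfield of \<open>F\<close>, so it is a copy of the rationals in
  characteristic zero.\<close>

definition number_field :: "('a, 'b) ring_scheme \<Rightarrow> bool" where
  "number_field F \<longleftrightarrow> field F \<and>
     (\<forall>m::nat. m > 0 \<longrightarrow> [m] \<cdot>\<^bsub>F\<^esub> \<one>\<^bsub>F\<^esub> \<noteq> \<zero>\<^bsub>F\<^esub>) \<and>
     ring.finite_dimension F (generate_field F {}) (carrier F)"

text \<open>Finite extensions of a rational function field \<open>K(t)\<close> over a finite field \<open>K\<close>.\<close>

definition global_function_field :: "('a, 'b) ring_scheme \<Rightarrow> bool" where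
  "global_function_field F \<longleftrightarrow> field F \<and>
     (\<exists>K t. subfield K F \<and> finite K \<and> t \<in> carrier F \<and> ring.transcendental F K t \<and>
        ring.finite_dimension F (generate_field F (insert t K)) (carrier F))"

definition global_field :: "('a, 'b) ring_scheme \<Rightarrow> bool" where
  "global_field F \<longleftrightarrow> number_field F \<or> global_function_field F"

definition nontrivial_abs_values :: "('a, 'b) ring_scheme \<Rightarrow> ('a \<Rightarrow> real) set" where
  "nontrivial_abs_values F = {v.
     (\<forall>x\<in>carrier F. 0 \<le> v x \<and> (v x = 0 \<longleftrightarrow> x = \<zero>\<^bsub>F\<^esub>)) \<and>
     (\<forall>x\<in>carrier F. \<forall>y\<in>carrier F. v (x \<otimes>\<^bsub>F\<^esub> y) = v x * v y) \<and>
     (\<forall>x\<in>carrier F. \<forall>y\<in>carrier F. v (x \<oplus>\<^bsub>F\<^esub> y) \<le> v x + v y) \<and>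
     (\<exists>x\<in>carrier F. x \<noteq> \<zero>\<^bsub>F\<^esub> \<and> v x \<noteq> 1)}"

definition abs_value_equiv :: "('a, 'b) ring_scheme \<Rightarrow> (('a \<Rightarrow> real) \<times> ('a \<Rightarrow> real)) set" where
  "abs_value_equiv F = {(v, w). v \<in> nontrivial_abs_values F \<and> w \<in> nontrivial_abs_values F \<and>
     (\<exists>s>0. \<forall>x\<in>carrier F. w x = v x powr s)}"

definition places :: "('a, 'b) ring_scheme \<Rightarrow> ('a \<Rightarrow> real) set set" where
  "places F = nontrivial_abs_values F // abs_value_equiv F"

definition nonarchimedean :: "('a, 'b) ring_scheme \<Rightarrow> ('a \<Rightarrow> real) \<Rightarrow> bool" where
  "nonarchimedean F v \<longleftrightarrow>
     (\<forall>x\<in>carrier F. \<forall>y\<in>carrier F. v (x \<oplus>\<^bsub>F\<^esub> y) \<le> max (v x) (v y))"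

definition archimedean_places :: "('a, 'b) ring_scheme \<Rightarrow> ('a \<Rightarrow> real) set set" where
  "archimedean_places F = {P \<in> places F. \<exists>v\<in>P. \<not> nonarchimedean F v}"

definition S_integers ::
    "('a, 'b) ring_scheme \<Rightarrow> ('a \<Rightarrow> real) set set \<Rightarrow> ('a, 'b) ring_scheme" where
  "S_integers F S = F\<lparr>carrier := {x \<in> carrier F. \<forall>P \<in> places F - S. \<forall>v\<in>P. v x \<le> 1}\<rparr>"

section \<open>Profinite completions\<close>

definition nonzero_ideals :: "('a, 'b) ring_scheme \<Rightarrow> 'a set set" where
  "nonzero_ideals D = {I. ideal I D \<and> I \<noteq> {\<zero>\<^bsub>D\<^esub>}}"

definition nonzero_primes :: "('a, 'b) ring_scheme \<Rightarrow> 'a set set" where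
  "nonzero_primes D = {P. primeideal P D \<and> P \<noteq> {\<zero>\<^bsub>D\<^esub>}}"

definition ideal_powers :: "('a, 'b) ring_scheme \<Rightarrow> 'a set \<Rightarrow> 'a set set" where
  "ideal_powers D P = range (\<lambda>j::nat. P [^]\<^bsub>ideals_set D\<^esub> j)"

text \<open>The inverse limit of the quotients \<open>D/I\<close>, with \<open>I\<close> ranging over a set \<open>\<A>\<close> of ideals ordered
  by reverse inclusion. Elements of a quotient are cosets, and for \<open>I \<subseteq> J\<close> the transition map
  \<open>D/I \<rightarrow> D/J\<close> sends a coset of \<open>I\<close> to the unique coset of \<open>J\<close> containing it; so compatibility of a
  family of cosets is inclusion. Taking \<open>\<A> = nonzero_ideals D\<close> gives the profinite completion of
  \<open>D\<close>, and \<open>\<A> = ideal_powers D P\<close> its completion at \<open>P\<close>.\<close>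

definition prolim :: "('a, 'b) ring_scheme \<Rightarrow> 'a set set \<Rightarrow> ('a set \<Rightarrow> 'a set) set" where
  "prolim D \<A> = {x \<in> (\<Pi>\<^sub>E I\<in>\<A>. carrier (D Quot I)). \<forall>I\<in>\<A>. \<forall>J\<in>\<A>. I \<subseteq> J \<longrightarrow> x I \<subseteq> x J}"

definition prolim_group :: "('a, 'b) ring_scheme \<Rightarrow> 'a set set \<Rightarrow> ('a set \<Rightarrow> 'a set) monoid" where
  "prolim_group D \<A> = (product_group \<A> (\<lambda>I. add_monoid (D Quot I)))\<lparr>carrier := prolim D \<A>\<rparr>"

definition prolim_topology ::
    "('a, 'b) ring_scheme \<Rightarrow> 'a set set \<Rightarrow> ('a set \<Rightarrow> 'a set) topology" where
  "prolim_topology D \<A> =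
     subtopology (product_topology (\<lambda>I. discrete_topology (carrier (D Quot I))) \<A>) (prolim D \<A>)"

text \<open>The \<open>n\<close>-th powers of these groups: vectors are functions on \<^term>\<open>{..<n}\<close>.\<close>

definition vec_group ::
    "('a, 'b) ring_scheme \<Rightarrow> 'a set set \<Rightarrow> nat \<Rightarrow> (nat \<Rightarrow> 'a set \<Rightarrow> 'a set) monoid" where
  "vec_group D \<A> n = product_group {..<n} (\<lambda>_. prolim_group D \<A>)"

definition vec_topology ::
    "('a, 'b) ring_scheme \<Rightarrow> 'a set set \<Rightarrow> nat \<Rightarrow> (nat \<Rightarrow> 'a set \<Rightarrow> 'a set) topology" where
  "vec_topology D \<A> n = product_topology (\<lambda>_. prolim_topology D \<A>) {..<n}"

definition proj_mod :: "nat \<Rightarrow> 'a set \<Rightarrow> (nat \<Rightarrow> 'a set \<Rightarrow> 'a set) \<Rightarrow> nat \<Rightarrow> 'a set" where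
  "proj_mod n I x = (\<lambda>i\<in>{..<n}. x i I)"

definition proj_prime ::
    "('a, 'b) ring_scheme \<Rightarrow> nat \<Rightarrow> 'a set \<Rightarrow> (nat \<Rightarrow> 'a set \<Rightarrow> 'a set) \<Rightarrow> nat \<Rightarrow> 'a set \<Rightarrow> 'a set" where
  "proj_prime D n P x = (\<lambda>i\<in>{..<n}. restrict (x i) (ideal_powers D P))"

text \<open>The identification of the \<open>n\<close>-th power of the profinite completion with the product over all
  \<open>P\<close> of the \<open>n\<close>-th powers of the completions at \<open>P\<close>.\<close>

definition local_components ::
    "('a, 'b) ring_scheme \<Rightarrow> nat \<Rightarrow> (nat \<Rightarrow> 'a set \<Rightarrow> 'a set) \<Rightarrow> 'a set \<Rightarrow> nat \<Rightarrow> 'a set \<Rightarrow> 'a set" where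
  "local_components D n x = (\<lambda>P\<in>nonzero_primes D. proj_prime D n P x)"

definition local_closure ::
    "('a, 'b) ring_scheme \<Rightarrow> nat \<Rightarrow> (nat \<Rightarrow> 'a set \<Rightarrow> 'a set) set \<Rightarrow> 'a set
       \<Rightarrow> (nat \<Rightarrow> 'a set \<Rightarrow> 'a set) set" where
  "local_closure D n A P = vec_topology D (ideal_powers D P) n closure_of (proj_prime D n P ` A)"

definition Eulerian ::
    "('a, 'b) ring_scheme \<Rightarrow> nat \<Rightarrow> (nat \<Rightarrow> 'a set \<Rightarrow> 'a set) set \<Rightarrow> bool" where
  "Eulerian D n A \<longleftrightarrow>
     local_components D n ` (vec_topology D (nonzero_ideals D) n closure_of A) =
       (\<Pi>\<^sub>E P\<in>nonzero_primes D. local_closure D n A P)"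

definition openly_Eulerian ::
    "('a, 'b) ring_scheme \<Rightarrow> nat \<Rightarrow> (nat \<Rightarrow> 'a set \<Rightarrow> 'a set) set \<Rightarrow> bool" where
  "openly_Eulerian D n A \<longleftrightarrow> Eulerian D n A \<and>
     (\<forall>P\<in>nonzero_primes D. openin (vec_topology D (ideal_powers D P) n) (local_closure D n A P))"

section \<open>Measures\<close>

definition borel_of :: "'a topology \<Rightarrow> 'a measure" where
  "borel_of T = sigma (topspace T) {U. openin T U}"

text \<open>Regularity is not imposed: the groups considered here are compact and metrizable, where finite
  Borel measures are automatically regular.\<close>

definition is_normalized_haar :: "('a, 'b) monoid_scheme \<Rightarrow> 'a topology \<Rightarrow> 'a measure \<Rightarrow> bool" where
  "is_normalized_haar G T \<mu> \<longleftrightarrow>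
     sets \<mu> = sets (borel_of T) \<and> emeasure \<mu> (topspace T) = 1 \<and>
     (\<forall>g\<in>carrier G. \<forall>A\<in>sets \<mu>. emeasure \<mu> ((\<lambda>x. g \<otimes>\<^bsub>G\<^esub> x) ` A) = emeasure \<mu> A)"

definition normalized_haar :: "('a, 'b) monoid_scheme \<Rightarrow> 'a topology \<Rightarrow> 'a measure" where
  "normalized_haar G T = (THE \<mu>. is_normalized_haar G T \<mu>)"

definition vec_haar ::
    "('a, 'b) ring_scheme \<Rightarrow> 'a set set \<Rightarrow> nat \<Rightarrow> (nat \<Rightarrow> 'a set \<Rightarrow> 'a set) measure" where
  "vec_haar D \<A> n = normalized_haar (vec_group D \<A> n) (vec_topology D \<A> n)"

definition procounting_approx ::
    "('a, 'b) ring_scheme \<Rightarrow> nat \<Rightarrow> (nat \<Rightarrow> 'a set \<Rightarrow> 'a set) set \<Rightarrow> 'a set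
       \<Rightarrow> (nat \<Rightarrow> 'a set \<Rightarrow> 'a set) measure" where
  "procounting_approx D n S I =
     density (vec_haar D (nonzero_ideals D) n)
       (\<lambda>x. ennreal (real (card (carrier (D Quot I))) ^ n / real (card (proj_mod n I ` S))) *
            indicator {y \<in> carrier (vec_group D (nonzero_ideals D) n).
                         proj_mod n I y \<in> proj_mod n I ` S} x)"

text \<open>The filter of the net of non-zero ideals ordered by divisibility.\<close>

definition ideals_to_zero :: "('a, 'b) ring_scheme \<Rightarrow> 'a set filter" where
  "ideals_to_zero D =
     (INF J\<in>nonzero_ideals D. principal {I \<in> nonzero_ideals D. J divides\<^bsub>ideals_set D\<^esub> I})"

definition is_procounting_measure ::
    "('a, 'b) ring_scheme \<Rightarrow> nat \<Rightarrow> (nat \<Rightarrow> 'a set \<Rightarrow> 'a set) set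
       \<Rightarrow> (nat \<Rightarrow> 'a set \<Rightarrow> 'a set) measure \<Rightarrow> bool" where
  "is_procounting_measure D n S \<nu> \<longleftrightarrow>
     sets \<nu> = sets (borel_of (vec_topology D (nonzero_ideals D) n)) \<and>
     (\<forall>U. compactin (vec_topology D (nonzero_ideals D) n) U \<and>
          openin (vec_topology D (nonzero_ideals D) n) U \<longrightarrow>
        ((\<lambda>I. emeasure (procounting_approx D n S I) U) \<longlongrightarrow> emeasure \<nu> U) (ideals_to_zero D))"

definition procounting_measure ::
    "('a, 'b) ring_scheme \<Rightarrow> nat \<Rightarrow> (nat \<Rightarrow> 'a set \<Rightarrow> 'a set) set
       \<Rightarrow> (nat \<Rightarrow> 'a set \<Rightarrow> 'a set) measure" where
  "procounting_measure D n S = (THE \<nu>. is_procounting_measure D n S \<nu>)"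

text \<open>The product of probability measures \<open>\<mu> P\<close> on the \<open>n\<close>-th powers of the completions at \<open>P\<close>, as a
  measure on the \<open>n\<close>-th power of the profinite completion. All but finitely many factors of the
  product of the \<open>\<mu> P (U P)\<close> equal 1 and are left out.\<close>

definition is_local_product_measure ::
    "('a, 'b) ring_scheme \<Rightarrow> nat \<Rightarrow> ('a set \<Rightarrow> (nat \<Rightarrow> 'a set \<Rightarrow> 'a set) measure)
       \<Rightarrow> (nat \<Rightarrow> 'a set \<Rightarrow> 'a set) measure \<Rightarrow> bool" where
  "is_local_product_measure D n \<mu> \<nu> \<longleftrightarrow>
     sets \<nu> = sets (borel_of (vec_topology D (nonzero_ideals D) n)) \<and>
     (\<forall>U. (\<forall>P\<in>nonzero_primes D. compactin (vec_topology D (ideal_powers D P) n) (U P) \<and>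
                                 openin (vec_topology D (ideal_powers D P) n) (U P)) \<and>
          finite {P \<in> nonzero_primes D. U P \<noteq> topspace (vec_topology D (ideal_powers D P) n)} \<longrightarrow>
        emeasure \<nu> {x \<in> carrier (vec_group D (nonzero_ideals D) n).
                      local_components D n x \<in> (\<Pi>\<^sub>E P\<in>nonzero_primes D. U P)} =
        (\<Prod>P\<in>{P \<in> nonzero_primes D. U P \<noteq> topspace (vec_topology D (ideal_powers D P) n)}.
           emeasure (\<mu> P) (U P)))"

definition local_product_measure ::
    "('a, 'b) ring_scheme \<Rightarrow> nat \<Rightarrow> ('a set \<Rightarrow> (nat \<Rightarrow> 'a set \<Rightarrow> 'a set) measure)
       \<Rightarrow> (nat \<Rightarrow> 'a set \<Rightarrow> 'a set) measure" where
  "local_product_measure D n \<mu> = (THE \<nu>. is_local_product_measure D n \<mu> \<nu>)"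

end

theory Submission
  imports Defs
begin

text \<open>Write \<open>T\<close> for a finite set of primes. Since each \<open>X(\<pp>)\<close> is open, hence a union of cosets modulo
  some \<open>\<pp>\<^sup>k\<close>, the thickening \<open>W = \<pi>\<^sub>I\<inverse>(\<pi>\<^sub>I(X))\<close> is, for all \<open>I\<close> divisible enough, the intersection of the
  conditions \<open>x\<^sub>\<pp> \<in> X(\<pp>)\<close> for \<open>\<pp> \<in> T\<close> with a set invariant under the local groups at the primes
  of \<open>T\<close>. Uniqueness of Haar measure makes the coordinates at \<open>T\<close> independent of such a set, so the
  normalized restriction of Haar measure to \<open>W\<close> takes exactly the product value on a box with
  conditions at \<open>T\<close>. Thus the net is eventually constant on boxes, hence on compact open sets, and
  the limits extend to a measure by Caratheodory's theorem.\<close>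

section \<open>Profinite groups and their Haar measures\<close>

text \<open>Two uniqueness principles carry the argument: a finite measure is determined by the
  clopen sets, and Haar measure by its value 1/index on the cosets of each level. Both sides of the
  final equation are definite descriptions, so neither means anything before such uniqueness is
  known. The completions are compact because D modulo a non-zero ideal is finite. That finiteness is
  obtained by counting: long base-x expansions cannot outnumber the field elements of bounded size.
  The argument is uniform for number fields and function fields, given a suitable notion of size.
  The splitting into local parts rests on two facts about ideals: distinct non-zero primes have
  comaximal powers, and every non-zero ideal contains a finite intersection of prime powers. Both
  are again drawn from finite quotients, by pigeonhole and by induction on the number of ideals
  above a given one. An ideal I deep in the net also carries conditions at primes outside T; their
  joint mass is never computed, as it cancels between numerator and denominator.\<close>

lemma space_borel_of [simp]: "space (borel_of T) = topspace T"
  by (simp add: borel_of_def space_measure_of_conv)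

lemma sets_borel_of: "sets (borel_of T) = sigma_sets (topspace T) {U. openin T U}"
  unfolding borel_of_def by (intro sets_measure_of) (auto dest: openin_subset)

lemma borel_of_open: "openin T U \<Longrightarrow> U \<in> sets (borel_of T)"
  by (auto simp: sets_borel_of)

text \<open>The levels have an index type of their own because they will be ideals, while the
  subgroups \<open>H I\<close> are the kernels of reduction modulo them. By
  \<open>openin_iff\<close> the \<open>H I\<close> form a neighbourhood base of the unit;
  compactness then forces finite index, and countably many levels make the Borel sets generated by
  cosets. Commutativity makes a left translate of a right coset a right coset.\<close>

locale profinite_group = comm_group G for G (structure) +
  fixes T :: "'a topology" and \<A> :: "'i set" and H :: "'i \<Rightarrow> 'a set"
  assumes topspace_eq: "topspace T = carrier G"
    and compact: "compact_space T" and hausdorff: "Hausdorff_space T"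
    and countable_levels: "countable \<A>" and levels_nonempty: "\<A> \<noteq> {}"
    and directed: "I \<in> \<A> \<Longrightarrow> J \<in> \<A> \<Longrightarrow> \<exists>K\<in>\<A>. H K \<subseteq> H I \<inter> H J"
    and subgroup: "I \<in> \<A> \<Longrightarrow> subgroup (H I) G"
    and openin_iff: "openin T U \<longleftrightarrow> U \<subseteq> carrier G \<and> (\<forall>x\<in>U. \<exists>I\<in>\<A>. H I #> x \<subseteq> U)"
begin

section \<open>Unions of cosets at one level, and clopen sets\<close>

definition saturated :: "'i \<Rightarrow> 'a set \<Rightarrow> bool" where
  "saturated I U \<longleftrightarrow> U \<subseteq> carrier G \<and> (\<forall>x\<in>U. H I #> x \<subseteq> U)"

definition clopens :: "'a set set" where
  "clopens = {U. openin T U \<and> closedin T U}"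

lemma H_subset: "I \<in> \<A> \<Longrightarrow> H I \<subseteq> carrier G"
  by (simp add: subgroup subgroup.subset)

lemma one_in_H: "I \<in> \<A> \<Longrightarrow> \<one> \<in> H I"
  by (simp add: subgroup subgroup.one_closed)

lemma coset_subset: "I \<in> \<A> \<Longrightarrow> x \<in> carrier G \<Longrightarrow> H I #> x \<subseteq> carrier G"
  by (simp add: H_subset r_coset_subset_G)

lemma coset_self: "I \<in> \<A> \<Longrightarrow> x \<in> carrier G \<Longrightarrow> x \<in> H I #> x"
  by (simp add: rcos_self subgroup)

lemma coset_eq: "I \<in> \<A> \<Longrightarrow> x \<in> carrier G \<Longrightarrow> y \<in> H I #> x \<Longrightarrow> H I #> y = H I #> x"
  using repr_independence[OF _ _ subgroup] by metis

lemma coset_mono: "H K \<subseteq> H I \<Longrightarrow> H K #> x \<subseteq> H I #> x"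
  by (auto simp: r_coset_def)

lemma saturated_coset: "I \<in> \<A> \<Longrightarrow> x \<in> carrier G \<Longrightarrow> saturated I (H I #> x)"
  by (simp add: saturated_def coset_subset coset_eq)

lemma saturated_mono: "saturated I U \<Longrightarrow> H K \<subseteq> H I \<Longrightarrow> saturated K U"
  unfolding saturated_def using coset_mono by blast

lemma saturated_openin: "I \<in> \<A> \<Longrightarrow> saturated I U \<Longrightarrow> openin T U"
  unfolding saturated_def openin_iff by blast

text \<open>Cosets of one level partition the group: if the coset of a point outside
  \<open>V\<close> met \<open>V\<close> at \<open>y\<close>, it would be the coset of
  \<open>y\<close> and hence lie inside \<open>V\<close>.\<close>

lemma saturated_Diff:
  assumes "I \<in> \<A>" "saturated I U" "saturated I V" shows "saturated I (U - V)"
proof -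
  have "(H I #> x) \<inter> V = {}" if x: "x \<in> U - V" for x
  proof (rule ccontr)
    assume "(H I #> x) \<inter> V \<noteq> {}"
    then obtain y where y: "y \<in> H I #> x" "y \<in> V" by blast
    have xc: "x \<in> carrier G" using x assms(2) by (auto simp: saturated_def)
    have "x \<in> H I #> y" using coset_eq[OF assms(1) xc y(1)] coset_self[OF assms(1) xc] by simp
    then show False using y(2) assms(3) x by (auto simp: saturated_def)
  qed
  then show ?thesis using assms by (auto simp: saturated_def)
qed

lemma saturated_carrier: "I \<in> \<A> \<Longrightarrow> saturated I (carrier G)"
  by (simp add: saturated_def coset_subset)

lemma saturated_clopen: "I \<in> \<A> \<Longrightarrow> saturated I U \<Longrightarrow> U \<in> clopens"
  using saturated_openin[of I U] saturated_openin[OF _ saturated_Diff[OF _ saturated_carrier], of I U]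
  by (auto simp: clopens_def closedin_def topspace_eq saturated_def)

lemma directed_finite:
  assumes "finite B" "B \<subseteq> \<A>" shows "\<exists>K\<in>\<A>. \<forall>I\<in>B. H K \<subseteq> H I"
  using assms
proof (induction B)
  case empty then show ?case using levels_nonempty by auto
next
  case (insert J B)
  then obtain K where K: "K \<in> \<A>" "\<forall>I\<in>B. H K \<subseteq> H I" by auto
  obtain L where "L \<in> \<A>" "H L \<subseteq> H K \<inter> H J" using directed[of K J] K(1) insert.prems by auto
  then show ?case using K(2) by (intro bexI[of _ L]) auto
qed

text \<open>Each point of a clopen set has a coset inside it, but at a level depending on the point.
  Compactness leaves finitely many levels, and directedness supplies one below them all that works
  at every point.\<close>

lemma clopen_saturated:
  assumes "U \<in> clopens" obtains I where "I \<in> \<A>" "saturated I U"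
proof -
  have U: "openin T U" "compactin T U" using assms compact
    by (auto simp: clopens_def closedin_compact_space)
  obtain f where f: "\<And>x. x \<in> U \<Longrightarrow> f x \<in> \<A> \<and> H (f x) #> x \<subseteq> U"
    using U(1) unfolding openin_iff by metis
  have Uc: "U \<subseteq> carrier G" using U(1) openin_iff by blast
  let ?C = "(\<lambda>x. H (f x) #> x) ` U"
  have "\<forall>V\<in>?C. openin T V" using f Uc saturated_openin saturated_coset by blast
  moreover have "U \<subseteq> \<Union>?C" using f Uc coset_self by blast
  ultimately obtain C where C: "finite C" "C \<subseteq> ?C" "U \<subseteq> \<Union>C"
    using U(2) unfolding compactin_def by meson
  obtain B where B: "finite B" "B \<subseteq> U" "C = (\<lambda>x. H (f x) #> x) ` B"
    using finite_subset_image[OF C(1,2)] by blast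
  obtain K where K: "K \<in> \<A>" "\<forall>x\<in>B. H K \<subseteq> H (f x)"
    using directed_finite[of "f ` B"] B f by (metis finite_imageI image_subset_iff imageI subsetD)
  have "H K #> y \<subseteq> U" if "y \<in> U" for y
  proof -
    have "y \<in> \<Union>C" using C(3) that by blast
    then obtain x where x: "x \<in> B" "y \<in> H (f x) #> x" unfolding B(3) by blast
    have xU: "x \<in> U" using x B by blast
    have "H K #> y \<subseteq> H (f x) #> y" using coset_mono K(2) x(1) by blast
    also have "\<dots> = H (f x) #> x" using coset_eq x(2) f[OF xU] xU Uc by blast
    also have "\<dots> \<subseteq> U" using f[OF xU] by blast
    finally show ?thesis .
  qed
  then show thesis using that[OF K(1)] Uc by (auto simp: saturated_def)
qed

lemma coset_clopen: "I \<in> \<A> \<Longrightarrow> x \<in> carrier G \<Longrightarrow> H I #> x \<in> clopens"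
  using saturated_clopen saturated_coset by blast

lemma rcosets_clopen: "I \<in> \<A> \<Longrightarrow> C \<in> rcosets (H I) \<Longrightarrow> C \<in> clopens"
  using coset_clopen by (auto simp: RCOSETS_def)

lemma rcosets_disjoint: "I \<in> \<A> \<Longrightarrow> C \<in> rcosets (H I) \<Longrightarrow> C' \<in> rcosets (H I) \<Longrightarrow> x \<in> C \<Longrightarrow> x \<in> C' \<Longrightarrow> C = C'"
  using rcos_disjoint[OF subgroup, of I] unfolding pairwise_def disjnt_def by blast

text \<open>The cosets form a disjoint open cover, so a finite subcover cannot omit any of
  them.\<close>

lemma finite_rcosets: assumes "I \<in> \<A>" shows "finite (rcosets (H I))"
proof -
  have "\<Union>(rcosets (H I)) = carrier G" using rcosets_part_G subgroup assms by blast
  moreover have "\<forall>C\<in>rcosets (H I). openin T C" using rcosets_clopen[OF assms] by (auto simp: clopens_def)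
  ultimately obtain F where F: "finite F" "F \<subseteq> rcosets (H I)" "\<Union>F = carrier G"
    using compact unfolding compact_space topspace_eq by meson
  have "rcosets (H I) \<subseteq> F"
  proof
    fix C assume C: "C \<in> rcosets (H I)"
    then obtain x where x: "x \<in> carrier G" "C = H I #> x" by (auto simp: RCOSETS_def)
    obtain C' where C': "C' \<in> F" "x \<in> C'" using F(3) x(1) by blast
    have "C = C'" using rcosets_disjoint[OF assms C] C' F(2) coset_self[OF assms x(1)] x(2) by blast
    then show "C \<in> F" using C' by simp
  qed
  then show ?thesis using F(1) finite_subset by blast
qed

lemma saturated_Union_rcosets:
  assumes "I \<in> \<A>" "saturated I U" shows "U = \<Union>{C \<in> rcosets (H I). C \<subseteq> U}"
proof
  show "U \<subseteq> \<Union>{C \<in> rcosets (H I). C \<subseteq> U}"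
  proof
    fix x assume x: "x \<in> U"
    then have "x \<in> carrier G" "H I #> x \<subseteq> U" using assms(2) by (auto simp: saturated_def)
    then show "x \<in> \<Union>{C \<in> rcosets (H I). C \<subseteq> U}"
      using coset_self[OF assms(1), of x] by (auto simp: RCOSETS_def)
  qed
qed blast

section \<open>Clopen sets as generators of the Borel sets, and extension of contents\<close>

lemma algebra_clopens: "Sigma_Algebra.algebra (carrier G) clopens"
proof (unfold algebra_iff_Un, intro conjI ballI)
  show "clopens \<subseteq> Pow (carrier G)" by (auto simp: clopens_def openin_iff)
  show "{} \<in> clopens" by (auto simp: clopens_def)
  fix a assume a: "a \<in> clopens"
  then show "carrier G - a \<in> clopens" unfolding clopens_def using topspace_eq
    by (metis (no_types, lifting) closedin_diff closedin_topspace mem_Collect_eq openin_diff openin_topspace)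
  fix b assume "b \<in> clopens" with a show "a \<union> b \<in> clopens" by (auto simp: clopens_def)
qed

text \<open>Countably many levels of finite index have countably many cosets, so every open set is a
  countable union of clopen ones.\<close>

lemma sigma_clopens: "sets (borel_of T) = sigma_sets (carrier G) clopens"
proof
  show "sigma_sets (carrier G) clopens \<subseteq> sets (borel_of T)"
    unfolding sets_borel_of topspace_eq
    by (rule sigma_sets_mono) (auto simp: clopens_def)
  show "sets (borel_of T) \<subseteq> sigma_sets (carrier G) clopens"
    unfolding sets_borel_of topspace_eq
  proof (rule sigma_sets_mono, rule subsetI)
    fix U assume "U \<in> {U. openin T U}"
    then have U: "openin T U" by simp
    let ?\<C> = "{C \<in> (\<Union>I\<in>\<A>. rcosets (H I)). C \<subseteq> U}"
    have "countable (\<Union>I\<in>\<A>. rcosets (H I))"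
      by (rule countable_UN[OF countable_levels]) (simp add: finite_rcosets countable_finite)
    then have "countable ?\<C>" by (rule countable_subset[rotated]) blast
    moreover have "?\<C> \<subseteq> sigma_sets (carrier G) clopens" using rcosets_clopen by auto
    moreover have "U = \<Union>?\<C>"
    proof
      show "U \<subseteq> \<Union>?\<C>"
      proof
        fix x assume x: "x \<in> U"
        then obtain I where I: "I \<in> \<A>" "H I #> x \<subseteq> U" "x \<in> carrier G"
          using U unfolding openin_iff by blast
        then show "x \<in> \<Union>?\<C>" using coset_self[of I x] by (auto simp: RCOSETS_def)
      qed
    qed blast
    ultimately show "U \<in> sigma_sets (carrier G) clopens"
      using sigma_sets_UNION[of ?\<C> "carrier G" clopens] by auto
  qed
qed

lemma clopen_sets: "U \<in> clopens \<Longrightarrow> U \<in> sets (borel_of T)"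
  by (simp add: sigma_clopens)

lemma clopen_subset: "U \<in> clopens \<Longrightarrow> U \<subseteq> carrier G"
  by (auto simp: clopens_def openin_iff)

lemma clopen_iff: "U \<in> clopens \<longleftrightarrow> compactin T U \<and> openin T U"
  using compact hausdorff by (auto simp: clopens_def closedin_compact_space compactin_imp_closedin)

lemma clopens_measure_eqI:
  assumes "sets M = sets (borel_of T)" "sets N = sets (borel_of T)"
    and "\<And>U. U \<in> clopens \<Longrightarrow> emeasure M U = emeasure N U" "emeasure M (carrier G) \<noteq> \<infinity>"
  shows "M = N"
proof (rule measure_eqI_generator_eq[where E = clopens and \<Omega> = "carrier G" and A = "\<lambda>_. carrier G"])
  interpret Sigma_Algebra.algebra "carrier G" clopens by (rule algebra_clopens)
  show "Int_stable clopens" by (auto simp: Int_stable_def)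
  show "clopens \<subseteq> Pow (carrier G)" using clopen_subset by auto
  show "range (\<lambda>_. carrier G) \<subseteq> clopens" by auto
qed (use assms sigma_clopens in auto)

lemma clopens_additive_eqI:
  fixes f g :: "'a set \<Rightarrow> ennreal"
  assumes add: "\<And>U V. U \<in> clopens \<Longrightarrow> V \<in> clopens \<Longrightarrow> U \<inter> V = {} \<Longrightarrow> f (U \<union> V) = f U + f V"
      "\<And>U V. U \<in> clopens \<Longrightarrow> V \<in> clopens \<Longrightarrow> U \<inter> V = {} \<Longrightarrow> g (U \<union> V) = g U + g V"
    and empty: "f {} = 0" "g {} = 0"
    and fin: "finite \<C>" "\<And>C. C \<in> \<C> \<Longrightarrow> C \<in> clopens" "disjoint \<C>"
    and eq: "\<And>C. C \<in> \<C> \<Longrightarrow> f C = g C"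
  shows "\<Union>\<C> \<in> clopens \<and> f (\<Union>\<C>) = g (\<Union>\<C>)"
  using fin eq
proof (induction \<C>)
  case empty then show ?case using assms(3,4) by (auto simp: clopens_def)
next
  case (insert C \<C>)
  then have IH: "\<Union>\<C> \<in> clopens" "f (\<Union>\<C>) = g (\<Union>\<C>)" by (auto simp: pairwise_insert)
  have C: "C \<in> clopens" "f C = g C" using insert.prems by auto
  have dis: "C \<inter> \<Union>\<C> = {}" using insert.prems(2) insert.hyps(2) by (auto simp: pairwise_insert disjnt_def)
  interpret Sigma_Algebra.algebra "carrier G" clopens by (rule algebra_clopens)
  show ?case using add[OF C(1) IH(1) dis] C IH by auto
qed

text \<open>Countable additivity comes for free on clopen sets: when a disjoint sequence has a
  clopen union, compactness lets finitely many members cover it, and the others are then empty. This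
  is how values obtained as limits of measures, which are only finitely additive, become a
  measure.\<close>

lemma content_extension:
  fixes f :: "'a set \<Rightarrow> ennreal"
  assumes empty: "f {} = 0"
    and add: "\<And>U V. U \<in> clopens \<Longrightarrow> V \<in> clopens \<Longrightarrow> U \<inter> V = {} \<Longrightarrow> f (U \<union> V) = f U + f V"
  shows "\<exists>M. sets M = sets (borel_of T) \<and> (\<forall>U\<in>clopens. emeasure M U = f U)"
proof -
  interpret Sigma_Algebra.algebra "carrier G" clopens by (rule algebra_clopens)
  have fadd: "f (\<Union>i<n. B i) = (\<Sum>i<n. f (B i))"
    if "disjoint_family B" "range B \<subseteq> clopens" for B :: "nat \<Rightarrow> 'a set" and n
  proof (induction n)
    case 0 then show ?case using empty by simp
  next
    case (Suc n)
    have 1: "(\<Union>i<n. B i) \<in> clopens" "B n \<in> clopens" using that(2) by auto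
    have "B n \<inter> B i = {}" if "i < n" for i
      using disjoint_family_onD[OF \<open>disjoint_family B\<close>, of n i] that by simp
    then have 2: "B n \<inter> (\<Union>i<n. B i) = {}" by blast
    have "(\<Union>i<Suc n. B i) = B n \<union> (\<Union>i<n. B i)" by (auto simp: less_Suc_eq)
    then show ?case using add[OF 1(2,1) 2] Suc by (simp add: add.commute)
  qed
  have "countably_additive clopens f"
  proof (rule countably_additiveI)
    fix B :: "nat \<Rightarrow> 'a set"
    assume B: "range B \<subseteq> clopens" "disjoint_family B" "(\<Union>i. B i) \<in> clopens"
    have 1: "compactin T (\<Union>i. B i)" using B(3) clopen_iff by blast
    have 2: "\<forall>U\<in>range B. openin T U" using B(1) unfolding clopens_def by blast
    obtain F where F: "finite F" "F \<subseteq> range B" "(\<Union>i. B i) \<subseteq> \<Union>F"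
      using 1[unfolded compactin_def, THEN conjunct2, rule_format, of "range B"] 2 by auto
    obtain S where S: "finite S" "F = B ` S" using finite_subset_image[OF F(1,2)] by auto
    obtain n where n: "\<forall>i\<in>S. i < n" using S(1) finite_nat_set_iff_bounded by blast
    \<comment> \<open>A later member is disjoint from every chosen one, yet lies in their
      union.\<close>
    have "B i = {}" if "i \<ge> n" for i
    proof -
      have "B i \<inter> B j = {}" if "j \<in> S" for j
        using disjoint_family_onD[OF B(2), of i j] n that \<open>i \<ge> n\<close> by fastforce
      then show ?thesis using F(3) S(2) by blast
    qed
    then have emp: "B i = {}" if "i \<notin> {..<n}" for i using that by simp
    have "(\<Union>i. B i) = (\<Union>i<n. B i)" using emp by blast
    moreover have "\<And>i. i \<notin> {..<n} \<Longrightarrow> f (B i) = 0" using empty emp by simp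
    ultimately show "suminf (\<lambda>i. f (B i)) = f (\<Union>i. B i)"
      using fadd[OF B(2,1), of n] suminf_finite[of "{..<n}" "\<lambda>i. f (B i)"] by simp
  qed
  then obtain \<mu> where \<mu>: "\<forall>s\<in>clopens. \<mu> s = f s" "measure_space (carrier G) (sigma_sets (carrier G) clopens) \<mu>"
    using caratheodory'[of f] empty by (auto simp: positive_def)
  let ?M = "measure_of (carrier G) (sigma_sets (carrier G) clopens) \<mu>"
  interpret S: sigma_algebra "carrier G" "sigma_sets (carrier G) clopens"
    using \<mu>(2) by (simp add: measure_space_def)
  have 1: "sets ?M = sigma_sets (carrier G) clopens" by (rule S.sets_measure_of_eq)
  have "emeasure ?M U = \<mu> U" if "U \<in> clopens" for U
    using \<mu>(2) that by (intro emeasure_measure_of_sigma) (auto simp: measure_space_def)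
  then show ?thesis using 1 \<mu>(1) sigma_clopens by (intro exI[of _ ?M]) auto
qed

section \<open>Coset counting: indices, relative indices and densities\<close>

definition index :: "'i \<Rightarrow> nat" where "index I = card (rcosets (H I))"

definition relative_index :: "'i \<Rightarrow> 'a set \<Rightarrow> nat" where
  "relative_index I U = card {C \<in> rcosets (H I). C \<subseteq> U}"

lemma index_pos: "I \<in> \<A> \<Longrightarrow> index I > 0"
  unfolding index_def using finite_rcosets[of I] rcosetsI[OF H_subset, of I \<one>]
  by (auto simp: card_gt_0_iff)

text \<open>Translation by \<open>x\<close>, undone by translation by \<open>inv x\<close>, matches
  the finer cosets inside \<open>H I\<close> with those inside its translate.\<close>

lemma relative_index_coset:
  assumes "K \<in> \<A>" "I \<in> \<A>" "x \<in> carrier G"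
  shows "relative_index K (H I #> x) = relative_index K (H I)"
proof -
  have shift: "C #> y \<in> {C \<in> rcosets (H K). C \<subseteq> B #> y}"
    if "C \<in> {C \<in> rcosets (H K). C \<subseteq> B}" "y \<in> carrier G" for C B y
  proof -
    have "C \<in> rcosets (H K)" "C \<subseteq> B" using that(1) by auto
    then obtain z where z: "z \<in> carrier G" "C = H K #> z" by (auto simp: RCOSETS_def)
    have "C #> y = H K #> (z \<otimes> y)" using z that H_subset[OF assms(1)] coset_mult_assoc by simp
    moreover have "C #> y \<subseteq> B #> y" using \<open>C \<subseteq> B\<close> by (auto simp: r_coset_def)
    ultimately show ?thesis using z that(2) by (auto simp: RCOSETS_def)
  qed
  have Hx: "(H I #> x) #> inv x = H I"
    using assms H_subset by (simp add: coset_mult_assoc)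
  have inv1: "(C #> x) #> inv x = C" "(C #> inv x) #> x = C" if "C \<in> rcosets (H K)" for C
  proof -
    have "C \<subseteq> carrier G" using that rcosets_clopen[OF assms(1)] clopen_subset by blast
    then show "(C #> x) #> inv x = C" "(C #> inv x) #> x = C"
      using assms by (simp_all add: coset_mult_assoc)
  qed
  have "bij_betw (\<lambda>C. C #> x) {C \<in> rcosets (H K). C \<subseteq> H I} {C \<in> rcosets (H K). C \<subseteq> H I #> x}"
  proof (rule bij_betwI[where g = "\<lambda>C. C #> inv x"])
    show "(\<lambda>C. C #> x) \<in> {C \<in> rcosets (H K). C \<subseteq> H I} \<rightarrow> {C \<in> rcosets (H K). C \<subseteq> H I #> x}"
      by (intro Pi_I shift assms(3))
    have "(\<lambda>C. C #> inv x) \<in> {C \<in> rcosets (H K). C \<subseteq> H I #> x}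
        \<rightarrow> {C \<in> rcosets (H K). C \<subseteq> (H I #> x) #> inv x}"
      by (intro Pi_I shift inv_closed assms(3))
    then show "(\<lambda>C. C #> inv x) \<in> {C \<in> rcosets (H K). C \<subseteq> H I #> x} \<rightarrow> {C \<in> rcosets (H K). C \<subseteq> H I}"
      by (simp only: Hx)
    show "(C #> x) #> inv x = C" if "C \<in> {C \<in> rcosets (H K). C \<subseteq> H I}" for C
      by (rule inv1(1)) (use that in blast)
    show "(C #> inv x) #> x = C" if "C \<in> {C \<in> rcosets (H K). C \<subseteq> H I #> x}" for C
      by (rule inv1(2)) (use that in blast)
  qed
  from bij_betw_same_card[OF this] show ?thesis unfolding relative_index_def by (rule sym)
qed

text \<open>The tower law for indices. Sort the \<open>K\<close>-cosets inside \<open>U\<close> by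
  the \<open>I\<close>-coset containing them; by translation every block is as large as the one for
  \<open>H I\<close>.\<close>

lemma relative_index_mult:
  assumes "K \<in> \<A>" "I \<in> \<A>" "H K \<subseteq> H I" "saturated I U"
  shows "relative_index K U = relative_index K (H I) * relative_index I U"
proof -
  let ?CI = "{C \<in> rcosets (H I). C \<subseteq> U}"
  have "{C \<in> rcosets (H K). C \<subseteq> U} = (\<Union>B\<in>?CI. {C \<in> rcosets (H K). C \<subseteq> B})"
  proof (intro equalityI subsetI)
    fix C assume "C \<in> {C \<in> rcosets (H K). C \<subseteq> U}"
    then obtain x where x: "x \<in> carrier G" "C = H K #> x" "C \<subseteq> U" by (auto simp: RCOSETS_def)
    then have "x \<in> U" using coset_self[OF assms(1)] by auto
    then have "H I #> x \<in> ?CI" using x(1) assms(4) by (auto simp: saturated_def RCOSETS_def)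
    moreover have "C \<subseteq> H I #> x" using x coset_mono assms(3) by simp
    ultimately show "C \<in> (\<Union>B\<in>?CI. {C \<in> rcosets (H K). C \<subseteq> B})"
      using x by (auto simp: RCOSETS_def)
  qed blast
  then have "relative_index K U = card (\<Union>B\<in>?CI. {C \<in> rcosets (H K). C \<subseteq> B})"
    by (simp add: relative_index_def)
  also have "\<dots> = (\<Sum>B\<in>?CI. card {C \<in> rcosets (H K). C \<subseteq> B})"
  proof (rule card_UN_disjoint)
    show "finite ?CI" using finite_rcosets[OF assms(2)] by simp
    show "\<forall>B\<in>?CI. finite {C \<in> rcosets (H K). C \<subseteq> B}" using finite_rcosets[OF assms(1)] by simp
    show "\<forall>B\<in>?CI. \<forall>B'\<in>?CI. B \<noteq> B' \<longrightarrow>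
        {C \<in> rcosets (H K). C \<subseteq> B} \<inter> {C \<in> rcosets (H K). C \<subseteq> B'} = {}"
    proof (intro ballI impI)
      fix B B' assume B: "B \<in> ?CI" "B' \<in> ?CI" "B \<noteq> B'"
      have "False" if "C \<in> rcosets (H K)" "C \<subseteq> B" "C \<subseteq> B'" for C
      proof -
        have "C \<noteq> {}" using that(1) coset_self[OF assms(1)] by (auto simp: RCOSETS_def)
        then show False using that B rcosets_disjoint[OF assms(2), of B B'] by blast
      qed
      then show "{C \<in> rcosets (H K). C \<subseteq> B} \<inter> {C \<in> rcosets (H K). C \<subseteq> B'} = {}" by blast
    qed
  qed
  also have "\<dots> = (\<Sum>B\<in>?CI. relative_index K (H I))"
  proof (rule sum.cong)
    fix B assume "B \<in> ?CI"
    then obtain x where "x \<in> carrier G" "B = H I #> x" by (auto simp: RCOSETS_def)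
    then show "card {C \<in> rcosets (H K). C \<subseteq> B} = relative_index K (H I)"
      using relative_index_coset[OF assms(1,2)] by (simp add: relative_index_def)
  qed simp
  also have "\<dots> = relative_index K (H I) * relative_index I U" by (simp add: relative_index_def)
  finally show ?thesis .
qed

lemma relative_index_carrier: "I \<in> \<A> \<Longrightarrow> relative_index I (carrier G) = index I"
  unfolding relative_index_def index_def
  using rcosets_clopen clopen_subset by (metis (mono_tags, lifting) Collect_cong Collect_mem_eq)

definition density_at :: "'i \<Rightarrow> 'a set \<Rightarrow> real" where
  "density_at I U = real (relative_index I U) / real (index I)"

text \<open>Passing to a finer level multiplies numerator and denominator by the same factor, the
  number of \<open>K\<close>-cosets in \<open>H I\<close>.\<close>

lemma density_at_refine:
  assumes "K \<in> \<A>" "I \<in> \<A>" "H K \<subseteq> H I" "saturated I U"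
  shows "density_at K U = density_at I U"
proof -
  have 1: "index K = relative_index K (H I) * index I"
    using relative_index_mult[OF assms(1-3) saturated_carrier[OF assms(2)]]
      relative_index_carrier assms by simp
  have "relative_index K (H I) > 0" using index_pos[OF assms(1)] 1 by simp
  then show ?thesis unfolding density_at_def relative_index_mult[OF assms] 1 by simp
qed

text \<open>The arbitrary choice of level is harmless: two levels have a common refinement, where
  \<open>density_at_refine\<close> compares them.\<close>

definition clopen_density :: "'a set \<Rightarrow> real" where
  "clopen_density U = density_at (SOME I. I \<in> \<A> \<and> saturated I U) U"

lemma clopen_density_eq:
  assumes "I \<in> \<A>" "saturated I U" shows "clopen_density U = density_at I U"
proof -
  let ?J = "SOME I. I \<in> \<A> \<and> saturated I U"
  have J: "?J \<in> \<A>" "saturated ?J U" using someI[of "\<lambda>I. I \<in> \<A> \<and> saturated I U" I] assms by auto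
  obtain K where "K \<in> \<A>" "H K \<subseteq> H I \<inter> H ?J" using directed[OF assms(1) J(1)] by blast
  then show ?thesis unfolding clopen_density_def
    using density_at_refine[of K I U] density_at_refine[of K ?J U] assms J by auto
qed

lemma density_at_add:
  assumes "I \<in> \<A>" "saturated I U" "saturated I V" "U \<inter> V = {}"
  shows "density_at I (U \<union> V) = density_at I U + density_at I V"
proof -
  have "{C \<in> rcosets (H I). C \<subseteq> U \<union> V} = {C \<in> rcosets (H I). C \<subseteq> U} \<union> {C \<in> rcosets (H I). C \<subseteq> V}"
  proof (intro equalityI subsetI)
    fix C assume C: "C \<in> {C \<in> rcosets (H I). C \<subseteq> U \<union> V}"
    then obtain x where x: "x \<in> carrier G" "C = H I #> x" by (auto simp: RCOSETS_def)
    then have "x \<in> U \<union> V" using C coset_self[OF assms(1)] by auto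
    then have "C \<subseteq> U \<or> C \<subseteq> V" using x assms(2,3) by (auto simp: saturated_def)
    then show "C \<in> {C \<in> rcosets (H I). C \<subseteq> U} \<union> {C \<in> rcosets (H I). C \<subseteq> V}" using C by blast
  qed blast
  moreover have "{C \<in> rcosets (H I). C \<subseteq> U} \<inter> {C \<in> rcosets (H I). C \<subseteq> V} = {}"
  proof -
    have "C \<noteq> {}" if "C \<in> rcosets (H I)" for C
      using that coset_self[OF assms(1)] by (auto simp: RCOSETS_def)
    then show ?thesis using assms(4) by blast
  qed
  ultimately have "relative_index I (U \<union> V) = relative_index I U + relative_index I V"
    unfolding relative_index_def using finite_rcosets[OF assms(1)] by (simp add: card_Un_disjoint)
  then show ?thesis by (simp add: density_at_def add_divide_distrib)
qed

lemma density_at_empty: "I \<in> \<A> \<Longrightarrow> density_at I {} = 0"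
  using coset_self by (auto simp: density_at_def relative_index_def RCOSETS_def)

lemma density_at_coset:
  assumes "I \<in> \<A>" "x \<in> carrier G" shows "density_at I (H I #> x) = 1 / index I"
proof -
  have "{C \<in> rcosets (H I). C \<subseteq> H I #> x} = {H I #> x}"
  proof (intro equalityI subsetI)
    fix C assume C: "C \<in> {C \<in> rcosets (H I). C \<subseteq> H I #> x}"
    then obtain y where y: "y \<in> carrier G" "C = H I #> y" by (auto simp: RCOSETS_def)
    then have "y \<in> H I #> x" using C coset_self[OF assms(1)] by blast
    then show "C \<in> {H I #> x}" using y coset_eq[OF assms] by simp
  qed (use assms in \<open>auto simp: RCOSETS_def\<close>)
  then show ?thesis by (simp add: density_at_def relative_index_def)
qed

lemma common_level:
  assumes "U \<in> clopens" "V \<in> clopens" obtains I where "I \<in> \<A>" "saturated I U" "saturated I V"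
proof -
  obtain I J where "I \<in> \<A>" "saturated I U" "J \<in> \<A>" "saturated J V"
    using assms clopen_saturated by metis
  then show thesis using directed[of I J] saturated_mono that by (metis Int_subset_iff)
qed

section \<open>Haar measure: determined by cosets, constructed from densities\<close>

lemma measure_eqI_cosets:
  assumes "sets M = sets (borel_of T)" "sets N = sets (borel_of T)"
    and eq: "\<And>I x. I \<in> \<A> \<Longrightarrow> x \<in> carrier G \<Longrightarrow> emeasure M (H I #> x) = emeasure N (H I #> x)"
    and "emeasure M (carrier G) \<noteq> \<infinity>"
  shows "M = N"
proof (rule clopens_measure_eqI)
  fix U assume "U \<in> clopens"
  then obtain I where I: "I \<in> \<A>" "saturated I U" by (rule clopen_saturated)
  let ?\<C> = "{C \<in> rcosets (H I). C \<subseteq> U}"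
  have "\<Union>?\<C> \<in> clopens \<and> emeasure M (\<Union>?\<C>) = emeasure N (\<Union>?\<C>)"
  proof (rule clopens_additive_eqI)
    show "finite ?\<C>" using finite_rcosets[OF I(1)] by simp
    show "disjoint ?\<C>" using rcos_disjoint[OF subgroup[OF I(1)]] by (auto simp: pairwise_def)
    fix U V assume UV: "U \<in> clopens" "V \<in> clopens" "U \<inter> V = {}"
    show "emeasure M (U \<union> V) = emeasure M U + emeasure M V"
      using UV clopen_sets assms by (intro plus_emeasure[symmetric]) auto
    show "emeasure N (U \<union> V) = emeasure N U + emeasure N V"
      using UV clopen_sets assms by (intro plus_emeasure[symmetric]) auto
  qed (use I rcosets_clopen eq in \<open>auto simp: RCOSETS_def\<close>)
  then show "emeasure M U = emeasure N U" using saturated_Union_rcosets[OF I] by simp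
qed (use assms in auto)

lemma translate_coset:
  assumes "I \<in> \<A>" "x \<in> carrier G" "g \<in> carrier G"
  shows "(\<lambda>x. g \<otimes> x) ` (H I #> x) = H I #> (g \<otimes> x)"
  using assms H_subset[OF assms(1)]
  by (auto simp: r_coset_def image_iff) (metis m_lcomm subsetD)+

text \<open>The cosets of \<open>H I\<close> are translates of one another, hence equally heavy;
  they are finitely many and disjoint, and their masses add up to 1.\<close>

lemma haar_coset:
  assumes "is_normalized_haar G T M" "I \<in> \<A>" "x \<in> carrier G"
  shows "emeasure M (H I #> x) = ennreal (1 / index I)"
proof -
  have M: "sets M = sets (borel_of T)" "emeasure M (carrier G) = 1"
    "\<And>g A. g \<in> carrier G \<Longrightarrow> A \<in> sets M \<Longrightarrow> emeasure M ((\<lambda>x. g \<otimes> x) ` A) = emeasure M A"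
    using assms(1) topspace_eq by (auto simp: is_normalized_haar_def)
  have c: "emeasure M (H I #> y) = emeasure M (H I)" if "y \<in> carrier G" for y
    using M(3)[OF that, of "H I #> \<one>"] translate_coset[OF assms(2) one_closed that] that
      clopen_sets[OF coset_clopen[OF assms(2) one_closed]] M(1) coset_mult_one[OF H_subset[OF assms(2)]]
    by simp
  have "1 = emeasure M (\<Union>C\<in>rcosets (H I). C)"
    using rcosets_part_G[OF subgroup[OF assms(2)]] M by simp
  also have "\<dots> = (\<Sum>C\<in>rcosets (H I). emeasure M C)"
    using finite_rcosets[OF assms(2)] rcosets_clopen[OF assms(2)] clopen_sets M(1)
      rcos_disjoint[OF subgroup[OF assms(2)]]
    by (intro sum_emeasure[symmetric]) (auto simp: disjoint_family_on_def pairwise_def disjnt_def)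
  also have "\<dots> = (\<Sum>C\<in>rcosets (H I). emeasure M (H I))"
    using c by (intro sum.cong) (auto simp: RCOSETS_def)
  also have "\<dots> = of_nat (index I) * emeasure M (H I)" by (simp add: index_def)
  finally have "of_nat (index I) * emeasure M (H I) = 1" by simp
  then have "emeasure M (H I) = 1 / of_nat (index I)"
    using index_pos[OF assms(2)]
    by (metis ennreal_of_nat_neq_top ennreal_times_divide mult.commute mult_divide_eq_ennreal not_gr_zero of_nat_eq_0_iff times_divide_eq_left)
  also have "\<dots> = ennreal (1 / index I)"
    using index_pos[OF assms(2)] by (simp add: ennreal_of_nat_eq_real_of_nat divide_ennreal flip: ennreal_1)
  finally show ?thesis using c assms(3) by simp
qed

lemma haar_unique:
  assumes "is_normalized_haar G T M" "is_normalized_haar G T N" shows "M = N"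
proof (rule measure_eqI_cosets)
  show "emeasure M (carrier G) \<noteq> \<infinity>" using assms topspace_eq by (auto simp: is_normalized_haar_def)
qed (use assms haar_coset in \<open>auto simp: is_normalized_haar_def\<close>)

lemma translation_measurable:
  assumes "g \<in> carrier G" "sets M = sets (borel_of T)"
  shows "(\<lambda>x. g \<otimes> x) \<in> measurable M (borel_of T)"
  unfolding borel_of_def
proof (rule measurable_measure_of)
  have sp: "space M = carrier G" using sets_eq_imp_space_eq[OF assms(2)] topspace_eq by simp
  show "{U. openin T U} \<subseteq> Pow (topspace T)" by (auto dest: openin_subset)
  show "(\<lambda>x. g \<otimes> x) \<in> space M \<rightarrow> topspace T" using sp topspace_eq assms by auto
  fix U assume "U \<in> {U. openin T U}"
  then have U: "openin T U" by simp
  have "openin T ((\<lambda>x. g \<otimes> x) -` U \<inter> carrier G)"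
    unfolding openin_iff
  proof (intro conjI ballI)
    fix x assume x: "x \<in> (\<lambda>x. g \<otimes> x) -` U \<inter> carrier G"
    then obtain I where I: "I \<in> \<A>" "H I #> (g \<otimes> x) \<subseteq> U" using U unfolding openin_iff by blast
    then have "H I #> x \<subseteq> (\<lambda>x. g \<otimes> x) -` U \<inter> carrier G"
      using translate_coset[OF I(1) _ assms(1), of x] coset_subset[OF I(1)] x by blast
    then show "\<exists>I\<in>\<A>. H I #> x \<subseteq> (\<lambda>x. g \<otimes> x) -` U \<inter> carrier G" using I(1) by blast
  qed auto
  then show "(\<lambda>x. g \<otimes> x) -` U \<inter> space M \<in> sets M" using borel_of_open assms sp by simp
qed

text \<open>The density is additive because two clopen sets can be compared at a common level. Its
  extension has mass 1/index on each coset, a value that translation cannot change.\<close>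

lemma haar_exists: "\<exists>M. is_normalized_haar G T M"
proof -
  have "\<exists>M. sets M = sets (borel_of T) \<and> (\<forall>U\<in>clopens. emeasure M U = ennreal (clopen_density U))"
  proof (rule content_extension)
    obtain I where "I \<in> \<A>" using levels_nonempty by blast
    then show "ennreal (clopen_density {}) = 0"
      using clopen_density_eq[of I "{}"] density_at_empty by (simp add: saturated_def)
  next
    fix U V assume UV: "U \<in> clopens" "V \<in> clopens" "U \<inter> V = {}"
    obtain I where I: "I \<in> \<A>" "saturated I U" "saturated I V" using common_level UV by blast
    moreover have "saturated I (U \<union> V)" using I by (auto simp: saturated_def)
    ultimately have "clopen_density (U \<union> V) = clopen_density U + clopen_density V"
      using clopen_density_eq density_at_add UV(3) by simp
    moreover have "clopen_density W \<ge> 0" for W by (simp add: clopen_density_def density_at_def)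
    ultimately show "ennreal (clopen_density (U \<union> V)) = ennreal (clopen_density U) + ennreal (clopen_density V)"
      by simp
  qed
  then obtain M where M: "sets M = sets (borel_of T)" "\<And>U. U \<in> clopens \<Longrightarrow> emeasure M U = ennreal (clopen_density U)"
    by blast
  have coset: "emeasure M (H I #> x) = ennreal (1 / index I)" if "I \<in> \<A>" "x \<in> carrier G" for I x
    using M(2)[OF coset_clopen] clopen_density_eq[OF _ saturated_coset] density_at_coset that by simp
  obtain I where I: "I \<in> \<A>" using levels_nonempty by blast
  interpret Sigma_Algebra.algebra "carrier G" clopens by (rule algebra_clopens)
  have one: "emeasure M (carrier G) = 1"
    using M(2)[OF top] clopen_density_eq[OF I saturated_carrier[OF I]] index_pos[OF I]
    by (simp add: density_at_def relative_index_carrier[OF I])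
  have sp: "space M = carrier G" using sets_eq_imp_space_eq[OF M(1)] topspace_eq by simp
  have "emeasure M ((\<lambda>x. g \<otimes> x) ` A) = emeasure M A" if g: "g \<in> carrier G" and A: "A \<in> sets M" for g A
  proof -
    \<comment> \<open>The preimage of a set under translation by \<open>inv g\<close> is its
      translate by \<open>g\<close>, so the image measure along \<open>?f\<close> records the masses
      of translates.\<close>
    let ?f = "\<lambda>x. inv g \<otimes> x"
    have meas: "?f \<in> measurable M (borel_of T)" using translation_measurable[OF inv_closed[OF g] M(1)] .
    have pre: "?f -` B \<inter> space M = (\<lambda>x. g \<otimes> x) ` B" if "B \<subseteq> carrier G" for B
    proof (intro equalityI subsetI)
      fix x assume "x \<in> ?f -` B \<inter> space M"
      then show "x \<in> (\<lambda>x. g \<otimes> x) ` B" using g sp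
        by (intro image_eqI[of _ _ "inv g \<otimes> x"]) (auto simp: m_assoc[symmetric])
    next
      fix x assume "x \<in> (\<lambda>x. g \<otimes> x) ` B"
      then show "x \<in> ?f -` B \<inter> space M" using g sp that by (auto simp: m_assoc[symmetric] subset_iff)
    qed
    \<comment> \<open>Both measures give each coset mass 1/index; this carries invariance from
      cosets to all Borel sets.\<close>
    have "M = distr M (borel_of T) ?f"
    proof (rule measure_eqI_cosets)
      fix I x assume Ix: "I \<in> \<A>" "x \<in> carrier G"
      have "emeasure (distr M (borel_of T) ?f) (H I #> x) = emeasure M ((\<lambda>x. g \<otimes> x) ` (H I #> x))"
        using pre[OF coset_subset[OF Ix]] clopen_sets[OF coset_clopen[OF Ix]] meas
        by (simp add: emeasure_distr)
      also have "\<dots> = emeasure M (H I #> x)"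
        using translate_coset[OF Ix g] coset Ix g by simp
      finally show "emeasure M (H I #> x) = emeasure (distr M (borel_of T) ?f) (H I #> x)" by simp
    qed (use M one in auto)
    then have "emeasure M A = emeasure (distr M (borel_of T) ?f) A" by simp
    also have "\<dots> = emeasure M ((\<lambda>x. g \<otimes> x) ` A)"
      using pre[of A] A meas M(1) sets.sets_into_space[OF A] sp by (simp add: emeasure_distr)
    finally show ?thesis by simp
  qed
  then show ?thesis using M(1) one topspace_eq by (intro exI[of _ M]) (auto simp: is_normalized_haar_def)
qed

lemma normalized_haar: "is_normalized_haar G T (normalized_haar G T)"
  unfolding normalized_haar_def using haar_exists haar_unique by (metis theI)

lemma normalized_haar_unique: "is_normalized_haar G T M \<Longrightarrow> M = normalized_haar G T"
  using normalized_haar haar_unique by blast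

end

section \<open>Products of local measures\<close>

context profinite_group
begin

lemma space_haar: "space (normalized_haar G T) = carrier G"
  and sets_haar: "sets (normalized_haar G T) = sets (borel_of T)"
  and emeasure_haar_carrier: "emeasure (normalized_haar G T) (carrier G) = 1"
  using normalized_haar sets_eq_imp_space_eq[of "normalized_haar G T" "borel_of T"] topspace_eq
  by (auto simp: is_normalized_haar_def)

lemma finite_haar: "emeasure (normalized_haar G T) A < \<infinity>"
proof -
  have "emeasure (normalized_haar G T) A \<le> 1"
    using emeasure_space[of "normalized_haar G T" A] by (simp add: space_haar emeasure_haar_carrier)
  then show ?thesis by (simp add: order_le_less_trans)
qed

lemma haar_open_pos:
  assumes "openin T U" "U \<noteq> {}" shows "emeasure (normalized_haar G T) U \<noteq> 0"
proof -
  obtain x I where x: "x \<in> carrier G" "I \<in> \<A>" "H I #> x \<subseteq> U"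
    using assms unfolding openin_iff by blast
  have "0 < emeasure (normalized_haar G T) (H I #> x)"
    using haar_coset[OF normalized_haar x(2,1)] index_pos[OF x(2)] by simp
  also have "\<dots> \<le> emeasure (normalized_haar G T) U"
    using x(3) borel_of_open[OF assms(1)] by (intro emeasure_mono) (auto simp: sets_haar)
  finally show ?thesis by simp
qed

text \<open>An open set separating the unit from \<open>x\<close> contains some
  \<open>H I\<close>.\<close>

lemma H_trivial_Inter:
  assumes "x \<in> carrier G" "\<And>I. I \<in> \<A> \<Longrightarrow> x \<in> H I" shows "x = \<one>"
proof (rule ccontr)
  assume "x \<noteq> \<one>"
  then obtain U V where U: "openin T U" "\<one> \<in> U" "x \<notin> U"
    using hausdorff assms(1) topspace_eq unfolding Hausdorff_space_def disjnt_def
    by (metis disjoint_iff one_closed)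
  obtain I where I: "I \<in> \<A>" "H I #> \<one> \<subseteq> U" using U unfolding openin_iff by blast
  then show False using assms(2)[OF I(1)] U(3) H_subset[OF I(1)] by auto
qed

end

text \<open>The shape of a product decomposition, stated without a product space.
  \<open>cont\<close> says that each local level contains the image of a global one;
  \<open>cofinal\<close> is the converse, that finitely many local conditions force membership in a
  given global level. \<open>split\<close> asks for lifts supported at a single coordinate, which is
  what translating one coordinate while fixing the rest requires.\<close>

locale local_global = profinite_group G T \<A> H
  for G :: "('a, 'm) monoid_scheme" (structure) and T :: "'a topology" and \<A> :: "'i set" and H +
  fixes P :: "'p set" and L :: "'p \<Rightarrow> ('b, 'c) monoid_scheme" and TL :: "'p \<Rightarrow> 'b topology"
    and AL :: "'p \<Rightarrow> 'j set" and HL :: "'p \<Rightarrow> 'j \<Rightarrow> 'b set" and \<pi> :: "'p \<Rightarrow> 'a \<Rightarrow> 'b"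
  assumes loc: "p \<in> P \<Longrightarrow> profinite_group (L p) (TL p) (AL p) (HL p)"
    and hom: "p \<in> P \<Longrightarrow> \<pi> p \<in> hom G (L p)"
    and cont: "p \<in> P \<Longrightarrow> k \<in> AL p \<Longrightarrow> \<exists>J\<in>\<A>. \<pi> p ` H J \<subseteq> HL p k"
    and cofinal: "I \<in> \<A> \<Longrightarrow> \<exists>Q f. finite Q \<and> Q \<subseteq> P \<and> (\<forall>p\<in>Q. f p \<in> AL p) \<and>
        {x \<in> carrier G. \<forall>p\<in>Q. \<pi> p x \<in> HL p (f p)} \<subseteq> H I"
    and split: "p \<in> P \<Longrightarrow> g \<in> carrier (L p) \<Longrightarrow>
        \<exists>x\<in>carrier G. \<pi> p x = g \<and> (\<forall>q\<in>P - {p}. \<pi> q x = \<one>\<^bsub>L q\<^esub>)"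
begin

abbreviation \<mu> :: "'a measure" where "\<mu> \<equiv> normalized_haar G T"
abbreviation \<mu>L :: "'p \<Rightarrow> 'b measure" where "\<mu>L p \<equiv> normalized_haar (L p) (TL p)"

definition box :: "'p set \<Rightarrow> ('p \<Rightarrow> 'b set) \<Rightarrow> 'a set" where
  "box Q U = {x \<in> carrier G. \<forall>p\<in>Q. \<pi> p x \<in> U p}"

lemma group_hom: "p \<in> P \<Longrightarrow> group_hom G (L p) (\<pi> p)"
  using loc[of p] hom[of p] is_group
  by (simp add: group_hom_def group_hom_axioms_def profinite_group_def comm_group_def)

lemma \<pi>_closed: "p \<in> P \<Longrightarrow> x \<in> carrier G \<Longrightarrow> \<pi> p x \<in> carrier (L p)"
  using hom by (auto simp: hom_def)

lemma \<pi>_mult: "p \<in> P \<Longrightarrow> x \<in> carrier G \<Longrightarrow> y \<in> carrier G \<Longrightarrow> \<pi> p (x \<otimes> y) = \<pi> p x \<otimes>\<^bsub>L p\<^esub> \<pi> p y"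
  using hom by (auto simp: hom_def)

lemma \<pi>_coset:
  assumes "p \<in> P" "\<pi> p ` H J \<subseteq> HL p k" "J \<in> \<A>" "x \<in> carrier G" "y \<in> H J #> x"
  shows "\<pi> p y \<in> HL p k #>\<^bsub>L p\<^esub> \<pi> p x"
proof -
  obtain h where h: "h \<in> H J" "y = h \<otimes> x" using assms(5) by (auto simp: r_coset_def)
  then show ?thesis using assms \<pi>_mult[OF assms(1), of h x] H_subset[OF assms(3)]
    by (auto simp: r_coset_def)
qed

lemma openin_preimage:
  assumes "p \<in> P" "openin (TL p) U" shows "openin T {x \<in> carrier G. \<pi> p x \<in> U}"
  unfolding openin_iff
proof (intro conjI ballI)
  interpret Lp: profinite_group "L p" "TL p" "AL p" "HL p" using loc assms by simp
  fix x assume x: "x \<in> {x \<in> carrier G. \<pi> p x \<in> U}"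
  then obtain k where k: "k \<in> AL p" "HL p k #>\<^bsub>L p\<^esub> \<pi> p x \<subseteq> U"
    using assms(2) Lp.openin_iff by blast
  obtain J where J: "J \<in> \<A>" "\<pi> p ` H J \<subseteq> HL p k" using cont[OF assms(1) k(1)] by blast
  have "H J #> x \<subseteq> {x \<in> carrier G. \<pi> p x \<in> U}"
  proof
    fix y assume y: "y \<in> H J #> x"
    have "\<pi> p y \<in> U" using \<pi>_coset[OF assms(1) J(2,1) _ y] x k(2) by blast
    then show "y \<in> {x \<in> carrier G. \<pi> p x \<in> U}" using coset_subset[OF J(1), of x] x y by blast
  qed
  then show "\<exists>I\<in>\<A>. H I #> x \<subseteq> {x \<in> carrier G. \<pi> p x \<in> U}" using J(1) by blast
qed blast

lemma \<pi>_measurable: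
  assumes "p \<in> P" shows "\<pi> p \<in> measurable (borel_of T) (borel_of (TL p))"
  unfolding borel_of_def[of "TL p"]
proof (rule measurable_measure_of)
  interpret Lp: profinite_group "L p" "TL p" "AL p" "HL p" using loc assms by simp
  show "\<pi> p \<in> space (borel_of T) \<rightarrow> topspace (TL p)"
    using \<pi>_closed[OF assms] Lp.topspace_eq topspace_eq by auto
  fix U assume "U \<in> {U. openin (TL p) U}"
  then have "openin T {x \<in> carrier G. \<pi> p x \<in> U}" using openin_preimage[OF assms] by blast
  moreover have "\<pi> p -` U \<inter> space (borel_of T) = {x \<in> carrier G. \<pi> p x \<in> U}" using topspace_eq by auto
  ultimately show "\<pi> p -` U \<inter> space (borel_of T) \<in> sets (borel_of T)" using borel_of_open by metis
qed (auto dest: openin_subset)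

lemma box_empty: "box {} U = carrier G" by (simp add: box_def)

lemma box_insert: "box (insert p Q) U = {x \<in> carrier G. \<pi> p x \<in> U p} \<inter> box Q U"
  by (auto simp: box_def)

lemma preimage_sets:
  assumes "p \<in> P" "U \<in> sets (borel_of (TL p))" shows "{x \<in> carrier G. \<pi> p x \<in> U} \<in> sets (borel_of T)"
proof -
  have "\<pi> p -` U \<inter> space (borel_of T) = {x \<in> carrier G. \<pi> p x \<in> U}" using topspace_eq by auto
  then show ?thesis using measurable_sets[OF \<pi>_measurable[OF assms(1)] assms(2)] by simp
qed

lemma carrier_sets: "carrier G \<in> sets (borel_of T)"
  using sets.top[of "borel_of T"] topspace_eq by simp

lemma box_sets:
  assumes "finite Q" "Q \<subseteq> P" "\<And>p. p \<in> Q \<Longrightarrow> U p \<in> sets (borel_of (TL p))"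
  shows "box Q U \<in> sets (borel_of T)"
  using assms
  by (induction Q) (auto simp: box_empty box_insert carrier_sets intro!: sets.Int preimage_sets)

lemma clopen_preimage:
  assumes "p \<in> P" "openin (TL p) U" "closedin (TL p) U" shows "{x \<in> carrier G. \<pi> p x \<in> U} \<in> clopens"
proof -
  interpret Lp: profinite_group "L p" "TL p" "AL p" "HL p" using loc assms by simp
  have "openin T {x \<in> carrier G. \<pi> p x \<in> carrier (L p) - U}"
    using assms Lp.topspace_eq by (intro openin_preimage) (auto simp: closedin_def)
  also have "{x \<in> carrier G. \<pi> p x \<in> carrier (L p) - U} = carrier G - {x \<in> carrier G. \<pi> p x \<in> U}"
    using \<pi>_closed[OF assms(1)] by auto
  finally show ?thesis using openin_preimage[OF assms(1,2)] topspace_eq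
    by (auto simp: clopens_def closedin_def)
qed

lemma box_clopen:
  assumes "finite Q" "Q \<subseteq> P" "\<And>p. p \<in> Q \<Longrightarrow> openin (TL p) (U p)" "\<And>p. p \<in> Q \<Longrightarrow> closedin (TL p) (U p)"
  shows "box Q U \<in> clopens"
proof -
  interpret Sigma_Algebra.algebra "carrier G" clopens by (rule algebra_clopens)
  show ?thesis using assms
    by (induction Q) (auto simp: box_empty box_insert intro!: clopen_preimage Int)
qed

text \<open>Only translations supported at one coordinate appear: these are the elements that
  \<open>split\<close> provides, and \<open>haar_box_Int\<close> treats the coordinates one at a
  time.\<close>

definition invariant :: "'p set \<Rightarrow> 'a set \<Rightarrow> bool" where
  "invariant Q B \<longleftrightarrow> (\<forall>p\<in>Q. \<forall>b\<in>B. \<forall>x\<in>carrier G. (\<forall>q\<in>P - {p}. \<pi> q x = \<one>\<^bsub>L q\<^esub>) \<longrightarrow> x \<otimes> b \<in> B)"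

text \<open>Normalizing \<open>V \<mapsto> \<mu> ({x. \<pi> p x \<in> V} \<inter> B)\<close> gives a Haar measure on \<open>L p\<close>, because translation by an element
  supported at \<open>p\<close> preserves \<open>B\<close>; so it is the Haar measure.\<close>

lemma haar_preimage_Int:
  assumes p: "p \<in> P" and V: "V \<in> sets (borel_of (TL p))" and B: "B \<in> sets (borel_of T)"
    and inv: "invariant {p} B"
  shows "emeasure \<mu> ({x \<in> carrier G. \<pi> p x \<in> V} \<inter> B) = emeasure (\<mu>L p) V * emeasure \<mu> B"
proof (cases "emeasure \<mu> B = 0")
  case True
  then have "emeasure \<mu> ({x \<in> carrier G. \<pi> p x \<in> V} \<inter> B) = 0"
    using emeasure_mono[of "{x \<in> carrier G. \<pi> p x \<in> V} \<inter> B" B \<mu>] B by (simp add: sets_haar)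
  then show ?thesis using True by simp
next
  case False
  interpret Lp: profinite_group "L p" "TL p" "AL p" "HL p" using loc p by simp
  have Bc: "B \<subseteq> carrier G" using sets.sets_into_space[OF B] topspace_eq by simp
  have fin: "emeasure \<mu> B \<noteq> \<infinity>" using finite_haar by (metis less_irrefl)
  have meas: "\<pi> p \<in> measurable (uniform_measure \<mu> B) (borel_of (TL p))"
    using \<pi>_measurable[OF p] sets_haar by (simp cong: measurable_cong_sets)
  \<comment> \<open>The law of the coordinate at \<open>p\<close> under Haar measure conditioned on
    \<open>B\<close>.\<close>
  let ?N = "distr (uniform_measure \<mu> B) (borel_of (TL p)) (\<pi> p)"
  have N: "emeasure ?N W = emeasure \<mu> ({x \<in> carrier G. \<pi> p x \<in> W} \<inter> B) / emeasure \<mu> B"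
    if W: "W \<in> sets (borel_of (TL p))" for W
  proof -
    have "\<pi> p -` W \<inter> space \<mu> = {x \<in> carrier G. \<pi> p x \<in> W}" by (auto simp: space_haar)
    then show ?thesis using W B preimage_sets[OF p W]
      by (simp add: emeasure_distr[OF meas] emeasure_uniform_measure sets_haar Int_commute)
  qed
  have "is_normalized_haar (L p) (TL p) ?N"
    unfolding is_normalized_haar_def
  proof (intro conjI ballI)
    show "sets ?N = sets (borel_of (TL p))" by simp
    have "{x \<in> carrier G. \<pi> p x \<in> carrier (L p)} \<inter> B = B" using Bc \<pi>_closed[OF p] by auto
    then show "emeasure ?N (topspace (TL p)) = 1"
      using N[of "topspace (TL p)"] sets.top[of "borel_of (TL p)"] False fin Lp.topspace_eq
      by (simp add: ennreal_divide_self less_top)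
    fix g W assume g: "g \<in> carrier (L p)" and "W \<in> sets ?N"
    then have W: "W \<in> sets (borel_of (TL p))" by simp
    have Wc: "W \<subseteq> carrier (L p)" using sets.sets_into_space[OF W] Lp.topspace_eq by simp
    obtain x where x: "x \<in> carrier G" "\<pi> p x = g" "\<forall>q\<in>P - {p}. \<pi> q x = \<one>\<^bsub>L q\<^esub>"
      using split[OF p g] by blast
    have inv_x: "\<pi> q (inv x) = inv\<^bsub>L q\<^esub> (\<pi> q x)" if "q \<in> P" for q
      using group_hom.hom_inv[OF group_hom[OF that] x(1)] .
    \<comment> \<open>The inverse is supported at \<open>p\<close> too, so it also maps
      \<open>B\<close> into \<open>B\<close>; this turns the inclusion of translated slices below
      into an equality.\<close>
    have inv_x1: "\<forall>q\<in>P - {p}. \<pi> q (inv x) = \<one>\<^bsub>L q\<^esub>"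
      using inv_x x(3) loc by (auto simp: profinite_group_def comm_group_def group_def monoid.inv_one)
    have gW: "(\<lambda>y. g \<otimes>\<^bsub>L p\<^esub> y) ` W \<in> sets (borel_of (TL p))"
    proof -
      have "(\<lambda>y. g \<otimes>\<^bsub>L p\<^esub> y) ` W = (\<lambda>y. inv\<^bsub>L p\<^esub> g \<otimes>\<^bsub>L p\<^esub> y) -` W \<inter> space (borel_of (TL p))"
      proof (intro equalityI subsetI)
        fix y assume "y \<in> (\<lambda>y. inv\<^bsub>L p\<^esub> g \<otimes>\<^bsub>L p\<^esub> y) -` W \<inter> space (borel_of (TL p))"
        then show "y \<in> (\<lambda>y. g \<otimes>\<^bsub>L p\<^esub> y) ` W" using g Lp.topspace_eq
          by (intro image_eqI[of _ _ "inv\<^bsub>L p\<^esub> g \<otimes>\<^bsub>L p\<^esub> y"]) (auto simp: Lp.m_assoc[symmetric])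
      next
        fix y assume "y \<in> (\<lambda>y. g \<otimes>\<^bsub>L p\<^esub> y) ` W"
        then show "y \<in> (\<lambda>y. inv\<^bsub>L p\<^esub> g \<otimes>\<^bsub>L p\<^esub> y) -` W \<inter> space (borel_of (TL p))"
          using g Lp.topspace_eq Wc by (auto simp: Lp.m_assoc[symmetric] subset_iff)
      qed
      then show ?thesis
        using measurable_sets[OF Lp.translation_measurable[OF Lp.inv_closed[OF g] refl] W] by simp
    qed
    have "(\<lambda>y. x \<otimes> y) ` ({y \<in> carrier G. \<pi> p y \<in> W} \<inter> B) =
        {y \<in> carrier G. \<pi> p y \<in> (\<lambda>y. g \<otimes>\<^bsub>L p\<^esub> y) ` W} \<inter> B" (is "_ ` ?S = ?R")
    proof (intro equalityI subsetI)
      fix y assume "y \<in> (\<lambda>y. x \<otimes> y) ` ?S"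
      then show "y \<in> ?R" using x inv p by (auto simp: \<pi>_mult invariant_def)
    next
      fix y assume y: "y \<in> ?R"
      then obtain w where w: "w \<in> W" "\<pi> p y = g \<otimes>\<^bsub>L p\<^esub> w" by blast
      have yc: "y \<in> carrier G" "y \<in> B" using y by auto
      have "\<pi> p (inv x \<otimes> y) = inv\<^bsub>L p\<^esub> g \<otimes>\<^bsub>L p\<^esub> (g \<otimes>\<^bsub>L p\<^esub> w)"
        using x(1,2) yc p w(2) inv_x[OF p] by (simp add: \<pi>_mult)
      also have "\<dots> = w" using g w(1) Wc by (auto simp: Lp.m_assoc[symmetric] subset_iff)
      finally have "inv x \<otimes> y \<in> ?S" using w(1) inv inv_x1 x(1) yc unfolding invariant_def by auto
      then show "y \<in> (\<lambda>y. x \<otimes> y) ` ?S"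
        using x(1) yc by (intro image_eqI[of _ _ "inv x \<otimes> y"]) (auto simp: m_assoc[symmetric])
    qed
    moreover have "emeasure \<mu> ((\<lambda>y. x \<otimes> y) ` ?S) = emeasure \<mu> ?S" if "?S \<in> sets \<mu>" for S
      using normalized_haar x(1) that unfolding is_normalized_haar_def by blast
    moreover have "?S \<in> sets \<mu>" using preimage_sets[OF p W] B by (simp add: sets_haar)
    ultimately have "emeasure \<mu> ?S = emeasure \<mu> ?R" by simp
    then show "emeasure ?N ((\<lambda>y. g \<otimes>\<^bsub>L p\<^esub> y) ` W) = emeasure ?N W" using N[OF gW] N[OF W] by simp
  qed
  then have "?N = \<mu>L p" by (rule Lp.normalized_haar_unique)
  then have "emeasure (\<mu>L p) V = emeasure \<mu> ({x \<in> carrier G. \<pi> p x \<in> V} \<inter> B) / emeasure \<mu> B"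
    using N[OF V] by simp
  then show ?thesis using False fin by (simp add: ennreal_divide_times ennreal_divide_self top.not_eq_extremum)
qed

text \<open>A translation supported at \<open>q\<close> does not move the coordinate at
  \<open>p\<close>, so a condition on that coordinate survives it.\<close>

lemma invariant_preimage_Int:
  assumes "p \<in> P" "invariant {q} B" "q \<noteq> p" "B \<subseteq> carrier G"
  shows "invariant {q} ({x \<in> carrier G. \<pi> p x \<in> V} \<inter> B)"
proof -
  interpret Lp: profinite_group "L p" "TL p" "AL p" "HL p" using loc assms by simp
  have "\<pi> p (x \<otimes> b) = \<pi> p b" if "x \<in> carrier G" "b \<in> B" "\<pi> p x = \<one>\<^bsub>L p\<^esub>" for x b
    using that assms \<pi>_mult[OF assms(1), of x b] \<pi>_closed[OF assms(1), of b] by auto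
  then show ?thesis using assms by (auto simp: invariant_def subset_iff)
qed

text \<open>Coordinates are peeled off one at a time. For \<open>p\<close> outside \<open>Q\<close>
  the box over \<open>Q\<close> constrains only coordinates other than \<open>p\<close>, so
  \<open>box Q U \<inter> B\<close> is still invariant at \<open>p\<close> and
  \<open>haar_preimage_Int\<close> applies to it.\<close>

lemma haar_box_Int:
  assumes "finite Q" "Q \<subseteq> P" "\<And>p. p \<in> Q \<Longrightarrow> U p \<in> sets (borel_of (TL p))"
    and "B \<in> sets (borel_of T)" "invariant Q B"
  shows "emeasure \<mu> (box Q U \<inter> B) = (\<Prod>p\<in>Q. emeasure (\<mu>L p) (U p)) * emeasure \<mu> B"
  using assms
proof (induction Q)
  case empty
  then have "B \<subseteq> carrier G" using sets.sets_into_space[of B "borel_of T"] topspace_eq by simp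
  then show ?case by (simp add: box_empty Int_absorb1)
next
  case (insert p Q)
  have Bc: "B \<subseteq> carrier G" using sets.sets_into_space[OF insert.prems(3)] topspace_eq by simp
  have inv: "invariant {q} B" if "q \<in> insert p Q" for q using insert.prems(4) that by (auto simp: invariant_def)
  have "invariant {p} (box Q U \<inter> B)"
    using insert.hyps insert.prems(1)
  proof (induction Q)
    case empty
    then show ?case using inv[of p] Bc by (simp add: box_empty Int_absorb1)
  next
    case (insert q Q)
    then show ?case using invariant_preimage_Int[of q p "box Q U \<inter> B" "U q"] Bc
      by (auto simp: box_insert Int_assoc)
  qed
  moreover have "box Q U \<inter> B \<in> sets (borel_of T)" using insert.prems insert.hyps by (auto intro: box_sets)
  ultimately have "emeasure \<mu> (box (insert p Q) U \<inter> B) = emeasure (\<mu>L p) (U p) * emeasure \<mu> (box Q U \<inter> B)"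
    using haar_preimage_Int[of p "U p" "box Q U \<inter> B"] insert.prems by (simp add: box_insert Int_assoc)
  moreover have "invariant Q B" using insert.prems(4) by (auto simp: invariant_def)
  ultimately show ?case using insert by (simp add: mult.assoc)
qed

end

section \<open>Clopen sets as disjoint unions of boxes\<close>

context local_global
begin

text \<open>By \<open>cofinal\<close>, finitely many local kernels cut out a neighbourhood of the
  unit inside the level of \<open>U\<close>. The boxes of local cosets at these coordinates are
  pairwise equal or disjoint, finitely many since local levels have finite index, and contained in
  \<open>U\<close> once they pass through a point of \<open>U\<close>.\<close>

lemma box_partition:
  assumes "U \<in> clopens"
  obtains Q \<C> where "finite Q" "Q \<subseteq> P" "finite \<C>" "disjoint \<C>" "\<Union>\<C> = U"
    "\<And>C. C \<in> \<C> \<Longrightarrow> \<exists>V. (\<forall>p\<in>Q. openin (TL p) (V p) \<and> closedin (TL p) (V p)) \<and> C = box Q V"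
proof -
  obtain I where I: "I \<in> \<A>" "saturated I U" using assms by (rule clopen_saturated)
  obtain Q f where Q: "finite Q" "Q \<subseteq> P" "\<And>p. p \<in> Q \<Longrightarrow> f p \<in> AL p" "box Q (\<lambda>p. HL p (f p)) \<subseteq> H I"
    using cofinal[OF I(1)] unfolding box_def by blast
  have Qloc: "profinite_group (L p) (TL p) (AL p) (HL p)" if "p \<in> Q" for p using loc Q(2) that by blast
  define V where "V a p = HL p (f p) #>\<^bsub>L p\<^esub> \<pi> p a" for a p
  have Uc: "U \<subseteq> carrier G" using clopen_subset assms by blast
  have V_clopen: "openin (TL p) (V a p)" "closedin (TL p) (V a p)" if "p \<in> Q" "a \<in> carrier G" for p a
  proof -
    interpret Lp: profinite_group "L p" "TL p" "AL p" "HL p" using Qloc that by simp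
    have "V a p \<in> Lp.clopens"
      unfolding V_def using Lp.coset_clopen Q(2,3) that \<pi>_closed by blast
    then show "openin (TL p) (V a p)" "closedin (TL p) (V a p)" by (auto simp: Lp.clopens_def)
  qed
  have self: "a \<in> box Q (V a)" if "a \<in> carrier G" for a
    unfolding box_def
  proof (intro CollectI conjI ballI)
    fix p assume p: "p \<in> Q"
    interpret Lp: profinite_group "L p" "TL p" "AL p" "HL p" using Qloc p by simp
    show "\<pi> p a \<in> V a p" unfolding V_def using Lp.coset_self Q(2,3) p that \<pi>_closed by blast
  qed (rule that)
  have V_eq: "V b p = V a p" if "p \<in> Q" "a \<in> carrier G" "b \<in> box Q (V a)" for a b p
  proof -
    interpret Lp: profinite_group "L p" "TL p" "AL p" "HL p" using Qloc that by simp
    have "\<pi> p b \<in> HL p (f p) #>\<^bsub>L p\<^esub> \<pi> p a" using that by (auto simp: box_def V_def)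
    then show ?thesis unfolding V_def using Lp.coset_eq Q(2,3) that \<pi>_closed by blast
  qed
  have box_eq: "box Q (V b) = box Q (V a)" if "a \<in> carrier G" "b \<in> box Q (V a)" for a b
    using V_eq[OF _ that] by (auto simp: box_def)
  have sub: "box Q (V a) \<subseteq> U" if a: "a \<in> U" for a
  proof
    fix b assume b: "b \<in> box Q (V a)"
    have c: "a \<in> carrier G" "b \<in> carrier G" using a Uc b by (auto simp: box_def)
    \<comment> \<open>Two points of one box differ by an element of the local kernel at every
      coordinate of \<open>Q\<close>, hence by an element of \<open>H I\<close>.\<close>
    have "b \<otimes> inv a \<in> box Q (\<lambda>p. HL p (f p))"
      unfolding box_def
    proof (intro CollectI conjI ballI)
      fix p assume p: "p \<in> Q"
      interpret Lp: profinite_group "L p" "TL p" "AL p" "HL p" using Qloc p by simp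
      interpret h: group_hom G "L p" "\<pi> p" using group_hom p Q(2) by blast
      have "\<pi> p b \<in> HL p (f p) #>\<^bsub>L p\<^esub> \<pi> p a" using b p by (auto simp: box_def V_def)
      then obtain h where h: "h \<in> HL p (f p)" "\<pi> p b = h \<otimes>\<^bsub>L p\<^esub> \<pi> p a" by (auto simp: r_coset_def)
      have "h \<in> carrier (L p)" using h(1) Lp.H_subset[OF Q(3)[OF p]] by blast
      then have "\<pi> p (b \<otimes> inv a) = h" using c h(2) by (simp add: Lp.m_assoc)
      then show "\<pi> p (b \<otimes> inv a) \<in> HL p (f p)" using h by simp
    qed (use c in simp)
    then have "b \<otimes> inv a \<in> H I" using Q(4) by blast
    then have "(b \<otimes> inv a) \<otimes> a \<in> H I #> a" by (auto simp: r_coset_def)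
    then have "b \<in> H I #> a" using c by (simp add: m_assoc)
    then show "b \<in> U" using a I(2) by (auto simp: saturated_def)
  qed
  let ?\<C> = "(\<lambda>a. box Q (V a)) ` U"
  \<comment> \<open>Restricting the family of cosets to \<open>Q\<close> leaves the box unchanged
    and places the family in a finite dependent product, which bounds the number of boxes.\<close>
  have "?\<C> \<subseteq> box Q ` (\<Pi>\<^sub>E p\<in>Q. rcosets\<^bsub>L p\<^esub> (HL p (f p)))"
  proof
    fix C assume "C \<in> ?\<C>"
    then obtain a where a: "a \<in> U" "C = box Q (V a)" by blast
    have "V a p \<in> rcosets\<^bsub>L p\<^esub> (HL p (f p))" if "p \<in> Q" for p
      unfolding V_def RCOSETS_def using that a Uc \<pi>_closed Q(2) by blast
    then have "restrict (V a) Q \<in> (\<Pi>\<^sub>E p\<in>Q. rcosets\<^bsub>L p\<^esub> (HL p (f p)))" by auto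
    moreover have "C = box Q (restrict (V a) Q)" using a(2) by (auto simp: box_def)
    ultimately show "C \<in> box Q ` (\<Pi>\<^sub>E p\<in>Q. rcosets\<^bsub>L p\<^esub> (HL p (f p)))" by blast
  qed
  moreover have "finite (\<Pi>\<^sub>E p\<in>Q. rcosets\<^bsub>L p\<^esub> (HL p (f p)))"
    using Q(1,3) profinite_group.finite_rcosets[OF Qloc] by (intro finite_PiE) auto
  ultimately have fin: "finite ?\<C>" by (meson finite_subset finite_imageI)
  show thesis
  proof (rule that[OF Q(1,2) fin])
    show "disjoint ?\<C>"
    proof (rule pairwiseI)
      fix A B assume "A \<in> ?\<C>" "B \<in> ?\<C>" "A \<noteq> B"
      then obtain a b where ab: "a \<in> U" "b \<in> U" "A = box Q (V a)" "B = box Q (V b)" by blast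
      have "A = B" if "x \<in> A" "x \<in> B" for x
        using box_eq[of a x] box_eq[of b x] that ab Uc by blast
      then show "disjnt A B" using \<open>A \<noteq> B\<close> by (auto simp: disjnt_def)
    qed
    show "\<Union>?\<C> = U" using sub self Uc by blast
    fix C assume "C \<in> ?\<C>"
    then show "\<exists>V. (\<forall>p\<in>Q. openin (TL p) (V p) \<and> closedin (TL p) (V p)) \<and> C = box Q V"
      using V_clopen Uc by blast
  qed
qed

lemma clopen_emeasure_eq_sum:
  assumes "finite \<C>" "disjoint \<C>" "\<C> \<subseteq> clopens" "sets M = sets (borel_of T)"
  shows "emeasure M (\<Union>\<C>) = (\<Sum>C\<in>\<C>. emeasure M C)"
proof -
  have "(\<Sum>C\<in>\<C>. emeasure M C) = emeasure M (\<Union>C\<in>\<C>. C)"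
    using assms clopen_sets
    by (intro sum_emeasure) (auto simp: disjoint_family_on_def pairwise_def disjnt_def)
  then show ?thesis by simp
qed

lemma measure_eqI_boxes:
  assumes "sets M = sets (borel_of T)" "sets N = sets (borel_of T)"
    and eq: "\<And>Q U. finite Q \<Longrightarrow> Q \<subseteq> P \<Longrightarrow> (\<And>p. p \<in> Q \<Longrightarrow> openin (TL p) (U p) \<and> closedin (TL p) (U p))
        \<Longrightarrow> emeasure M (box Q U) = emeasure N (box Q U)"
    and "emeasure M (carrier G) \<noteq> \<infinity>"
  shows "M = N"
proof (rule clopens_measure_eqI)
  fix U assume "U \<in> clopens"
  then obtain Q \<C> where C: "finite Q" "Q \<subseteq> P" "finite \<C>" "disjoint \<C>" "\<Union>\<C> = U"
    "\<And>C. C \<in> \<C> \<Longrightarrow> \<exists>V. (\<forall>p\<in>Q. openin (TL p) (V p) \<and> closedin (TL p) (V p)) \<and> C = box Q V"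
    by (rule box_partition) blast
  have sub: "\<C> \<subseteq> clopens" using C(6) box_clopen[OF C(1,2)] by blast
  have "emeasure M C = emeasure N C" if "C \<in> \<C>" for C
    using C(6)[OF that] eq[OF C(1,2)] by blast
  then have "(\<Sum>C\<in>\<C>. emeasure M C) = (\<Sum>C\<in>\<C>. emeasure N C)" by (rule sum.cong[OF refl])
  then show "emeasure M U = emeasure N U"
    using clopen_emeasure_eq_sum[OF C(3,4) sub assms(1)] clopen_emeasure_eq_sum[OF C(3,4) sub assms(2)] C(5)
    by simp
qed (use assms in auto)

text \<open>Equal coordinates put \<open>x \<otimes> inv y\<close> into every level by
  \<open>cofinal\<close>, and the levels meet only in the unit.\<close>

lemma \<pi>_injective:
  assumes "x \<in> carrier G" "y \<in> carrier G" "\<And>p. p \<in> P \<Longrightarrow> \<pi> p x = \<pi> p y" shows "x = y"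
proof -
  have "x \<otimes> inv y = \<one>"
  proof (rule H_trivial_Inter)
    fix I assume I: "I \<in> \<A>"
    obtain Q f where Q: "finite Q" "Q \<subseteq> P" "\<And>p. p \<in> Q \<Longrightarrow> f p \<in> AL p"
      "{x \<in> carrier G. \<forall>p\<in>Q. \<pi> p x \<in> HL p (f p)} \<subseteq> H I"
      using cofinal[OF I] by blast
    have "\<pi> p (x \<otimes> inv y) \<in> HL p (f p)" if p: "p \<in> Q" for p
    proof -
      have pP: "p \<in> P" using p Q by blast
      interpret Lp: profinite_group "L p" "TL p" "AL p" "HL p" using loc[OF pP] .
      interpret h: group_hom G "L p" "\<pi> p" using group_hom[OF pP] .
      have "\<pi> p (x \<otimes> inv y) = \<one>\<^bsub>L p\<^esub>" using assms pP by simp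
      then show ?thesis using Lp.one_in_H[OF Q(3)[OF p]] by simp
    qed
    then show "x \<otimes> inv y \<in> H I" using Q(4) assms by auto
  qed (use assms in simp)
  then show ?thesis using assms inv_equality[of x "inv y"] by simp
qed

end

text \<open>In the extended reals only factors other than 0 and infinity cancel. The
  \<open>c p\<close> will be the masses of the local closures and \<open>b\<close> the mass of the
  part common to numerator and denominator.\<close>

lemma prod_ratio_ennreal:
  fixes a c :: "'p \<Rightarrow> ennreal"
  assumes "\<And>p. p \<in> Q \<Longrightarrow> c p \<noteq> 0" "\<And>p. p \<in> Q \<Longrightarrow> c p \<noteq> \<infinity>"
    and "(\<Prod>p\<in>Q. c p) * b \<noteq> 0" "(\<Prod>p\<in>Q. c p) * b \<noteq> \<infinity>"
  shows "((\<Prod>p\<in>Q. a p) * b) / ((\<Prod>p\<in>Q. c p) * b) = (\<Prod>p\<in>Q. a p / c p)"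
proof -
  have "a p / c p * c p = a p" if "p \<in> Q" for p
    using assms(1,2)[OF that] by (simp add: ennreal_divide_times ennreal_divide_self top.not_eq_extremum)
  then have "(\<Prod>p\<in>Q. a p) = (\<Prod>p\<in>Q. a p / c p) * (\<Prod>p\<in>Q. c p)"
    unfolding prod.distrib[symmetric] by (intro prod.cong) simp_all
  then have "(\<Prod>p\<in>Q. a p) * b = (\<Prod>p\<in>Q. a p / c p) * ((\<Prod>p\<in>Q. c p) * b)" by (simp add: mult.assoc)
  then show ?thesis using assms(3,4) by (simp add: mult_divide_eq_ennreal)
qed

section \<open>Thickenings of an openly Eulerian set and their limit measure\<close>

locale openly_eulerian_set = local_global G T \<A> H P L TL AL HL \<pi>
  for G :: "('a, 'm) monoid_scheme" (structure) and T :: "'a topology" and \<A> :: "'i set" and H and P :: "'p set"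
    and L :: "'p \<Rightarrow> ('b, 'c) monoid_scheme" and TL and AL :: "'p \<Rightarrow> 'j set" and HL and \<pi> +
  fixes E :: "'a set" and XL :: "'p \<Rightarrow> 'b set"
  assumes X_subset: "E \<subseteq> carrier G" and X_nonempty: "E \<noteq> {}"
    and XL_openin: "p \<in> P \<Longrightarrow> openin (TL p) (XL p)" and XL_closedin: "p \<in> P \<Longrightarrow> closedin (TL p) (XL p)"
    and euler: "(\<lambda>x. \<lambda>p\<in>P. \<pi> p x) ` (T closure_of E) = (\<Pi>\<^sub>E p\<in>P. XL p)"
begin

text \<open>The Eulerian identity yields a point of the closure with the same coordinates as
  \<open>x\<close>, and injectivity of the coordinates identifies the two.\<close>

lemma mem_closure: "x \<in> T closure_of E \<longleftrightarrow> x \<in> carrier G \<and> (\<forall>p\<in>P. \<pi> p x \<in> XL p)"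
proof
  assume x: "x \<in> T closure_of E"
  then have "(\<lambda>p\<in>P. \<pi> p x) \<in> (\<Pi>\<^sub>E p\<in>P. XL p)" using euler by blast
  then have "\<pi> p x \<in> XL p" if "p \<in> P" for p using that by (auto simp: PiE_iff)
  then show "x \<in> carrier G \<and> (\<forall>p\<in>P. \<pi> p x \<in> XL p)"
    using x closure_of_subset_topspace[of T E] topspace_eq by auto
next
  assume x: "x \<in> carrier G \<and> (\<forall>p\<in>P. \<pi> p x \<in> XL p)"
  then have "(\<lambda>p\<in>P. \<pi> p x) \<in> (\<Pi>\<^sub>E p\<in>P. XL p)" by simp
  then obtain y where y: "y \<in> T closure_of E" "(\<lambda>p\<in>P. \<pi> p x) = (\<lambda>p\<in>P. \<pi> p y)"
    unfolding euler[symmetric] by blast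
  have "y \<in> carrier G" using y(1) closure_of_subset_topspace[of T E] topspace_eq by auto
  moreover have "\<pi> p x = \<pi> p y" if "p \<in> P" for p using fun_cong[OF y(2), of p] that by simp
  ultimately have "x = y" using \<pi>_injective x by blast
  then show "x \<in> T closure_of E" using y by simp
qed

definition thickening where "thickening I = (\<Union>a\<in>E. H I #> a)"

text \<open>Cosets of \<open>H I\<close> are open, so one that contains a point of the closure
  contains a point of \<open>E\<close>. Through \<open>mem_closure\<close> the thickening then
  depends only on the local sets \<open>XL\<close>.\<close>

lemma thickening_closure:
  assumes "I \<in> \<A>" shows "thickening I = (\<Union>a\<in>T closure_of E. H I #> a)"
proof
  show "thickening I \<subseteq> (\<Union>a\<in>T closure_of E. H I #> a)"
    unfolding thickening_def using closure_of_subset[of E T] X_subset topspace_eq by auto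
  show "(\<Union>a\<in>T closure_of E. H I #> a) \<subseteq> thickening I"
  proof
    fix x assume "x \<in> (\<Union>a\<in>T closure_of E. H I #> a)"
    then obtain a where a: "a \<in> T closure_of E" "x \<in> H I #> a" by blast
    have ac: "a \<in> carrier G" using a(1) mem_closure by blast
    have "openin T (H I #> a)" using coset_clopen[OF assms ac] by (simp add: clopens_def)
    then obtain b where b: "b \<in> E" "b \<in> H I #> a"
      using a(1) coset_self[OF assms ac] unfolding in_closure_of by blast
    then show "x \<in> thickening I" using a(2) coset_eq[OF assms ac b(2)] by (auto simp: thickening_def)
  qed
qed

lemma thickening_saturated: assumes "I \<in> \<A>" shows "saturated I (thickening I)"
  unfolding saturated_def thickening_def
proof (intro conjI ballI)
  show "(\<Union>a\<in>E. H I #> a) \<subseteq> carrier G" using coset_subset[OF assms] X_subset by blast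
  fix x assume "x \<in> (\<Union>a\<in>E. H I #> a)"
  then obtain a where a: "a \<in> E" "x \<in> H I #> a" by blast
  then have "H I #> x = H I #> a" using coset_eq[OF assms] X_subset by blast
  then show "H I #> x \<subseteq> (\<Union>a\<in>E. H I #> a)" using a by blast
qed

lemma thickening_clopen: "I \<in> \<A> \<Longrightarrow> thickening I \<in> clopens"
  using thickening_saturated saturated_clopen by blast

lemma thickening_nonempty: "I \<in> \<A> \<Longrightarrow> thickening I \<noteq> {}"
  using X_nonempty X_subset coset_self unfolding thickening_def by blast

text \<open>\<open>B\<close> is the closure, moved by all elements supported on \<open>Q\<close> and
  then thickened by \<open>H I\<close>, so its coordinates at \<open>Q\<close> are free. A point of
  \<open>B\<close> whose coordinates at \<open>Q\<close> lie in \<open>XL\<close> is congruent to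
  some \<open>a \<otimes> l\<close>, which agrees with \<open>a\<close> outside \<open>Q\<close> and
  hence belongs to the closure itself.\<close>

lemma thickening_decompose:
  assumes Q: "finite Q" "Q \<subseteq> P" "\<And>p. p \<in> Q \<Longrightarrow> f p \<in> AL p"
    and sat: "\<And>p. p \<in> Q \<Longrightarrow> profinite_group.saturated (L p) (HL p) (f p) (XL p)"
    and I: "I \<in> \<A>" "\<And>p. p \<in> Q \<Longrightarrow> \<pi> p ` H I \<subseteq> HL p (f p)"
  obtains B where "B \<in> sets (borel_of T)" "invariant Q B" "thickening I = box Q XL \<inter> B"
proof -
  let ?X = "T closure_of E"
  let ?N = "{l \<in> carrier G. \<forall>q\<in>P - Q. \<pi> q l = \<one>\<^bsub>L q\<^esub>}"
  define B where "B = (\<Union>a\<in>?X. \<Union>l\<in>?N. H I #> (a \<otimes> l))"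
  have Xc: "?X \<subseteq> carrier G" using mem_closure by blast
  have "saturated I B"
    unfolding saturated_def
  proof (intro conjI ballI)
    show "B \<subseteq> carrier G" unfolding B_def using coset_subset[OF I(1)] Xc by blast
    fix x assume "x \<in> B"
    then obtain a l where al: "a \<in> ?X" "l \<in> ?N" "x \<in> H I #> (a \<otimes> l)" unfolding B_def by blast
    then have "H I #> x = H I #> (a \<otimes> l)" using coset_eq[OF I(1), of "a \<otimes> l" x] Xc by blast
    then show "H I #> x \<subseteq> B" using al unfolding B_def by blast
  qed
  then have meas: "B \<in> sets (borel_of T)" using saturated_clopen[OF I(1)] clopen_sets by blast
  have one: "\<pi> q \<one> = \<one>\<^bsub>L q\<^esub>" if "q \<in> P" for q
    using group_hom.hom_one[OF group_hom[OF that]] .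
  have Lone: "\<one>\<^bsub>L q\<^esub> \<otimes>\<^bsub>L q\<^esub> y = y" "y \<otimes>\<^bsub>L q\<^esub> \<one>\<^bsub>L q\<^esub> = y" "\<one>\<^bsub>L q\<^esub> \<in> carrier (L q)" if "q \<in> P" "y \<in> carrier (L q)" for q y
  proof -
    interpret Lp: profinite_group "L q" "TL q" "AL q" "HL q" using loc[OF that(1)] .
    show "\<one>\<^bsub>L q\<^esub> \<otimes>\<^bsub>L q\<^esub> y = y" "y \<otimes>\<^bsub>L q\<^esub> \<one>\<^bsub>L q\<^esub> = y" "\<one>\<^bsub>L q\<^esub> \<in> carrier (L q)" using that by simp_all
  qed
  have inv: "invariant Q B"
    unfolding invariant_def
  proof (intro ballI impI)
    fix p b x assume p: "p \<in> Q" and b: "b \<in> B" and x: "x \<in> carrier G" "\<forall>q\<in>P - {p}. \<pi> q x = \<one>\<^bsub>L q\<^esub>"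
    obtain a l where al: "a \<in> ?X" "l \<in> ?N" "b \<in> H I #> (a \<otimes> l)" using b unfolding B_def by blast
    have ac: "a \<in> carrier G" "l \<in> carrier G" using al Xc by auto
    have "\<pi> q (x \<otimes> l) = \<one>\<^bsub>L q\<^esub>" if "q \<in> P - Q" for q
    proof -
      have q: "q \<in> P" "\<pi> q x = \<one>\<^bsub>L q\<^esub>" "\<pi> q l = \<one>\<^bsub>L q\<^esub>" using that x(2) p al(2) by auto
      then show ?thesis using \<pi>_mult[OF q(1) x(1) ac(2)] Lone(1)[OF q(1)] \<pi>_closed[OF q(1) x(1)] by simp
    qed
    then have 1: "x \<otimes> l \<in> ?N" using x(1) ac(2) by simp
    have "x \<otimes> b \<in> (\<lambda>y. x \<otimes> y) ` (H I #> (a \<otimes> l))" using al(3) by blast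
    also have "\<dots> = H I #> (x \<otimes> (a \<otimes> l))" using translate_coset[OF I(1) _ x(1)] ac by simp
    also have "x \<otimes> (a \<otimes> l) = a \<otimes> (x \<otimes> l)" using x(1) ac by (simp add: m_lcomm)
    finally show "x \<otimes> b \<in> B" using 1 al(1) unfolding B_def by blast
  qed
  \<comment> \<open>\<open>I\<close> is so fine at \<open>Q\<close> that moving inside an
    \<open>I\<close>-coset cannot leave a set saturated at level \<open>f p\<close>.\<close>
  have step: "\<pi> p y \<in> XL p" if p: "p \<in> Q" and x: "x \<in> carrier G" "\<pi> p x \<in> XL p" and y: "y \<in> H I #> x" for p x y
  proof -
    interpret Lp: profinite_group "L p" "TL p" "AL p" "HL p" using loc p Q(2) by blast
    have "\<pi> p y \<in> HL p (f p) #>\<^bsub>L p\<^esub> \<pi> p x" using \<pi>_coset[OF _ I(2)[OF p] I(1) x(1) y] p Q(2) by blast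
    then show ?thesis using sat[OF p] x(2) unfolding Lp.saturated_def by blast
  qed
  have "thickening I = box Q XL \<inter> B"
  proof (intro equalityI subsetI)
    fix w assume "w \<in> thickening I"
    then obtain a where a: "a \<in> ?X" "w \<in> H I #> a" using thickening_closure[OF I(1)] by blast
    have ac: "a \<in> carrier G" using a Xc by blast
    have "\<pi> p w \<in> XL p" if "p \<in> Q" for p
      using step[OF that ac _ a(2)] a(1) that Q(2) mem_closure by blast
    moreover have "w \<in> carrier G" using a(2) coset_subset[OF I(1) ac] by blast
    moreover have "w \<in> B"
    proof -
      have "\<one> \<in> ?N" using one by simp
      moreover have "w \<in> H I #> (a \<otimes> \<one>)" using a(2) ac by simp
      ultimately show ?thesis unfolding B_def using a(1) by blast
    qed
    ultimately show "w \<in> box Q XL \<inter> B" by (simp add: box_def)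
  next
    fix w assume w: "w \<in> box Q XL \<inter> B"
    then obtain a l where al: "a \<in> ?X" "l \<in> ?N" "w \<in> H I #> (a \<otimes> l)" unfolding B_def by blast
    have c: "a \<in> carrier G" "l \<in> carrier G" "w \<in> carrier G" "a \<otimes> l \<in> carrier G"
      using al Xc w by (auto simp: box_def)
    \<comment> \<open>Congruence is used backwards: the coordinates of \<open>w\<close> at
      \<open>Q\<close> are known, those of \<open>a \<otimes> l\<close> are wanted.\<close>
    have alw: "a \<otimes> l \<in> H I #> w" using coset_eq[OF I(1) c(4) al(3)] coset_self[OF I(1) c(4)] by simp
    have "\<pi> q (a \<otimes> l) \<in> XL q" if q: "q \<in> P" for q
    proof (cases "q \<in> Q")
      case True
      then have "\<pi> q w \<in> XL q" using w by (auto simp: box_def)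
      then show ?thesis using step[OF True c(3) _ alw] by blast
    next
      case False
      then have "\<pi> q (a \<otimes> l) = \<pi> q a"
        using al(2) q \<pi>_mult[OF q c(1,2)] Lone(2)[OF q \<pi>_closed[OF q c(1)]] by simp
      then show ?thesis using al(1) mem_closure q by simp
    qed
    then have "a \<otimes> l \<in> ?X" using mem_closure c(4) by blast
    then show "w \<in> thickening I" using al(3) thickening_closure[OF I(1)] by blast
  qed
  with meas inv show thesis by (rule that)
qed

text \<open>The value that the product measure must take on a box; each coordinate outside
  \<open>Q\<close> would contribute the factor 1.\<close>

definition local_prod :: "'p set \<Rightarrow> ('p \<Rightarrow> 'b set) \<Rightarrow> ennreal" where
  "local_prod Q U = (\<Prod>p\<in>Q. emeasure (\<mu>L p) (U p \<inter> XL p) / emeasure (\<mu>L p) (XL p))"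

lemma XL_nonempty: "p \<in> P \<Longrightarrow> XL p \<noteq> {}"
proof -
  assume p: "p \<in> P"
  obtain a where "a \<in> T closure_of E" using X_nonempty closure_of_subset[of E T] X_subset topspace_eq by auto
  then show ?thesis using mem_closure p by blast
qed

text \<open>Numerator and denominator are boxes intersected with the same \<open>B\<close>. They
  differ only in their local factors, so the mass of \<open>B\<close> cancels.\<close>

lemma haar_thickening_ratio:
  assumes Q: "finite Q" "Q \<subseteq> P" "\<And>p. p \<in> Q \<Longrightarrow> f p \<in> AL p"
    and sat: "\<And>p. p \<in> Q \<Longrightarrow> profinite_group.saturated (L p) (HL p) (f p) (XL p)"
    and I: "I \<in> \<A>" "\<And>p. p \<in> Q \<Longrightarrow> \<pi> p ` H I \<subseteq> HL p (f p)"
    and U: "\<And>p. p \<in> Q \<Longrightarrow> U p \<in> sets (borel_of (TL p))"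
  shows "emeasure \<mu> (thickening I \<inter> box Q U) / emeasure \<mu> (thickening I) = local_prod Q U"
proof -
  obtain B where B: "B \<in> sets (borel_of T)" "invariant Q B" "thickening I = box Q XL \<inter> B"
    using thickening_decompose[OF Q sat I] by blast
  have XLs: "XL p \<in> sets (borel_of (TL p))" if "p \<in> Q" for p
    using XL_openin borel_of_open that Q(2) by blast
  have "thickening I \<inter> box Q U = box Q (\<lambda>p. U p \<inter> XL p) \<inter> B" using B(3) by (auto simp: box_def)
  then have 1: "emeasure \<mu> (thickening I \<inter> box Q U) = (\<Prod>p\<in>Q. emeasure (\<mu>L p) (U p \<inter> XL p)) * emeasure \<mu> B"
    using haar_box_Int[OF Q(1,2) _ B(1,2), of "\<lambda>p. U p \<inter> XL p"] U XLs by (simp add: sets.Int)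
  have 2: "emeasure \<mu> (thickening I) = (\<Prod>p\<in>Q. emeasure (\<mu>L p) (XL p)) * emeasure \<mu> B"
    using haar_box_Int[OF Q(1,2) XLs B(1,2)] B(3) by simp
  have "emeasure \<mu> (thickening I) \<noteq> 0"
    using haar_open_pos thickening_clopen[OF I(1)] thickening_nonempty[OF I(1)] by (auto simp: clopens_def)
  moreover have "emeasure \<mu> (thickening I) \<noteq> \<infinity>" using finite_haar by (metis less_irrefl)
  moreover have "emeasure (\<mu>L p) (XL p) \<noteq> 0" "emeasure (\<mu>L p) (XL p) \<noteq> \<infinity>" if "p \<in> Q" for p
  proof -
    have p: "p \<in> P" using that Q by blast
    interpret Lp: profinite_group "L p" "TL p" "AL p" "HL p" using loc[OF p] .
    show "emeasure (\<mu>L p) (XL p) \<noteq> 0" using Lp.haar_open_pos XL_openin XL_nonempty p by blast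
    show "emeasure (\<mu>L p) (XL p) \<noteq> \<infinity>" using Lp.finite_haar by (metis less_irrefl)
  qed
  ultimately show ?thesis unfolding 1 2 local_prod_def by (intro prod_ratio_ennreal) auto
qed

lemma eventually_box_ratio:
  assumes Fi: "\<And>J. J \<in> \<A> \<Longrightarrow> eventually (\<lambda>I. I \<in> \<A> \<and> H I \<subseteq> H J) Fi"
    and Q: "finite Q" "Q \<subseteq> P" and U: "\<And>p. p \<in> Q \<Longrightarrow> U p \<in> sets (borel_of (TL p))"
  shows "eventually (\<lambda>I. emeasure \<mu> (thickening I \<inter> box Q U) / emeasure \<mu> (thickening I) = local_prod Q U) Fi"
proof -
  have "\<exists>k\<in>AL p. profinite_group.saturated (L p) (HL p) k (XL p)" if "p \<in> Q" for p
  proof -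
    have p: "p \<in> P" using that Q by blast
    interpret Lp: profinite_group "L p" "TL p" "AL p" "HL p" using loc[OF p] .
    have "XL p \<in> Lp.clopens" using XL_openin[OF p] XL_closedin[OF p] by (simp add: Lp.clopens_def)
    then show ?thesis using Lp.clopen_saturated by metis
  qed
  then obtain f where f: "\<And>p. p \<in> Q \<Longrightarrow> f p \<in> AL p"
      "\<And>p. p \<in> Q \<Longrightarrow> profinite_group.saturated (L p) (HL p) (f p) (XL p)" by metis
  have "\<exists>J\<in>\<A>. \<pi> p ` H J \<subseteq> HL p (f p)" if "p \<in> Q" for p
    using cont[of p "f p"] f(1)[OF that] that Q(2) by blast
  then obtain g where g: "\<And>p. p \<in> Q \<Longrightarrow> g p \<in> \<A>" "\<And>p. p \<in> Q \<Longrightarrow> \<pi> p ` H (g p) \<subseteq> HL p (f p)" by metis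
  \<comment> \<open>Three choices are chained: a local level saturating \<open>XL p\<close>, a
    global level mapped into it, and one level below these finitely many.\<close>
  have "\<exists>J\<in>\<A>. \<forall>I\<in>g ` Q. H J \<subseteq> H I"
    using Q(1) g(1) by (intro directed_finite) auto
  then obtain J where J: "J \<in> \<A>" "\<And>p. p \<in> Q \<Longrightarrow> H J \<subseteq> H (g p)" by blast
  have "emeasure \<mu> (thickening I \<inter> box Q U) / emeasure \<mu> (thickening I) = local_prod Q U"
    if "I \<in> \<A> \<and> H I \<subseteq> H J" for I
  proof (rule haar_thickening_ratio[OF Q f(1) f(2) _ _ U])
    fix p assume "p \<in> Q"
    then show "\<pi> p ` H I \<subseteq> HL p (f p)" using that J(2) g(2) by blast
  qed (use that in auto)
  then show ?thesis by (rule eventually_mono[OF Fi[OF J(1)]])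
qed

text \<open>A partition into finitely many boxes reduces every clopen set to
  \<open>eventually_box_ratio\<close>. Since the values are eventually constant, additivity of the
  limit is immediate: far enough along the filter all values involved belong to one genuine
  measure.\<close>

lemma limit_measure:
  fixes M :: "_ \<Rightarrow> 'a measure"
  assumes Fi: "\<And>J. J \<in> \<A> \<Longrightarrow> eventually (\<lambda>I. I \<in> \<A> \<and> H I \<subseteq> H J) Fi" and nb: "Fi \<noteq> bot"
    and M: "\<And>I. I \<in> \<A> \<Longrightarrow> sets (M I) = sets (borel_of T)"
      "\<And>I A. I \<in> \<A> \<Longrightarrow> A \<in> clopens \<Longrightarrow>
        emeasure (M I) A = emeasure \<mu> (thickening I \<inter> A) / emeasure \<mu> (thickening I)"
  obtains \<nu> where "sets \<nu> = sets (borel_of T)"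
    "\<And>U. U \<in> clopens \<Longrightarrow> eventually (\<lambda>I. emeasure (M I) U = emeasure \<nu> U) Fi"
    "\<And>Q U. finite Q \<Longrightarrow> Q \<subseteq> P \<Longrightarrow> (\<And>p. p \<in> Q \<Longrightarrow> openin (TL p) (U p) \<and> closedin (TL p) (U p))
       \<Longrightarrow> emeasure \<nu> (box Q U) = local_prod Q U"
proof -
  obtain J0 where J0: "J0 \<in> \<A>" using levels_nonempty by blast
  have evA: "eventually (\<lambda>I. I \<in> \<A>) Fi" using Fi[OF J0] by (rule eventually_mono) blast
  have evbox: "eventually (\<lambda>I. emeasure (M I) (box Q U) = local_prod Q U) Fi"
    if Q: "finite Q" "Q \<subseteq> P" and U: "\<And>p. p \<in> Q \<Longrightarrow> openin (TL p) (U p) \<and> closedin (TL p) (U p)" for Q U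
  proof -
    have "box Q U \<in> clopens" using box_clopen[OF Q] U by blast
    moreover have "eventually (\<lambda>I. emeasure \<mu> (thickening I \<inter> box Q U) / emeasure \<mu> (thickening I) = local_prod Q U) Fi"
      using U borel_of_open by (intro eventually_box_ratio Fi Q) blast+
    ultimately show ?thesis using evA M(2) by (auto elim: eventually_elim2)
  qed
  have ex: "\<exists>c. eventually (\<lambda>I. emeasure (M I) U = c) Fi" if "U \<in> clopens" for U
  proof -
    obtain Q \<C> where C: "finite Q" "Q \<subseteq> P" "finite \<C>" "disjoint \<C>" "\<Union>\<C> = U"
      "\<And>C. C \<in> \<C> \<Longrightarrow> \<exists>V. (\<forall>p\<in>Q. openin (TL p) (V p) \<and> closedin (TL p) (V p)) \<and> C = box Q V"
      using \<open>U \<in> clopens\<close> by (rule box_partition) blast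
    have sub: "\<C> \<subseteq> clopens" using C(6) box_clopen[OF C(1,2)] by blast
    have "\<exists>c. eventually (\<lambda>I. emeasure (M I) C = c) Fi" if "C \<in> \<C>" for C
      using C(6)[OF that] evbox[OF C(1,2)] by blast
    then obtain c where "\<And>C. C \<in> \<C> \<Longrightarrow> eventually (\<lambda>I. emeasure (M I) C = c C) Fi" by metis
    then have "eventually (\<lambda>I. \<forall>C\<in>\<C>. emeasure (M I) C = c C) Fi" using C(3) by (simp add: eventually_ball_finite)
    then have "eventually (\<lambda>I. emeasure (M I) U = (\<Sum>C\<in>\<C>. c C)) Fi"
      using evA
    proof eventually_elim
      case (elim I)
      then show ?case using clopen_emeasure_eq_sum[OF C(3,4) sub M(1)[OF elim(2)]] C(5) by simp
    qed
    then show ?thesis by blast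
  qed
  define f where "f U = (SOME c. eventually (\<lambda>I. emeasure (M I) U = c) Fi)" for U
  have f: "eventually (\<lambda>I. emeasure (M I) U = f U) Fi" if "U \<in> clopens" for U
    unfolding f_def using someI_ex[OF ex[OF that]] .
  \<comment> \<open>A nontrivial filter admits one eventual value only, so the choice made in
    \<open>f\<close> is forced.\<close>
  have uniq: "c = d" if "eventually (\<lambda>I. g I = c) Fi" "eventually (\<lambda>I. g I = d) Fi" for c d :: ennreal and g
  proof -
    have "eventually (\<lambda>I. c = d) Fi" using that by eventually_elim simp
    then show ?thesis using nb by (simp add: eventually_const)
  qed
  have "\<exists>N. sets N = sets (borel_of T) \<and> (\<forall>U\<in>clopens. emeasure N U = f U)"
  proof (rule content_extension)
    interpret Sigma_Algebra.algebra "carrier G" clopens by (rule algebra_clopens)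
    show "f {} = 0" by (rule uniq[OF f[OF empty_sets]]) simp
    fix U V assume UV: "U \<in> clopens" "V \<in> clopens" "U \<inter> V = {}"
    have "eventually (\<lambda>I. emeasure (M I) (U \<union> V) = f U + f V) Fi"
      using f[OF UV(1)] f[OF UV(2)] evA
    proof eventually_elim
      case (elim I)
      have "U \<in> sets (M I)" "V \<in> sets (M I)" using UV clopen_sets M(1)[OF elim(3)] by simp_all
      from plus_emeasure[OF this UV(3)] show ?case using elim by simp
    qed
    with f[OF Un[OF UV(1,2)]] show "f (U \<union> V) = f U + f V" by (rule uniq)
  qed
  then obtain \<nu> where \<nu>: "sets \<nu> = sets (borel_of T)" "\<And>U. U \<in> clopens \<Longrightarrow> emeasure \<nu> U = f U" by blast
  show thesis
  proof (rule that[OF \<nu>(1)])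
    show "eventually (\<lambda>I. emeasure (M I) U = emeasure \<nu> U) Fi" if "U \<in> clopens" for U
      using f[OF that] \<nu>(2)[OF that] by simp
    fix Q U assume Q: "finite Q" "Q \<subseteq> P" and U: "\<And>p. p \<in> Q \<Longrightarrow> openin (TL p) (U p) \<and> closedin (TL p) (U p)"
    have b: "box Q U \<in> clopens" using box_clopen[OF Q] U by blast
    have "f (box Q U) = local_prod Q U" by (rule uniq[OF f[OF b] evbox[OF Q U]])
    then show "emeasure \<nu> (box Q U) = local_prod Q U" using \<nu>(2)[OF b] by simp
  qed
qed

end

section \<open>Finiteness of quotients of subrings of global fields\<close>

text \<open>Otherwise the powers of \<open>y / q\<close> would outgrow \<open>C\<close>. Taking all
  powers removes the constant, which in the application depends on the chosen representatives while
  \<open>q\<close> does not.\<close>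

lemma geometric_bound:
  assumes "\<And>m::nat. y ^ m \<le> C * q ^ m" "q > 0" shows "y \<le> (q::nat)"
proof (rule ccontr)
  assume "\<not> y \<le> q"
  then have r: "1 < real y / real q" using assms(2) by simp
  then obtain m where m: "real C < (real y / real q) ^ m" using real_arch_pow by blast
  have "real y ^ m \<le> real C * real q ^ m" using assms(1)[of m] by (metis of_nat_le_iff of_nat_mult of_nat_power)
  then have "(real y / real q) ^ m \<le> real C" using assms(2) by (simp add: power_divide divide_le_eq)
  then show False using m by simp
qed

text \<open>For a number field take \<open>B k\<close> to be the integers of absolute value at most \<open>2 ^ k\<close>, and for a function
  field the polynomials of degree at most \<open>k\<close>.\<close>

locale filtered_field = field R for R (structure) +
  fixes B :: "nat \<Rightarrow> 'a set" and c :: nat and K :: "'a set" and us :: "'a list"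
  assumes B_carrier: "B k \<subseteq> carrier R" and B_finite: "finite (B k)" and B_card: "card (B k) \<le> c ^ (k + 1)"
    and B_Suc: "B k \<subseteq> B (Suc k)" and zero_B: "\<zero> \<in> B 0" and one_B: "\<one> \<in> B 0"
    and B_add: "a \<in> B k \<Longrightarrow> b \<in> B k \<Longrightarrow> a \<oplus> b \<in> B (Suc k)"
    and B_mult: "a \<in> B j \<Longrightarrow> b \<in> B k \<Longrightarrow> a \<otimes> b \<in> B (j + k)"
    and K_carrier: "K \<subseteq> carrier R" and K_fraction: "a \<in> K \<Longrightarrow> \<exists>j k. \<exists>d\<in>B j - {\<zero>}. d \<otimes> a \<in> B k"
    and us_carrier: "set us \<subseteq> carrier R" and Span_us: "Span K us = carrier R"
begin

section \<open>Spans with coefficients of bounded size\<close>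

lemma B_mono: "j \<le> k \<Longrightarrow> B j \<subseteq> B k"
  by (rule lift_Suc_mono_le[of B]) (rule B_Suc)

lemma Span_Nil [simp]: "Span C [] = {\<zero>}" by simp

lemma Span_Cons_iff: "x \<in> Span C (v # vs) \<longleftrightarrow> (\<exists>a\<in>C. \<exists>e\<in>Span C vs. x = a \<otimes> v \<oplus> e)"
  by (simp add: line_extension_mem_iff)

declare Span.simps [simp del]

lemma B_closed: "a \<in> B k \<Longrightarrow> a \<in> carrier R"
  using B_carrier by blast

lemma Span_closed: "x \<in> Span (B k) vs \<Longrightarrow> set vs \<subseteq> carrier R \<Longrightarrow> x \<in> carrier R"
  using Span_in_carrier[OF B_carrier] by blast

lemma Span_mono: "C \<subseteq> C' \<Longrightarrow> Span C vs \<subseteq> Span C' vs"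
proof (induction vs)
  case (Cons v vs) then show ?case unfolding subset_iff Span_Cons_iff by blast
qed simp

text \<open>One coefficient from \<open>B k\<close> per spanning vector; different coefficients may
  give the same element, hence an upper bound. The exponent is linear in \<open>k\<close>, which
  makes the later count geometric.\<close>

lemma Span_finite: "finite (Span (B k) vs) \<and> card (Span (B k) vs) \<le> c ^ ((k + 1) * length vs)"
proof (induction vs)
  case (Cons v vs)
  have eq: "Span (B k) (v # vs) = (\<lambda>(a, e). a \<otimes> v \<oplus> e) ` (B k \<times> Span (B k) vs)"
    using Span_Cons_iff by (fastforce simp: image_iff)
  have fin: "finite (B k \<times> Span (B k) vs)" using Cons B_finite by blast
  have "card (Span (B k) (v # vs)) \<le> card (B k \<times> Span (B k) vs)"
    unfolding eq using fin by (rule card_image_le)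
  also have "\<dots> \<le> c ^ (k + 1) * c ^ ((k + 1) * length vs)"
    unfolding card_cartesian_product using Cons B_card by (intro mult_mono) auto
  also have "\<dots> = c ^ ((k + 1) * length (v # vs))" by (simp add: power_add[symmetric])
  finally show ?case using finite_imageI[OF fin] unfolding eq by blast
qed simp

lemma Span_add:
  assumes "set vs \<subseteq> carrier R" "x \<in> Span (B k) vs" "y \<in> Span (B k) vs" shows "x \<oplus> y \<in> Span (B (Suc k)) vs"
  using assms
proof (induction vs arbitrary: x y)
  case (Cons v vs)
  then obtain a e b e' where h: "a \<in> B k" "e \<in> Span (B k) vs" "x = a \<otimes> v \<oplus> e"
    "b \<in> B k" "e' \<in> Span (B k) vs" "y = b \<otimes> v \<oplus> e'" unfolding Span_Cons_iff by blast
  have c: "a \<in> carrier R" "b \<in> carrier R" "e \<in> carrier R" "e' \<in> carrier R" "v \<in> carrier R"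
    using h B_closed Span_closed Cons.prems(1) by auto
  then have "x \<oplus> y = (a \<oplus> b) \<otimes> v \<oplus> (e \<oplus> e')" using h by algebra
  then show ?case unfolding Span_Cons_iff using B_add[OF h(1,4)] Cons.IH[OF _ h(2,5)] Cons.prems(1) by auto
qed simp

lemma Span_smult:
  assumes "set vs \<subseteq> carrier R" "a \<in> B j" "x \<in> Span (B k) vs" shows "a \<otimes> x \<in> Span (B (j + k)) vs"
  using assms
proof (induction vs arbitrary: x)
  case Nil then show ?case using B_closed by auto
next
  case (Cons v vs)
  then obtain b e where h: "b \<in> B k" "e \<in> Span (B k) vs" "x = b \<otimes> v \<oplus> e" unfolding Span_Cons_iff by blast
  have c: "a \<in> carrier R" "b \<in> carrier R" "e \<in> carrier R" "v \<in> carrier R"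
    using h B_closed Span_closed Cons.prems by auto
  then have "a \<otimes> x = (a \<otimes> b) \<otimes> v \<oplus> a \<otimes> e" using h by algebra
  then show ?case unfolding Span_Cons_iff using B_mult[OF Cons.prems(2) h(1)] Cons.IH[OF _ Cons.prems(2) h(2)] Cons.prems(1)
    by auto
qed

lemma Span_zero: "set vs \<subseteq> carrier R \<Longrightarrow> \<zero> \<in> Span (B k) vs"
proof (induction vs)
  case (Cons v vs)
  have "\<zero> \<in> B k" using zero_B B_mono[of 0 k] by blast
  moreover have "\<zero> = \<zero> \<otimes> v \<oplus> \<zero>" using Cons.prems by simp
  ultimately show ?case unfolding Span_Cons_iff using Cons by (metis insert_subset list.simps(15))
qed simp

text \<open>The level has three sources: \<open>k\<close> from the coefficients of \<open>x\<close>,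
  \<open>b\<close> from the images of the spanning vectors, and one step for each addition in the
  combination, hence \<open>length vs\<close>.\<close>

lemma Span_mult:
  assumes "set vs \<subseteq> carrier R" "set ws \<subseteq> carrier R" "y \<in> carrier R"
    and "\<And>v. v \<in> set vs \<Longrightarrow> y \<otimes> v \<in> Span (B b) ws" "x \<in> Span (B k) vs"
  shows "y \<otimes> x \<in> Span (B (k + b + length vs)) ws"
  using assms
proof (induction vs arbitrary: x)
  case Nil then show ?case using Span_zero by simp
next
  case (Cons v vs)
  then obtain a e where h: "a \<in> B k" "e \<in> Span (B k) vs" "x = a \<otimes> v \<oplus> e" unfolding Span_Cons_iff by blast
  have c: "a \<in> carrier R" "e \<in> carrier R" "v \<in> carrier R"
    using h B_closed Span_closed Cons.prems by auto
  have "y \<otimes> x = a \<otimes> (y \<otimes> v) \<oplus> y \<otimes> e" using h c Cons.prems(3) by algebra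
  moreover have "a \<otimes> (y \<otimes> v) \<in> Span (B (k + b + length vs)) ws"
    using Span_smult[OF Cons.prems(2) h(1), of "y \<otimes> v" b] Cons.prems(4)[of v]
      Span_mono[OF B_mono[of "k + b" "k + b + length vs"], of ws] by auto
  moreover have "y \<otimes> e \<in> Span (B (k + b + length vs)) ws" using Cons h(2) by simp
  ultimately show ?case using Span_add[OF Cons.prems(2)] by simp
qed

text \<open>\<open>h\<close> plays the role of a common denominator for \<open>Y\<close>.\<close>

definition bounded_by :: "'a \<Rightarrow> nat \<Rightarrow> 'a set \<Rightarrow> bool" where
  "bounded_by h k Y \<longleftrightarrow> (\<forall>y\<in>Y. h \<otimes> y \<in> Span (B k) us)"

lemma Span_denominator:
  assumes "set vs \<subseteq> carrier R" "x \<in> Span K vs"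
  shows "\<exists>j k. \<exists>h\<in>B j - {\<zero>}. h \<otimes> x \<in> Span (B k) vs"
  using assms
proof (induction vs arbitrary: x)
  case Nil
  then have "\<one> \<in> B 0 - {\<zero>}" "\<one> \<otimes> x \<in> Span (B 0) []" using one_B by auto
  then show ?case by blast
next
  case (Cons v vs)
  then obtain a e where h: "a \<in> K" "e \<in> Span K vs" "x = a \<otimes> v \<oplus> e" unfolding Span_Cons_iff by blast
  obtain j k d where d: "d \<in> B j - {\<zero>}" "d \<otimes> a \<in> B k" using K_fraction[OF h(1)] by blast
  obtain j' k' f where f: "f \<in> B j' - {\<zero>}" "f \<otimes> e \<in> Span (B k') vs" using Cons.IH[OF _ h(2)] Cons.prems(1) by auto
  have c: "a \<in> carrier R" "e \<in> carrier R" "v \<in> carrier R" "d \<in> carrier R" "f \<in> carrier R"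
    using h d f K_carrier Span_in_carrier[OF K_carrier, of vs] B_carrier Cons.prems by auto
  let ?m = "max (j' + k) (j + k')"
  have "(d \<otimes> f) \<otimes> x = (f \<otimes> (d \<otimes> a)) \<otimes> v \<oplus> d \<otimes> (f \<otimes> e)" using c h(3) by algebra
  moreover have "f \<otimes> (d \<otimes> a) \<in> B ?m" using B_mult[of f j' "d \<otimes> a" k] f d B_mono[of "j' + k" ?m] by auto
  moreover have "d \<otimes> (f \<otimes> e) \<in> Span (B ?m) vs"
    using Span_smult[of vs d j "f \<otimes> e" k'] f d Cons.prems(1) Span_mono[OF B_mono[of "j + k'" ?m], of vs] by auto
  ultimately have "(d \<otimes> f) \<otimes> x \<in> Span (B ?m) (v # vs)" unfolding Span_Cons_iff by blast
  moreover have "d \<otimes> f \<in> B (j + j') - {\<zero>}" using B_mult d f c integral_iff by auto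
  ultimately show ?case by blast
qed

lemma denominator: "x \<in> carrier R \<Longrightarrow> \<exists>j k. \<exists>h\<in>B j - {\<zero>}. h \<otimes> x \<in> Span (B k) us"
  using Span_denominator[OF us_carrier] Span_us by blast

lemma common_denominator:
  assumes "finite Y" "Y \<subseteq> carrier R" shows "\<exists>j k. \<exists>h\<in>B j - {\<zero>}. bounded_by h k Y"
  using assms
proof (induction Y)
  case empty
  have "\<one> \<in> B 0 - {\<zero>}" using one_B by simp
  then show ?case unfolding bounded_by_def by blast
next
  case (insert y Y)
  then obtain j k h where h: "h \<in> B j - {\<zero>}" "bounded_by h k Y" by auto
  obtain j' k' f where f: "f \<in> B j' - {\<zero>}" "f \<otimes> y \<in> Span (B k') us" using denominator insert.prems by blast
  have c: "h \<in> carrier R" "f \<in> carrier R" using h f B_carrier by auto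
  let ?m = "max (j' + k) (j + k')"
  have "(h \<otimes> f) \<otimes> z \<in> Span (B ?m) us" if z: "z \<in> insert y Y" for z
  proof (cases "z = y")
    case True
    have "(h \<otimes> f) \<otimes> z = h \<otimes> (f \<otimes> y)" using c insert.prems True by (simp add: m_assoc)
    also have "\<dots> \<in> Span (B (j + k')) us" using Span_smult[OF us_carrier _ f(2)] h by blast
    finally show ?thesis using Span_mono[OF B_mono[of "j + k'" ?m], of us] by auto
  next
    case False
    then have zY: "z \<in> Y" using z by blast
    have "(h \<otimes> f) \<otimes> z = f \<otimes> (h \<otimes> z)" using c insert.prems zY by (auto simp: m_lcomm m_assoc m_comm subset_iff)
    also have "\<dots> \<in> Span (B (j' + k)) us" using Span_smult[OF us_carrier _, of f j' "h \<otimes> z" k] h zY f by (auto simp: bounded_by_def)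
    finally show ?thesis using Span_mono[OF B_mono[of "j' + k" ?m], of us] by auto
  qed
  moreover have "h \<otimes> f \<in> B (j + j') - {\<zero>}" using B_mult h f c integral_iff by auto
  ultimately show ?case unfolding bounded_by_def by blast
qed

text \<open>Every element is a quotient of a member of a finite span by a member of a finite set
  \<open>B j\<close>, and the sizes are natural numbers.\<close>

lemma countable_carrier: "countable (carrier R)"
proof -
  have "carrier R \<subseteq> (\<Union>j. \<Union>h\<in>B j - {\<zero>}. \<Union>k. (\<lambda>y. inv h \<otimes> y) ` Span (B k) us)"
  proof
    fix x assume x: "x \<in> carrier R"
    obtain j k h where h: "h \<in> B j - {\<zero>}" "h \<otimes> x \<in> Span (B k) us" using denominator[OF x] by blast
    have c: "h \<in> Units R" using h B_carrier by (auto simp: field_Units)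
    then have "x = inv h \<otimes> (h \<otimes> x)" using x by (simp add: m_assoc[symmetric] Units_closed)
    then show "x \<in> (\<Union>j. \<Union>h\<in>B j - {\<zero>}. \<Union>k. (\<lambda>y. inv h \<otimes> y) ` Span (B k) us)" using h by blast
  qed
  moreover have "countable (\<Union>j. \<Union>h\<in>B j - {\<zero>}. \<Union>k. (\<lambda>y. inv h \<otimes> y) ` Span (B k) us)"
  proof (rule countable_UN)
    fix j
    have *: "countable (\<Union>k. (\<lambda>y. inv h \<otimes> y) ` Span (B k) us)" for h
      by (rule countable_UN) (simp_all add: Span_finite[THEN conjunct1] countable_finite)
    show "countable (\<Union>h\<in>B j - {\<zero>}. \<Union>k. (\<lambda>y. inv h \<otimes> y) ` Span (B k) us)"
      by (rule countable_UN) (use * in \<open>simp_all add: B_finite countable_finite\<close>)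
  qed simp
  ultimately show ?thesis by (rule countable_subset)
qed

text \<open>If \<open>Y\<close> represents distinct classes modulo \<open>x\<close> then the \<open>card Y ^ m\<close> expansions \<open>\<Sum>i<m. y\<^sub>i x\<^sup>i\<close> are
  distinct, while their size grows only linearly with \<open>m\<close>, so that there are at most \<open>C q ^ m\<close> of them.\<close>

lemma incongruent_bound:
  assumes D: "subring D R" and x: "x \<in> D" "x \<noteq> \<zero>"
  shows "\<exists>q. \<forall>Y. finite Y \<longrightarrow> Y \<subseteq> D \<longrightarrow>
      (\<forall>y\<in>Y. \<forall>z\<in>Y. \<forall>d\<in>D. y = z \<oplus> x \<otimes> d \<longrightarrow> y = z) \<longrightarrow> card Y \<le> q"
proof -
  have Dc: "D \<subseteq> carrier R" using D subringE(1) by blast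
  note D_closed = subringE(2,5,6,7)[OF D]
  have xc: "x \<in> carrier R" using x Dc by blast
  have "(\<lambda>u. x \<otimes> u) ` set us \<subseteq> carrier R" using xc us_carrier by auto
  then obtain d b h where h: "h \<in> B d - {\<zero>}" "bounded_by h b ((\<lambda>u. x \<otimes> u) ` set us)"
    using common_denominator by (meson List.finite_set finite_imageI)
  have hc: "h \<in> carrier R" using h B_carrier by blast
  \<comment> \<open>The growth per digit: multiplication by \<open>h \<otimes> x\<close> costs
    \<open>b + length us\<close> levels, adding the new digit costs 1, and \<open>d\<close> makes
    room for the power of \<open>h\<close> that multiplies this digit.\<close>
  define s where "s = b + length us + d + 1"
  have cpos: "c > 0" using B_card[of 0] B_finite[of 0] zero_B by (cases c) auto
  have "card Y \<le> c ^ (s * length us)" if Y: "finite Y" "Y \<subseteq> D"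
    and inc: "\<forall>y\<in>Y. \<forall>z\<in>Y. \<forall>d\<in>D. y = z \<oplus> x \<otimes> d \<longrightarrow> y = z" for Y
  proof -
    obtain j a f where f: "f \<in> B j - {\<zero>}" "bounded_by f a Y"
      using common_denominator[OF Y(1)] Y(2) Dc by blast
    have fc: "f \<in> carrier R" using f B_carrier by blast
    \<comment> \<open>The expansions with \<open>m\<close> digits from \<open>Y\<close> in base
      \<open>x\<close>, in Horner form.\<close>
    define E where "E = rec_nat {\<zero>} (\<lambda>_ S. (\<lambda>(y, e). y \<oplus> x \<otimes> e) ` (Y \<times> S))"
    have E0: "E 0 = {\<zero>}" and ES: "\<And>m. E (Suc m) = (\<lambda>(y, e). y \<oplus> x \<otimes> e) ` (Y \<times> E m)"
      by (simp_all add: E_def)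
    have ED: "E m \<subseteq> D" for m
    proof (induction m)
      case 0 then show ?case using E0 D_closed(1) by simp
    next
      case (Suc m)
      have "y \<oplus> x \<otimes> e \<in> D" if "y \<in> Y" "e \<in> E m" for y e
        using D_closed(4)[OF subsetD[OF Y(2) that(1)] D_closed(3)[OF x(1) subsetD[OF Suc that(2)]]] .
      then show ?case unfolding ES by auto
    qed
    \<comment> \<open>Digits are read off from the bottom: the lowest one is determined modulo
      \<open>x\<close>, hence determined by incongruence, and then \<open>x\<close> cancels.\<close>
    have inj: "inj_on (\<lambda>(y, e). y \<oplus> x \<otimes> e) (Y \<times> E m)" for m
    proof -
     have "y = z \<and> e = g"
      if h: "y \<in> Y" "e \<in> E m" "z \<in> Y" "g \<in> E m" "y \<oplus> x \<otimes> e = z \<oplus> x \<otimes> g" for y e z g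
     proof -
      have D': "y \<in> D" "e \<in> D" "z \<in> D" "g \<in> D" using h ED Y(2) by auto
      then have C: "y \<in> carrier R" "e \<in> carrier R" "z \<in> carrier R" "g \<in> carrier R" using Dc by auto
      have "y = z \<oplus> x \<otimes> (g \<ominus> e)"
      proof -
        have "y = (y \<oplus> x \<otimes> e) \<ominus> x \<otimes> e" using C xc by algebra
        also have "\<dots> = (z \<oplus> x \<otimes> g) \<ominus> x \<otimes> e" using h(5) by simp
        also have "\<dots> = z \<oplus> x \<otimes> (g \<ominus> e)" using C xc by algebra
        finally show ?thesis .
      qed
      moreover have "g \<ominus> e \<in> D" using D' D_closed by (simp add: a_minus_def)
      ultimately have yz: "y = z" using inc h(1,3) by blast
      then have "x \<otimes> e = x \<otimes> g" using h(5) C xc by simp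
      then have "e = g" using m_lcancel x(2) xc C by simp
      then show ?thesis using yz by simp
     qed
     then show ?thesis by (auto simp: inj_on_def)
    qed
    have fin: "finite (E m)" and cardE: "card (E m) = card Y ^ m" for m
      by (induction m) (use E0 ES inj Y(1) in \<open>auto simp: card_image card_cartesian_product\<close>)
    have pow: "h [^] m \<in> B (d * m)" and pow_nz: "h [^] m \<noteq> \<zero>" for m :: nat
    proof (induction m)
      case 0
      case 1 then show ?case using one_B by simp
      case 2 then show ?case by simp
    next
      case (Suc m)
      case 1 then show ?case using B_mult[OF Suc(1), of h d] h(1) by (simp add: add.commute)
      case 2 then show ?case using Suc(2) h(1) hc by (simp add: integral_iff)
    qed
    \<comment> \<open>\<open>f\<close> clears the denominators of the digits, and \<open>h\<close>
      those created by one multiplication by \<open>x\<close>; so \<open>m\<close> digits call for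
      \<open>h [^] m\<close>.\<close>
    have bnd: "f \<otimes> (h [^] m \<otimes> e) \<in> Span (B (a + s * m)) us" if "e \<in> E m" for m e
      using that
    proof (induction m arbitrary: e)
      case 0
      then show ?case using E0 fc Span_zero[OF us_carrier] by simp
    next
      case (Suc m)
      then obtain y g where g: "y \<in> Y" "g \<in> E m" "e = y \<oplus> x \<otimes> g" using ES by auto
      have C: "y \<in> carrier R" "g \<in> carrier R" using g ED Y(2) Dc by auto
      let ?k = "a + s * m + b + length us + d"
      have t1: "f \<otimes> (h [^] Suc m \<otimes> e) = h [^] Suc m \<otimes> (f \<otimes> y) \<oplus> (h \<otimes> x) \<otimes> (f \<otimes> (h [^] m \<otimes> g))"
      proof -
        have hm: "h [^] m \<in> carrier R" using hc by simp
        have "h [^] Suc m = h [^] m \<otimes> h" using hc by simp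
        then show ?thesis using C xc hc fc hm g(3) by algebra
      qed
      have t2: "h [^] Suc m \<otimes> (f \<otimes> y) \<in> Span (B (d * Suc m + a)) us"
        using Span_smult[OF us_carrier pow[of "Suc m"], of "f \<otimes> y" a] f(2) g(1) by (auto simp: bounded_by_def)
      have t3: "d * Suc m + a \<le> ?k"
        by (simp add: s_def algebra_simps)
      have t4: "(h \<otimes> x) \<otimes> (f \<otimes> (h [^] m \<otimes> g)) \<in> Span (B (a + s * m + b + length us)) us"
      proof (rule Span_mult[OF us_carrier us_carrier _ _ Suc.IH[OF g(2)]])
        fix v assume v: "v \<in> set us"
        then have "h \<otimes> (x \<otimes> v) \<in> Span (B b) us" using h(2) by (auto simp: bounded_by_def)
        then show "h \<otimes> x \<otimes> v \<in> Span (B b) us" using hc xc us_carrier v by (simp add: m_assoc subset_iff)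
      qed (use hc xc in simp)
      have t5: "Span (B i) us \<subseteq> Span (B ?k) us" if "i \<le> ?k" for i
        by (rule Span_mono[OF B_mono[OF that]])
      have "f \<otimes> (h [^] Suc m \<otimes> e) \<in> Span (B (Suc ?k)) us"
        unfolding t1 by (rule Span_add[OF us_carrier subsetD[OF t5 t2] subsetD[OF t5 t4]]) (use t3 in simp_all)
      also have "Suc ?k = a + s * Suc m" by (simp add: s_def)
      finally show ?case .
    qed
    \<comment> \<open>The number \<open>a\<close> depends on \<open>Y\<close> but enters only the
      constant factor; the base \<open>c ^ (s * length us)\<close> was fixed by \<open>x\<close>
      alone, which makes the final bound uniform in \<open>Y\<close>.\<close>
    have "card Y ^ m \<le> c ^ ((a + 1) * length us) * (c ^ (s * length us)) ^ m" for m
    proof -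
      have "inj_on (\<lambda>e. f \<otimes> (h [^] m \<otimes> e)) (E m)"
      proof (rule inj_onI)
        fix e g assume eg: "e \<in> E m" "g \<in> E m" "f \<otimes> (h [^] m \<otimes> e) = f \<otimes> (h [^] m \<otimes> g)"
        have C: "e \<in> carrier R" "g \<in> carrier R" using eg ED Dc by auto
        have hm: "h [^] m \<in> carrier R" "h [^] m \<noteq> \<zero>" using pow_nz hc by auto
        have "h [^] m \<otimes> e = h [^] m \<otimes> g" using m_lcancel[of f] f(1) fc C hm eg(3) by simp
        then show "e = g" using m_lcancel hm C by simp
      qed
      then have "card (E m) \<le> card (Span (B (a + s * m)) us)"
        using bnd Span_finite by (intro card_inj_on_le[of "\<lambda>e. f \<otimes> (h [^] m \<otimes> e)"]) auto
      also have "\<dots> \<le> c ^ ((a + s * m + 1) * length us)" using Span_finite by blast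
      also have "\<dots> = c ^ ((a + 1) * length us) * (c ^ (s * length us)) ^ m"
        by (simp add: power_add[symmetric] power_mult[symmetric] algebra_simps)
      finally show ?thesis using cardE by simp
    qed
    then show ?thesis by (rule geometric_bound) (simp add: cpos)
  qed
  then show ?thesis by blast
qed

text \<open>Representatives of distinct cosets of \<open>I\<close> are incongruent modulo any
  element of \<open>I\<close>; a non-zero one makes \<open>incongruent_bound\<close>
  applicable.\<close>

lemma finite_Quot:
  assumes D: "subring D R" and I: "ideal I (R\<lparr>carrier := D\<rparr>)" "I \<noteq> {\<zero>}"
  shows "finite (carrier (R\<lparr>carrier := D\<rparr> Quot I))"
proof (rule ccontr)
  let ?D = "R\<lparr>carrier := D\<rparr>"
  interpret D: ideal I ?D by (rule I(1))
  have "\<zero> \<in> I" using additive_subgroup.zero_closed[OF D.additive_subgroup_axioms] by simp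
  then obtain x where x: "x \<in> I" "x \<noteq> \<zero>" using I(2) by blast
  have xD: "x \<in> D" using D.a_subset x(1) by auto
  obtain q where q: "\<And>Y. finite Y \<Longrightarrow> Y \<subseteq> D \<Longrightarrow>
      (\<forall>y\<in>Y. \<forall>z\<in>Y. \<forall>d\<in>D. y = z \<oplus> x \<otimes> d \<longrightarrow> y = z) \<Longrightarrow> card Y \<le> q"
    using incongruent_bound[OF D xD x(2)] by blast
  assume "infinite (carrier (?D Quot I))"
  then obtain \<C> where C: "finite \<C>" "card \<C> = Suc q" "\<C> \<subseteq> carrier (?D Quot I)"
    using infinite_arbitrarily_large by blast
  have coset: "\<exists>y\<in>D. C = I +>\<^bsub>?D\<^esub> y" if "C \<in> \<C>" for C
    using that C(3) by (auto simp: FactRing_def A_RCOSETS_def')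
  then obtain g where g: "\<And>C. C \<in> \<C> \<Longrightarrow> g C \<in> D" "\<And>C. C \<in> \<C> \<Longrightarrow> C = I +>\<^bsub>?D\<^esub> g C"
    by metis
  have inj: "inj_on g \<C>" by (rule inj_onI) (use g(2) in metis)
  have "card (g ` \<C>) \<le> q"
  proof (rule q)
    show "finite (g ` \<C>)" "g ` \<C> \<subseteq> D" using C(1) g(1) by auto
    have "A = C" if h: "A \<in> \<C>" "C \<in> \<C>" "d \<in> D" "g A = g C \<oplus> x \<otimes> d" for A C d
    proof -
      have "x \<otimes> d \<in> I" using D.I_r_closed[OF x(1), of d] h(3) by simp
      moreover have "g A = x \<otimes> d \<oplus> g C"
        using h g(1) xD subringE(1)[OF D] by (simp add: a_comm subset_iff)
      ultimately have mem: "g A \<in> I +>\<^bsub>?D\<^esub> g C" by (auto simp: a_r_coset_def')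
      have eq: "I +>\<^bsub>?D\<^esub> g C = I +>\<^bsub>?D\<^esub> g A"
        using D.a_repr_independence[OF mem] g(1)[OF h(2)] D.additive_subgroup_axioms
        by (simp add: additive_subgroup_def)
      show "A = C" by (rule trans[OF g(2)[OF h(1)] trans[OF eq[symmetric] g(2)[OF h(2), symmetric]]])
    qed
    note rep = this
    show "\<forall>y\<in>g ` \<C>. \<forall>z\<in>g ` \<C>. \<forall>d\<in>D. y = z \<oplus> x \<otimes> d \<longrightarrow> y = z"
    proof (intro ballI impI)
      fix y z d assume h: "y \<in> g ` \<C>" "z \<in> g ` \<C>" "d \<in> D" "y = z \<oplus> x \<otimes> d"
      obtain A C where AC: "A \<in> \<C>" "y = g A" "C \<in> \<C>" "z = g C" using h(1,2) by (elim imageE)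
      show "y = z" using rep[OF AC(1,3) h(3)] h(4) unfolding AC(2,4) by (intro arg_cong[of _ _ g])
    qed
  qed
  then show False using C(2) card_image[OF inj] by simp
qed

end

section \<open>Filtrations of number fields and function fields\<close>

lemma (in field) generate_field_fraction:
  assumes A: "subring A R" and H: "H \<subseteq> A" and a: "a \<in> generate_field R H"
  shows "\<exists>d\<in>A - {\<zero>}. d \<otimes> a \<in> A"
  using a
proof induction
  have c: "A \<subseteq> carrier R" by (rule subringE(1)[OF A])
  note A_closed = subringE(2,3,5,6,7)[OF A]
  {
    case one
    show ?case using A_closed by (intro bexI[of _ \<one>]) auto
  next
    case (incl h)
    then show ?case using A_closed H c by (intro bexI[of _ \<one>]) auto
  next
    case (a_inv h)
    then obtain d where d: "d \<in> A - {\<zero>}" "d \<otimes> h \<in> A" by blast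
    have "h \<in> carrier R" using a_inv(1) generate_field_in_carrier[of H h] H c by blast
    then have "d \<otimes> \<ominus> h = \<ominus> (d \<otimes> h)" using d(1) c by (auto simp: r_minus)
    then show ?case using A_closed(3)[OF d(2)] by (intro bexI[OF _ d(1)]) simp
  next
    \<comment> \<open>If \<open>d\<close> is a denominator of \<open>h\<close>, then the numerator
      \<open>d \<otimes> h\<close> is a denominator of \<open>inv h\<close>.\<close>
    case (m_inv h)
    then obtain d where d: "d \<in> A - {\<zero>}" "d \<otimes> h \<in> A" by blast
    have hc: "h \<in> carrier R" "d \<in> carrier R" using m_inv(1) generate_field_in_carrier[of H h] H c d by auto
    have "h \<in> Units R" using hc m_inv(2) by (simp add: field_Units)
    then have "(d \<otimes> h) \<otimes> inv h = d" using hc by (simp add: m_assoc)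
    moreover have "d \<otimes> h \<noteq> \<zero>" using d hc m_inv(2) by (simp add: integral_iff)
    ultimately show ?case using d by (intro bexI[of _ "d \<otimes> h"]) auto
  next
    case (eng_add h g)
    then obtain d e where d: "d \<in> A - {\<zero>}" "d \<otimes> h \<in> A" "e \<in> A - {\<zero>}" "e \<otimes> g \<in> A" by blast
    have hc: "h \<in> carrier R" "d \<in> carrier R" "g \<in> carrier R" "e \<in> carrier R"
      using eng_add(1,2) generate_field_in_carrier[of H] H c d by auto
    have "(d \<otimes> e) \<otimes> (h \<oplus> g) = e \<otimes> (d \<otimes> h) \<oplus> d \<otimes> (e \<otimes> g)" using hc by algebra
    then have "(d \<otimes> e) \<otimes> (h \<oplus> g) \<in> A" using d A_closed by auto
    moreover have "d \<otimes> e \<in> A - {\<zero>}" using d hc A_closed by (auto simp: integral_iff)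
    ultimately show ?case by blast
  next
    case (eng_mult h g)
    then obtain d e where d: "d \<in> A - {\<zero>}" "d \<otimes> h \<in> A" "e \<in> A - {\<zero>}" "e \<otimes> g \<in> A" by blast
    have hc: "h \<in> carrier R" "d \<in> carrier R" "g \<in> carrier R" "e \<in> carrier R"
      using eng_mult(1,2) generate_field_in_carrier[of H] H c d by auto
    have "(d \<otimes> e) \<otimes> (h \<otimes> g) = (d \<otimes> h) \<otimes> (e \<otimes> g)" using hc by algebra
    then have "(d \<otimes> e) \<otimes> (h \<otimes> g) \<in> A" using d A_closed by auto
    moreover have "d \<otimes> e \<in> A - {\<zero>}" using d hc A_closed by (auto simp: integral_iff)
    ultimately show ?case by blast
  }
qed

text \<open>Closure under negation makes the union of the \<open>B k\<close> a subring, and elements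
  of the field generated by \<open>H\<close> are fractions over it. Finite dimension over that field
  supplies the spanning list.\<close>

lemma (in field) filtered_fieldI:
  assumes B: "\<And>k. B k \<subseteq> carrier R" "\<And>k. finite (B k)" "\<And>k. card (B k) \<le> c ^ (k + 1)"
    "\<And>k. B k \<subseteq> B (Suc k)" "\<zero> \<in> B 0" "\<one> \<in> B 0"
    "\<And>a b k. a \<in> B k \<Longrightarrow> b \<in> B k \<Longrightarrow> a \<oplus> b \<in> B (Suc k)"
    "\<And>a b j k. a \<in> B j \<Longrightarrow> b \<in> B k \<Longrightarrow> a \<otimes> b \<in> B (j + k)"
    and B_minus: "\<And>a k. a \<in> B k \<Longrightarrow> \<ominus> a \<in> B k"
    and H: "H \<subseteq> (\<Union>k. B k)" and fin: "finite_dimension (generate_field R H) (carrier R)"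
  shows "\<exists>B c K us. filtered_field R B c K us"
proof -
  have mono: "B j \<subseteq> B k" if "j \<le> k" for j k by (rule lift_Suc_mono_le[of B, OF B(4) that])
  have A: "subring (\<Union>k. B k) R"
  proof (rule subringI)
    show "(\<Union>k. B k) \<subseteq> carrier R" "\<one> \<in> (\<Union>k. B k)" using B(1,6) by auto
    show "\<ominus> h \<in> (\<Union>k. B k)" if "h \<in> (\<Union>k. B k)" for h using that B_minus by blast
    fix x y assume "x \<in> (\<Union>k. B k)" "y \<in> (\<Union>k. B k)"
    then obtain j k where h: "x \<in> B j" "y \<in> B k" by blast
    show "x \<otimes> y \<in> (\<Union>k. B k)" using B(8)[OF h] by blast
    have "x \<in> B (max j k)" "y \<in> B (max j k)" using h mono[of j "max j k"] mono[of k "max j k"] by auto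
    from B(7)[OF this] show "x \<oplus> y \<in> (\<Union>k. B k)" by blast
  qed
  have Hc: "H \<subseteq> carrier R" using H B(1) by blast
  obtain n where "dimension n (generate_field R H) (carrier R)" using fin by (auto simp: finite_dimension_def)
  then obtain us where us: "set us \<subseteq> carrier R" "Span (generate_field R H) us = carrier R"
    using exists_base[OF generate_field_is_subfield[OF Hc]] by blast
  have "filtered_field R B c (generate_field R H) us"
  proof (unfold_locales)
    fix a assume "a \<in> generate_field R H"
    then show "\<exists>j k. \<exists>d\<in>B j - {\<zero>}. d \<otimes> a \<in> B k" using generate_field_fraction[OF A H] by blast
  qed (use B us generate_field_in_carrier[OF Hc] in auto)
  then show ?thesis by blast
qed

text \<open>With powers of 2 as bounds, a sum costs one level and a product costs the sum of the
  levels. Level \<open>k\<close> comes from \<open>2 * 2 ^ k + 1\<close> integers, and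
  \<open>c = 4\<close> absorbs both the factor and the summand. With \<open>H = {}\<close> the
  generated field is the prime field.\<close>

lemma number_field_filtration:
  assumes "number_field F" shows "\<exists>B c K us. filtered_field F B c K us"
proof -
  interpret field F using assms by (simp add: number_field_def)
  define z where "z m = [m] \<cdot>\<^bsub>F\<^esub> \<one>\<^bsub>F\<^esub>" for m :: int
  define B where "B k = z ` {- (2 ^ k) .. 2 ^ k}" for k :: nat
  have zc: "z m \<in> carrier F" for m by (simp add: z_def)
  have z_add: "z (a + b) = z a \<oplus>\<^bsub>F\<^esub> z b" for a b by (simp add: z_def add.int_pow_mult)
  have z_mult: "z (a * b) = z a \<otimes>\<^bsub>F\<^esub> z b" for a b
  proof -
    have "z a \<otimes>\<^bsub>F\<^esub> z b = [a] \<cdot>\<^bsub>F\<^esub> (\<one>\<^bsub>F\<^esub> \<otimes>\<^bsub>F\<^esub> z b)" unfolding z_def[of a] by (rule add_pow_ldistr_int) (auto simp: zc)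
    then show ?thesis by (simp add: zc) (simp add: z_def add.int_pow_pow mult.commute)
  qed
  have z_minus: "z (- a) = \<ominus>\<^bsub>F\<^esub> z a" for a by (simp add: z_def add.int_pow_neg)
  have card_B: "card (B k) \<le> 4 ^ (k + 1)" for k
  proof -
    have "card (B k) \<le> card {- (2 ^ k) .. 2 ^ k :: int}" unfolding B_def by (rule card_image_le) simp
    also have "\<dots> = 2 * 2 ^ k + 1" by (simp add: nat_add_distrib nat_mult_distrib nat_power_eq)
    also have "\<dots> \<le> 4 * 2 ^ k" by simp
    also have "\<dots> \<le> 4 * 4 ^ k" by (intro mult_left_mono power_mono) auto
    finally show ?thesis by simp
  qed
  show ?thesis
  proof (rule filtered_fieldI[where B = B and c = 4 and H = "{}"])
    show "card (B k) \<le> 4 ^ (k + 1)" for k by (rule card_B)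
    show "B k \<subseteq> B (Suc k)" for k unfolding B_def by (rule image_mono) auto
    show "\<zero>\<^bsub>F\<^esub> \<in> B 0" unfolding B_def by (rule image_eqI[of _ _ 0]) (simp_all add: z_def add_pow_int_ge)
    show "\<one>\<^bsub>F\<^esub> \<in> B 0" unfolding B_def by (rule image_eqI[of _ _ 1]) (auto simp: z_def)
    show "a \<oplus>\<^bsub>F\<^esub> b \<in> B (Suc k)" if h: "a \<in> B k" "b \<in> B k" for a b k
    proof -
      obtain m n where "a = z m" "b = z n" "m \<in> {- (2 ^ k) .. 2 ^ k}" "n \<in> {- (2 ^ k) .. 2 ^ k}"
        using h unfolding B_def by blast
      then show ?thesis unfolding B_def by (intro image_eqI[of _ _ "m + n"]) (auto simp: z_add)
    qed
    show "a \<otimes>\<^bsub>F\<^esub> b \<in> B (j + k)" if h: "a \<in> B j" "b \<in> B k" for a b j k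
    proof -
      obtain m n where mn: "a = z m" "b = z n" "m \<in> {- (2 ^ j) .. 2 ^ j}" "n \<in> {- (2 ^ k) .. 2 ^ k}"
        using h unfolding B_def by blast
      have "\<bar>m * n\<bar> \<le> 2 ^ j * 2 ^ k" unfolding abs_mult using mn(3,4) by (intro mult_mono) auto
      then show ?thesis unfolding B_def using mn(1,2)
        by (intro image_eqI[of _ _ "m * n"]) (auto simp: z_mult power_add abs_le_iff)
    qed
    show "\<ominus>\<^bsub>F\<^esub> a \<in> B k" if h: "a \<in> B k" for a k
    proof -
      obtain m where "a = z m" "m \<in> {- (2 ^ k) .. 2 ^ k}" using h unfolding B_def by blast
      then show ?thesis unfolding B_def by (intro image_eqI[of _ _ "- m"]) (auto simp: z_minus)
    qed
  qed (use assms zc in \<open>auto simp: number_field_def B_def\<close>)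
qed

text \<open>\<open>c\<close> is the number of constants, one factor for each of the
  \<open>k + 1\<close> coefficients.\<close>

lemma global_function_field_filtration:
  assumes "global_function_field F" shows "\<exists>B c K us. filtered_field F B c K us"
proof -
  interpret field F using assms by (simp add: global_function_field_def)
  obtain K t where K: "subfield K F" "finite K" and t: "t \<in> carrier F"
    and fin: "finite_dimension (generate_field F (insert t K)) (carrier F)"
    using assms by (auto simp: global_function_field_def)
  have Kr: "subring K F" using K(1) by (rule subfieldE(1))
  note K_closed = subringE(2,3,5,6,7)[OF Kr]
  have Kc: "K \<subseteq> carrier F" by (rule subringE(1)[OF Kr])
  \<comment> \<open>Horner recursion: a constant plus \<open>t\<close> times an element of the
    previous level.\<close>
  define B where "B = rec_nat K (\<lambda>_ S. (\<lambda>(a, b). a \<oplus>\<^bsub>F\<^esub> t \<otimes>\<^bsub>F\<^esub> b) ` (K \<times> S))"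
  have B0: "B 0 = K" and BS: "\<And>k. B (Suc k) = (\<lambda>(a, b). a \<oplus>\<^bsub>F\<^esub> t \<otimes>\<^bsub>F\<^esub> b) ` (K \<times> B k)"
    by (simp_all add: B_def)
  have BSE: "\<exists>a\<in>K. \<exists>b\<in>B k. x = a \<oplus>\<^bsub>F\<^esub> t \<otimes>\<^bsub>F\<^esub> b" if "x \<in> B (Suc k)" for x k using that unfolding BS by auto
  have BSI: "a \<oplus>\<^bsub>F\<^esub> t \<otimes>\<^bsub>F\<^esub> b \<in> B (Suc k)" if "a \<in> K" "b \<in> B k" for a b k using that unfolding BS by auto
  have Bc: "B k \<subseteq> carrier F" for k
  proof (induction k)
    case (Suc k)
    show ?case
    proof
      fix x assume "x \<in> B (Suc k)"
      then obtain a b where "a \<in> K" "b \<in> B k" "x = a \<oplus>\<^bsub>F\<^esub> t \<otimes>\<^bsub>F\<^esub> b" using BSE by blast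
      then show "x \<in> carrier F" using Kc Suc t by auto
    qed
  qed (simp add: B0 Kc)
  have zeroB: "\<zero>\<^bsub>F\<^esub> \<in> B k" for k
  proof (induction k)
    case (Suc k) then show ?case using BSI[OF K_closed(1) Suc] t by simp
  qed (simp add: B0 K_closed)
  have KB: "K \<subseteq> B k" for k
  proof (cases k)
    case (Suc j)
    have "a \<in> B (Suc j)" if "a \<in> K" for a using BSI[OF that zeroB[of j]] t that Kc by auto
    then show ?thesis using Suc by blast
  qed (simp add: B0)
  have BSuc: "B k \<subseteq> B (Suc k)" for k
  proof (induction k)
    case (Suc k)
    show ?case
    proof
      fix x assume "x \<in> B (Suc k)"
      then obtain a b where "a \<in> K" "b \<in> B k" "x = a \<oplus>\<^bsub>F\<^esub> t \<otimes>\<^bsub>F\<^esub> b" using BSE by blast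
      then show "x \<in> B (Suc (Suc k))" using BSI[of a b "Suc k"] Suc by blast
    qed
  qed (use KB[of 1] B0 in simp)
  have Badd: "x \<oplus>\<^bsub>F\<^esub> y \<in> B k" if "x \<in> B k" "y \<in> B k" for x y k
    using that
  proof (induction k arbitrary: x y)
    case 0 then show ?case using B0 K_closed by simp
  next
    case (Suc k)
    obtain a b where ab: "a \<in> K" "b \<in> B k" "x = a \<oplus>\<^bsub>F\<^esub> t \<otimes>\<^bsub>F\<^esub> b" using BSE[OF Suc.prems(1)] by blast
    obtain c d where cd: "c \<in> K" "d \<in> B k" "y = c \<oplus>\<^bsub>F\<^esub> t \<otimes>\<^bsub>F\<^esub> d" using BSE[OF Suc.prems(2)] by blast
    have C: "a \<in> carrier F" "b \<in> carrier F" "c \<in> carrier F" "d \<in> carrier F" using ab cd Kc Bc by auto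
    have "x \<oplus>\<^bsub>F\<^esub> y = (a \<oplus>\<^bsub>F\<^esub> c) \<oplus>\<^bsub>F\<^esub> t \<otimes>\<^bsub>F\<^esub> (b \<oplus>\<^bsub>F\<^esub> d)" using C t ab(3) cd(3) by algebra
    then show ?case using BSI[OF K_closed(5)[OF ab(1) cd(1)] Suc.IH[OF ab(2) cd(2)]] by simp
  qed
  have Bminus: "\<ominus>\<^bsub>F\<^esub> x \<in> B k" if "x \<in> B k" for x k
    using that
  proof (induction k arbitrary: x)
    case 0 then show ?case using B0 K_closed by simp
  next
    case (Suc k)
    obtain a b where ab: "a \<in> K" "b \<in> B k" "x = a \<oplus>\<^bsub>F\<^esub> t \<otimes>\<^bsub>F\<^esub> b" using BSE[OF Suc.prems(1)] by blast
    have C: "a \<in> carrier F" "b \<in> carrier F" using ab Kc Bc by auto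
    have "\<ominus>\<^bsub>F\<^esub> x = (\<ominus>\<^bsub>F\<^esub> a) \<oplus>\<^bsub>F\<^esub> t \<otimes>\<^bsub>F\<^esub> (\<ominus>\<^bsub>F\<^esub> b)" using C t ab(3) by algebra
    then show ?case using BSI[OF K_closed(3)[OF ab(1)] Suc.IH[OF ab(2)]] by simp
  qed
  have Kmult: "a \<otimes>\<^bsub>F\<^esub> y \<in> B k" if "a \<in> K" "y \<in> B k" for a y k
    using that
  proof (induction k arbitrary: y)
    case 0 then show ?case using B0 K_closed by simp
  next
    case (Suc k)
    obtain c d where cd: "c \<in> K" "d \<in> B k" "y = c \<oplus>\<^bsub>F\<^esub> t \<otimes>\<^bsub>F\<^esub> d" using BSE[OF Suc.prems(2)] by blast
    have C: "a \<in> carrier F" "c \<in> carrier F" "d \<in> carrier F" using that(1) cd Kc Bc by auto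
    have "a \<otimes>\<^bsub>F\<^esub> y = (a \<otimes>\<^bsub>F\<^esub> c) \<oplus>\<^bsub>F\<^esub> t \<otimes>\<^bsub>F\<^esub> (a \<otimes>\<^bsub>F\<^esub> d)" using C t cd(3) by algebra
    then show ?case using BSI[OF K_closed(4)[OF that(1) cd(1)] Suc.IH[OF that(1) cd(2)]] by simp
  qed
  have Bmult: "x \<otimes>\<^bsub>F\<^esub> y \<in> B (j + k)" if "x \<in> B j" "y \<in> B k" for x y j k
    using that(1)
  proof (induction j arbitrary: x)
    case 0 then show ?case using B0 Kmult that(2) by simp
  next
    case (Suc j)
    obtain a b where ab: "a \<in> K" "b \<in> B j" "x = a \<oplus>\<^bsub>F\<^esub> t \<otimes>\<^bsub>F\<^esub> b" using BSE[OF Suc.prems] by blast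
    have C: "a \<in> carrier F" "b \<in> carrier F" "y \<in> carrier F" using ab that(2) Kc Bc by auto
    \<comment> \<open>The zero constant term puts the product by \<open>t\<close> into the Horner
      form of the next level.\<close>
    have "x \<otimes>\<^bsub>F\<^esub> y = a \<otimes>\<^bsub>F\<^esub> y \<oplus>\<^bsub>F\<^esub> (\<zero>\<^bsub>F\<^esub> \<oplus>\<^bsub>F\<^esub> t \<otimes>\<^bsub>F\<^esub> (b \<otimes>\<^bsub>F\<^esub> y))" using C t ab(3) by algebra
    moreover have "a \<otimes>\<^bsub>F\<^esub> y \<in> B (Suc j + k)"
      using Kmult[OF ab(1) that(2)] lift_Suc_mono_le[of B k "Suc j + k"] BSuc by auto
    moreover have "\<zero>\<^bsub>F\<^esub> \<oplus>\<^bsub>F\<^esub> t \<otimes>\<^bsub>F\<^esub> (b \<otimes>\<^bsub>F\<^esub> y) \<in> B (Suc j + k)"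
      using BSI[OF K_closed(1) Suc.IH[OF ab(2)]] by simp
    ultimately show ?case using Badd by simp
  qed
  have Bfin: "finite (B k) \<and> card (B k) \<le> card K ^ (k + 1)" for k
  proof (induction k)
    case (Suc k)
    have f: "finite (K \<times> B k)" using K(2) Suc by simp
    have "card (B (Suc k)) \<le> card (K \<times> B k)" unfolding BS using f by (rule card_image_le)
    also have "\<dots> \<le> card K * card K ^ (k + 1)" using Suc by (simp add: card_cartesian_product)
    finally show ?case using finite_imageI[OF f] unfolding BS by simp
  qed (simp add: B0 K)
  have tB: "t \<in> B 1" using BSI[of "\<zero>\<^bsub>F\<^esub>" "\<one>\<^bsub>F\<^esub>" 0] K_closed B0 t by simp
  show ?thesis
  proof (rule filtered_fieldI[where B = B and c = "card K" and H = "insert t K"])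
    show "insert t K \<subseteq> (\<Union>k. B k)" using tB B0 by blast
    show "a \<oplus>\<^bsub>F\<^esub> b \<in> B (Suc k)" if "a \<in> B k" "b \<in> B k" for a b k using Badd[OF that] BSuc by blast
    show "\<one>\<^bsub>F\<^esub> \<in> B 0" using B0 K_closed by simp
  qed (use Bc Bfin BSuc zeroB Bmult Bminus fin in blast)+
qed

lemma global_field_filtration:
  "global_field F \<Longrightarrow> \<exists>B c K us. filtered_field F B c K us"
  unfolding global_field_def using number_field_filtration global_function_field_filtration by blast

section \<open>Ideals in domains with finite quotients\<close>

context cring
begin

abbreviation ideal_pow :: "'a set \<Rightarrow> nat \<Rightarrow> 'a set" where
  "ideal_pow J k \<equiv> J [^]\<^bsub>ideals_set R\<^esub> k"

lemma mem_carrier_ideals_set: "J \<in> carrier (ideals_set R) \<longleftrightarrow> ideal J R"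
  by (simp add: ideals_set_def)

lemma monoid_ideals_set: "Group.monoid (ideals_set R)"
  using ideals_set_is_comm_monoid by (simp add: comm_monoid_def)

lemma ideal_pow_0: "ideal_pow J 0 = carrier R"
  by (simp add: ideals_set_def)

lemma ideal_pow_Suc: "ideal_pow J (Suc k) = ideal_pow J k \<cdot> J"
  by (simp add: ideals_set_def)

lemma ideal_ideal_pow: "ideal J R \<Longrightarrow> ideal (ideal_pow J k) R"
  using monoid.nat_pow_closed[OF monoid_ideals_set] mem_carrier_ideals_set by blast

lemma ideal_pow_add: "ideal J R \<Longrightarrow> ideal_pow J (j + k) = ideal_pow J j \<cdot> ideal_pow J k"
  using monoid.nat_pow_mult[OF monoid_ideals_set, of J j k] by (simp add: ideals_set_def)

lemma ideal_pow_1: "ideal J R \<Longrightarrow> ideal_pow J 1 = J"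
  using monoid.nat_pow_eone[OF monoid_ideals_set, of J] by (simp add: ideals_set_def)

lemma ideal_pow_antimono: assumes "ideal J R" "j \<le> k" shows "ideal_pow J k \<subseteq> ideal_pow J j"
  using ideal_pow_add[OF assms(1), of j "k - j"] assms ideal_ideal_pow[OF assms(1)]
    ideal_prod_inter[of "ideal_pow J j" "ideal_pow J (k - j)"] by auto

lemma pow_mem_ideal_pow: "ideal J R \<Longrightarrow> a \<in> J \<Longrightarrow> a [^] k \<in> ideal_pow J k"
proof (induction k)
  case 0 then show ?case by (simp only: ideal_pow_0 nat_pow_0 one_closed)
next
  case (Suc k)
  then have "a [^] k \<otimes> a \<in> ideal_pow J k \<cdot> J" by (intro ideal_prod.prod) auto
  then show ?case by (simp only: ideal_pow_Suc nat_pow_Suc)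
qed

lemma ideal_closed:
  assumes "ideal J R"
  shows ideal_subset: "J \<subseteq> carrier R" and ideal_zero: "\<zero> \<in> J"
    and ideal_add: "a \<in> J \<Longrightarrow> b \<in> J \<Longrightarrow> a \<oplus> b \<in> J" and ideal_minus: "a \<in> J \<Longrightarrow> \<ominus> a \<in> J"
    and ideal_mult: "a \<in> J \<Longrightarrow> c \<in> carrier R \<Longrightarrow> c \<otimes> a \<in> J"
    and ideal_mult_right: "a \<in> J \<Longrightarrow> c \<in> carrier R \<Longrightarrow> a \<otimes> c \<in> J"
proof -
  interpret ideal J R by fact
  show "J \<subseteq> carrier R" "\<zero> \<in> J" "a \<in> J \<Longrightarrow> b \<in> J \<Longrightarrow> a \<oplus> b \<in> J" "a \<in> J \<Longrightarrow> \<ominus> a \<in> J"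
    "a \<in> J \<Longrightarrow> c \<in> carrier R \<Longrightarrow> c \<otimes> a \<in> J" "a \<in> J \<Longrightarrow> c \<in> carrier R \<Longrightarrow> a \<otimes> c \<in> J"
    using a_subset I_l_closed I_r_closed by auto
qed

text \<open>Powers of an element congruent to 1 are congruent to 1: 1 - u^(k+1) = (1 - u^k) + u^k (1
  - u).\<close>

lemma one_minus_pow_mem:
  assumes "ideal J R" "u \<in> carrier R" "\<one> \<ominus> u \<in> J" shows "\<one> \<ominus> u [^] (k::nat) \<in> J"
proof (induction k)
  case 0 then show ?case using ideal_zero[OF assms(1)] by (simp add: a_minus_def r_neg)
next
  case (Suc k)
  have c: "u [^] k \<in> carrier R" using assms by simp
  then have "\<one> \<ominus> u [^] k \<otimes> u = (\<one> \<ominus> u [^] k) \<oplus> u [^] k \<otimes> (\<one> \<ominus> u)" using assms(2) by algebra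
  then show ?case using ideal_add[OF assms(1) Suc ideal_mult[OF assms(1,3) c]] by simp
qed

text \<open>The colon ideal of \<open>J\<close> by \<open>y\<close>. It turns a statement about
  multiples of \<open>y\<close> into a containment in an ideal, to which an induction over all
  ideals applies.\<close>

lemma ideal_quotient: assumes "ideal J R" "y \<in> carrier R" shows "ideal {x \<in> carrier R. x \<otimes> y \<in> J} R"
proof (rule idealI)
  show "ring R" by (rule ring_axioms)
  show "subgroup {x \<in> carrier R. x \<otimes> y \<in> J} (add_monoid R)"
  proof (rule add.subgroupI)
    show "{x \<in> carrier R. x \<otimes> y \<in> J} \<noteq> {}" using ideal_zero[OF assms(1)] assms(2) by (auto intro: exI[of _ \<zero>])
    show "\<ominus> a \<in> {x \<in> carrier R. x \<otimes> y \<in> J}" if "a \<in> {x \<in> carrier R. x \<otimes> y \<in> J}" for a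
      using that ideal_minus[OF assms(1), of "a \<otimes> y"] assms(2) by (simp add: l_minus)
    show "a \<oplus> b \<in> {x \<in> carrier R. x \<otimes> y \<in> J}"
      if "a \<in> {x \<in> carrier R. x \<otimes> y \<in> J}" "b \<in> {x \<in> carrier R. x \<otimes> y \<in> J}" for a b
      using that ideal_add[OF assms(1), of "a \<otimes> y" "b \<otimes> y"] assms(2) by (simp add: l_distr)
  qed auto
  fix a x assume ax: "a \<in> {x \<in> carrier R. x \<otimes> y \<in> J}" "x \<in> carrier R"
  then have "x \<otimes> (a \<otimes> y) \<in> J" using ideal_mult[OF assms(1)] by blast
  then show "x \<otimes> a \<in> {x \<in> carrier R. x \<otimes> y \<in> J}" using ax assms(2) by (simp add: m_assoc)
  then show "a \<otimes> x \<in> {x \<in> carrier R. x \<otimes> y \<in> J}" using ax by (simp add: m_comm)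
qed

lemma ideal_prod_subset_ideal:
  assumes "ideal J R" "\<And>u v. u \<in> A \<Longrightarrow> v \<in> B \<Longrightarrow> u \<otimes> v \<in> J" shows "A \<cdot> B \<subseteq> J"
proof
  fix s assume "s \<in> A \<cdot> B" then show "s \<in> J"
    by induction (auto intro: assms(2) ideal_add[OF assms(1)])
qed

text \<open>Membership in the carrier is listed separately so that the empty set of primes gives the
  whole ring.\<close>

definition pow_Inter :: "'a set set \<Rightarrow> nat \<Rightarrow> 'a set" where
  "pow_Inter Q k = {x \<in> carrier R. \<forall>P\<in>Q. x \<in> ideal_pow P k}"

lemma pow_Inter_mono:
  "Q \<subseteq> Q' \<Longrightarrow> k \<le> k' \<Longrightarrow> \<forall>P\<in>Q. ideal P R \<Longrightarrow> pow_Inter Q' k' \<subseteq> pow_Inter Q k"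
  unfolding pow_Inter_def using ideal_pow_antimono by blast

end

text \<open>Finite quotients give compact completions and drive the ideal theory behind their
  splitting into local parts; countability of the ring gives countably many levels.\<close>

locale finite_quotient_domain = domain R for R (structure) +
  assumes finite_quotient: "I \<in> nonzero_ideals R \<Longrightarrow> finite (carrier (R Quot I))"
    and countable_carrier: "countable (carrier R)"
begin

lemma nonzero_idealsD: "I \<in> nonzero_ideals R \<Longrightarrow> ideal I R"
  by (simp add: nonzero_ideals_def)

lemma nonzero_ideal_ex: "I \<in> nonzero_ideals R \<Longrightarrow> \<exists>x\<in>I. x \<noteq> \<zero>"
  using ideal_zero unfolding nonzero_ideals_def by blast

lemma nonzero_idealsI: "ideal I R \<Longrightarrow> x \<in> I \<Longrightarrow> x \<noteq> \<zero> \<Longrightarrow> I \<in> nonzero_ideals R"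
  by (auto simp: nonzero_ideals_def)

lemma nonzero_primes_ideal: "P \<in> nonzero_primes R \<Longrightarrow> ideal P R"
  by (simp add: nonzero_primes_def primeideal.axioms)

lemma nonzero_primesD: "P \<in> nonzero_primes R \<Longrightarrow> P \<in> nonzero_ideals R"
  using nonzero_primes_ideal by (auto simp: nonzero_primes_def nonzero_ideals_def)

lemma carrier_nonzero_ideal: "carrier R \<in> nonzero_ideals R"
  by (rule nonzero_idealsI[of _ \<one>]) (simp_all add: oneideal)

lemma ideal_prod_nonzero:
  assumes "I \<in> nonzero_ideals R" "J \<in> nonzero_ideals R" shows "I \<cdot> J \<in> nonzero_ideals R"
proof -
  obtain x y where xy: "x \<in> I" "x \<noteq> \<zero>" "y \<in> J" "y \<noteq> \<zero>" using nonzero_ideal_ex assms by metis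
  then have "x \<in> carrier R" "y \<in> carrier R" using assms nonzero_idealsD ideal_subset by blast+
  then have "x \<otimes> y \<noteq> \<zero>" using xy integral_iff by simp
  then show ?thesis
    using ideal_prod.prod[OF xy(1,3)] ideal_prod_is_ideal assms nonzero_idealsD by (intro nonzero_idealsI) auto
qed

lemma ideal_pow_nonzero: "I \<in> nonzero_ideals R \<Longrightarrow> ideal_pow I k \<in> nonzero_ideals R"
proof (induction k)
  case 0 then show ?case using carrier_nonzero_ideal by (simp only: ideal_pow_0)
next
  case (Suc k) then show ?case using ideal_prod_nonzero by (simp only: ideal_pow_Suc)
qed

text \<open>An ideal above \<open>I\<close> is a union of cosets of \<open>I\<close>, so it is named
  by a subset of the finite quotient. The number of such ideals later serves as an induction
  measure.\<close>

lemma finite_overideals: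
  assumes "I \<in> nonzero_ideals R" shows "finite {J. ideal J R \<and> I \<subseteq> J}"
proof -
  let ?f = "\<lambda>J. {C \<in> carrier (R Quot I). C \<subseteq> J}"
  have I: "ideal I R" using assms nonzero_idealsD by blast
  have U: "J = \<Union>(?f J)" if J: "ideal J R" "I \<subseteq> J" for J
  proof
    show "J \<subseteq> \<Union>(?f J)"
    proof
      fix x assume x: "x \<in> J"
      then have xc: "x \<in> carrier R" using ideal_subset[OF J(1)] by blast
      have "I +> x \<subseteq> J" using ideal_add[OF J(1) _ x] J(2) by (auto simp: a_r_coset_def')
      moreover have "x \<in> I +> x" using ideal_zero[OF I] xc by (force simp: a_r_coset_def')
      ultimately show "x \<in> \<Union>(?f J)" using xc by (auto simp: FactRing_def A_RCOSETS_def')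
    qed
  qed blast
  have "inj_on ?f {J. ideal J R \<and> I \<subseteq> J}"
  proof (rule inj_onI)
    fix J K assume "J \<in> {J. ideal J R \<and> I \<subseteq> J}" "K \<in> {J. ideal J R \<and> I \<subseteq> J}" and eq: "?f J = ?f K"
    then have "J = \<Union>(?f J)" "K = \<Union>(?f K)" using U by blast+
    then show "J = K" unfolding eq by (rule trans[OF _ sym])
  qed
  moreover have "?f ` {J. ideal J R \<and> I \<subseteq> J} \<subseteq> Pow (carrier (R Quot I))" by blast
  ultimately show ?thesis using finite_quotient[OF assms] by (meson finite_Pow_iff inj_on_finite)
qed

text \<open>Every non-zero ideal lies above a non-zero principal one; these are countably many, each
  with finitely many ideals above it.\<close>

lemma countable_nonzero_ideals: "countable (nonzero_ideals R)"
proof -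
  have "nonzero_ideals R \<subseteq> (\<Union>x\<in>carrier R - {\<zero>}. {J. ideal J R \<and> PIdl x \<subseteq> J})"
  proof
    fix J assume J: "J \<in> nonzero_ideals R"
    then obtain x where x: "x \<in> J" "x \<noteq> \<zero>" using nonzero_ideal_ex by blast
    have "PIdl x \<subseteq> J" using x nonzero_idealsD[OF J] ideal_mult_right by (auto simp: cgenideal_def ideal_mult)
    then show "J \<in> (\<Union>x\<in>carrier R - {\<zero>}. {J. ideal J R \<and> PIdl x \<subseteq> J})"
      using x nonzero_idealsD[OF J] ideal_subset by blast
  qed
  moreover have "countable (\<Union>x\<in>carrier R - {\<zero>}. {J. ideal J R \<and> PIdl x \<subseteq> J})"
  proof (rule countable_UN)
    show "countable (carrier R - {\<zero>})" using countable_carrier by (rule countable_Diff)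
    fix x assume x: "x \<in> carrier R - {\<zero>}"
    then have "PIdl x \<in> nonzero_ideals R"
      using cgenideal_ideal cgenideal_self by (intro nonzero_idealsI[of _ x]) auto
    then show "countable {J. ideal J R \<and> PIdl x \<subseteq> J}" by (intro countable_finite finite_overideals)
  qed
  ultimately show ?thesis by (rule countable_subset)
qed

text \<open>Pigeonhole on the powers of \<open>a\<close> modulo \<open>P\<close>: two of them agree,
  and primality cancels the smaller one. This is the concrete form of a finite domain being a field,
  the inverse of \<open>a\<close> being a power of \<open>a\<close>.\<close>

lemma prime_power_one_minus_mem:
  assumes P: "P \<in> nonzero_primes R" and a: "a \<in> carrier R" "a \<notin> P"
  shows "\<exists>k. \<one> \<ominus> a [^] Suc k \<in> P"
proof -
  interpret primeideal P R using P by (simp add: nonzero_primes_def)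
  have "range (\<lambda>i::nat. P +> a [^] i) \<subseteq> carrier (R Quot P)"
    using a by (auto simp: FactRing_def A_RCOSETS_def')
  then have "finite (range (\<lambda>i::nat. P +> a [^] i))"
    using finite_quotient[OF nonzero_primesD[OF P]] finite_subset by blast
  then have "\<not> inj (\<lambda>i::nat. P +> a [^] i)" using finite_imageD infinite_UNIV_nat by blast
  then obtain i j where ij: "i < j" "P +> a [^] i = P +> a [^] (j::nat)"
    by (metis linorder_injI)
  define k where "k = j - i - 1"
  have j: "j = i + Suc k" using ij(1) by (simp add: k_def)
  have ac: "a [^] i \<in> carrier R" "a [^] Suc k \<in> carrier R" using a by auto
  have "a [^] i \<ominus> a [^] j \<in> P"
    using quotient_eq_iff_same_a_r_cos[OF is_ideal, of "a [^] i" "a [^] j"] ij(2) a by simp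
  also have "a [^] i \<ominus> a [^] j = a [^] i \<otimes> (\<one> \<ominus> a [^] Suc k)"
  proof -
    have "a [^] j = a [^] i \<otimes> a [^] Suc k" unfolding j by (rule nat_pow_mult[symmetric, OF a(1)])
    moreover have "x \<ominus> x \<otimes> y = x \<otimes> (\<one> \<ominus> y)" if "x \<in> carrier R" "y \<in> carrier R" for x y using that by algebra
    ultimately show ?thesis using ac by simp
  qed
  finally have "a [^] i \<in> P \<or> \<one> \<ominus> a [^] Suc k \<in> P" using I_prime ac by blast
  moreover have "a [^] m \<notin> P" for m :: nat
  proof (induction m)
    case 0
    have "\<one> \<notin> P" using I_notcarr one_imp_carrier by blast
    then show ?case by simp
  next
    case (Suc m) then show ?case using I_prime[of "a [^] m" a] a by auto
  qed
  ultimately show ?thesis by blast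
qed

text \<open>One of the primes has an element outside the other; a positive power of it stays in the
  first prime and is 1 modulo the second. The two cases differ in which prime has it, and in the
  second one the complement to 1 is taken.\<close>

lemma primes_comaximal:
  assumes P: "P \<in> nonzero_primes R" and Q: "Q \<in> nonzero_primes R" and ne: "P \<noteq> Q"
  shows "\<exists>u\<in>P. \<one> \<ominus> u \<in> Q"
proof -
  have c: "P \<subseteq> carrier R" "Q \<subseteq> carrier R" using P Q nonzero_primes_ideal ideal_subset by auto
  have idP: "ideal P R" "ideal Q R" using P Q nonzero_primes_ideal by auto
  have powI: "a [^] Suc k \<in> J" if "ideal J R" "a \<in> J" for a k J
    using ideal_mult[OF that, of "a [^] k"] that ideal_subset[OF that(1)] by auto
  consider a where "a \<in> P" "a \<notin> Q" | a where "a \<in> Q" "a \<notin> P" using ne by blast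
  then show ?thesis
  proof cases
    case 1
    then obtain k where "\<one> \<ominus> a [^] Suc k \<in> Q" using prime_power_one_minus_mem[OF Q] c by blast
    then show ?thesis using powI[OF idP(1) 1(1)] by blast
  next
    case 2
    then obtain k where k: "\<one> \<ominus> a [^] Suc k \<in> P" using prime_power_one_minus_mem[OF P] c by blast
    have ac: "a [^] Suc k \<in> carrier R" using 2 c by blast
    have "\<one> \<ominus> (\<one> \<ominus> x) = x" if "x \<in> carrier R" for x using that by algebra
    then have "\<one> \<ominus> (\<one> \<ominus> a [^] Suc k) \<in> Q" using powI[OF idP(2) 2(1)] ac by simp
    then show ?thesis using k by blast
  qed
qed

text \<open>Powers are taken twice. With \<open>u\<close> in \<open>P\<close> and congruent to 1
  modulo \<open>Q\<close>, the element 1 - u^k lies in \<open>Q\<close> and is 1 modulo the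
  \<open>k\<close>-th power of \<open>P\<close>; its own \<open>k\<close>-th power lies in that of
  \<open>Q\<close> and is still 1 modulo that of \<open>P\<close>.\<close>

lemma prime_powers_comaximal:
  assumes P: "P \<in> nonzero_primes R" and Q: "Q \<in> nonzero_primes R" and ne: "P \<noteq> Q"
  shows "\<exists>e\<in>ideal_pow Q k. \<one> \<ominus> e \<in> ideal_pow P k"
proof -
  have id: "ideal P R" "ideal Q R" using P Q nonzero_primes_ideal by auto
  obtain u where u: "u \<in> P" "\<one> \<ominus> u \<in> Q" using primes_comaximal[OF assms] by blast
  have uc: "u \<in> carrier R" using u ideal_subset[OF id(1)] by blast
  let ?w = "\<one> \<ominus> u [^] k"
  have w: "?w \<in> Q" by (rule one_minus_pow_mem[OF id(2) uc u(2)])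
  have wc: "?w \<in> carrier R" using uc by simp
  have "\<one> \<ominus> ?w = u [^] k"
  proof -
    have "\<one> \<ominus> (\<one> \<ominus> x) = x" if "x \<in> carrier R" for x using that by algebra
    then show ?thesis using uc by simp
  qed
  then have "\<one> \<ominus> ?w \<in> ideal_pow P k" using pow_mem_ideal_pow[OF id(1) u(1)] by simp
  then have "\<one> \<ominus> ?w [^] k \<in> ideal_pow P k" by (rule one_minus_pow_mem[OF ideal_ideal_pow[OF id(1)] wc])
  moreover have "?w [^] k \<in> ideal_pow Q k" by (rule pow_mem_ideal_pow[OF id(2) w])
  ultimately show ?thesis by blast
qed

text \<open>Multiply the elements found for the single primes: each factor secures one power, and a
  product of elements congruent to 1 is congruent to 1.\<close>

lemma pow_Inter_comaximal:
  assumes P: "P \<in> nonzero_primes R" and Q: "finite Q" "Q \<subseteq> nonzero_primes R" "P \<notin> Q"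
  shows "\<exists>e\<in>pow_Inter Q k. \<one> \<ominus> e \<in> ideal_pow P k"
  using Q
proof (induction Q)
  have id: "ideal (ideal_pow P k) R" using ideal_ideal_pow nonzero_primes_ideal P by blast
  {
    case empty
    have "\<one> \<ominus> \<one> \<in> ideal_pow P k" using ideal_zero[OF id] by (simp add: a_minus_def r_neg)
    then show ?case by (auto simp: pow_Inter_def intro!: bexI[of _ \<one>])
  next
    case (insert S Q)
    then obtain e where e: "e \<in> pow_Inter Q k" "\<one> \<ominus> e \<in> ideal_pow P k" by auto
    obtain f where f: "f \<in> ideal_pow S k" "\<one> \<ominus> f \<in> ideal_pow P k"
      using prime_powers_comaximal[OF P, of S k] insert.prems by auto
    have idS: "ideal (ideal_pow T k) R" if "T \<in> insert S Q" for T
      using ideal_ideal_pow nonzero_primes_ideal insert.prems that by blast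
    have c: "e \<in> carrier R" "f \<in> carrier R"
      using e f ideal_subset[OF idS[of S]] by (auto simp: pow_Inter_def)
    have "e \<otimes> f \<in> ideal_pow T k" if T: "T \<in> insert S Q" for T
    proof (cases "T = S")
      case True then show ?thesis using ideal_mult[OF idS[OF T], of f e] f c by simp
    next
      case False
      then have "e \<in> ideal_pow T k" using e(1) T by (auto simp: pow_Inter_def)
      then show ?thesis by (rule ideal_mult_right[OF idS[OF T] _ c(2)])
    qed
    then have "e \<otimes> f \<in> pow_Inter (insert S Q) k" unfolding pow_Inter_def using c by simp
    moreover have "\<one> \<ominus> e \<otimes> f = (\<one> \<ominus> e) \<oplus> e \<otimes> (\<one> \<ominus> f)" using c by algebra
    then have "\<one> \<ominus> e \<otimes> f \<in> ideal_pow P k"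
      using ideal_add[OF id e(2) ideal_mult[OF id f(2) c(1)]] by simp
    ultimately show ?case by blast
  }
qed

lemma chinese_remainder:
  assumes P: "P \<in> nonzero_primes R" and Q: "finite Q" "Q \<subseteq> nonzero_primes R" "P \<notin> Q" and a: "a \<in> carrier R"
  shows "\<exists>d\<in>pow_Inter Q k. a \<ominus> d \<in> ideal_pow P k"
proof -
  obtain e where e: "e \<in> pow_Inter Q k" "\<one> \<ominus> e \<in> ideal_pow P k" using pow_Inter_comaximal[OF P Q] by blast
  have c: "e \<in> carrier R" using e by (simp add: pow_Inter_def)
  have "a \<otimes> e \<in> pow_Inter Q k"
    using e(1) a c ideal_mult[OF ideal_ideal_pow[OF nonzero_primes_ideal]] Q(2) by (auto simp: pow_Inter_def)
  moreover have "a \<ominus> a \<otimes> e = a \<otimes> (\<one> \<ominus> e)" using a c by algebra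
  then have "a \<ominus> a \<otimes> e \<in> ideal_pow P k"
    using ideal_mult[OF ideal_ideal_pow[OF nonzero_primes_ideal[OF P]] e(2) a] by simp
  ultimately show ?thesis by blast
qed

text \<open>The intersection with doubled exponent stands in for the square of the intersection,
  comaximality making the two comparable. The proof splits 1 = e + f, with \<open>e\<close> in the
  powers for \<open>Q\<close> and \<open>f\<close> in the power of \<open>P\<close>, and handles the
  two parts separately.\<close>

lemma pow_Inter_double_subset:
  assumes Q: "finite Q" "Q \<subseteq> nonzero_primes R" and I: "ideal I R"
    and prod: "\<And>u v. u \<in> pow_Inter Q k \<Longrightarrow> v \<in> pow_Inter Q k \<Longrightarrow> u \<otimes> v \<in> I"
  shows "pow_Inter Q (k + k) \<subseteq> I"
  using Q I prod
proof (induction Q arbitrary: I)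
  case empty
  have "\<one> \<otimes> \<one> \<in> I" by (rule empty.prems(3)) (simp_all add: pow_Inter_def)
  then have "x \<in> I" if "x \<in> carrier R" for x using ideal_mult[OF empty.prems(2), of \<one> x] that by simp
  then show ?case by (auto simp: pow_Inter_def)
next
  case (insert P Q)
  have P: "P \<in> nonzero_primes R" and Q: "Q \<subseteq> nonzero_primes R" using insert.prems by auto
  have id: "ideal P R" using nonzero_primes_ideal P by blast
  obtain e where e: "e \<in> pow_Inter Q k" "\<one> \<ominus> e \<in> ideal_pow P k"
    using pow_Inter_comaximal[OF P insert.hyps(1) Q insert.hyps(2)] by blast
  have c: "e \<in> carrier R" using e by (simp add: pow_Inter_def)
  let ?f = "\<one> \<ominus> e"
  have fc: "?f \<in> carrier R" using c by simp
  have idT: "ideal (ideal_pow T k) R" if "T \<in> insert P Q" for T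
    using ideal_ideal_pow nonzero_primes_ideal insert.prems that by blast
  have mem1: "u \<otimes> e \<in> pow_Inter (insert P Q) k" if u: "u \<in> ideal_pow P k" for u
  proof -
    have uc: "u \<in> carrier R" using u ideal_subset[OF idT[of P]] by auto
    have "u \<otimes> e \<in> ideal_pow T k" if T: "T \<in> insert P Q" for T
    proof (cases "T = P")
      case True then show ?thesis using ideal_mult_right[OF idT[OF T] _ c] u by simp
    next
      case False
      then have "e \<in> ideal_pow T k" using e(1) T by (auto simp: pow_Inter_def)
      then show ?thesis by (rule ideal_mult[OF idT[OF T] _ uc])
    qed
    then show ?thesis using uc c by (simp add: pow_Inter_def)
  qed
  have mem2: "u \<otimes> ?f \<in> pow_Inter (insert P Q) k" if u: "u \<in> pow_Inter Q k" for u
  proof -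
    have uc: "u \<in> carrier R" using u by (auto simp: pow_Inter_def)
    have "u \<otimes> ?f \<in> ideal_pow T k" if T: "T \<in> insert P Q" for T
    proof (cases "T = P")
      case True then show ?thesis using ideal_mult[OF idT[OF T] _ uc] e(2) by simp
    next
      case False
      then have "u \<in> ideal_pow T k" using u T by (auto simp: pow_Inter_def)
      then show ?thesis by (rule ideal_mult_right[OF idT[OF T] _ fc])
    qed
    then show ?thesis using uc fc by (simp add: pow_Inter_def)
  qed
  \<comment> \<open>In the colon ideals by e^2 and f^2 the hypothesis on products speaks about
    \<open>P\<close> alone and about \<open>Q\<close> alone; the second is where the induction needs
    an arbitrary ideal.\<close>
  let ?I1 = "{x \<in> carrier R. x \<otimes> (e \<otimes> e) \<in> I}" and ?I2 = "{x \<in> carrier R. x \<otimes> (?f \<otimes> ?f) \<in> I}"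
  have id1: "ideal ?I1 R" and id2: "ideal ?I2 R"
    using ideal_quotient[OF insert.prems(2)] c fc by simp_all
  have sub1: "ideal_pow P (k + k) \<subseteq> ?I1"
    unfolding ideal_pow_add[OF id]
  proof (rule ideal_prod_subset_ideal[OF id1])
    fix u v assume uv: "u \<in> ideal_pow P k" "v \<in> ideal_pow P k"
    then have C: "u \<in> carrier R" "v \<in> carrier R" using ideal_subset[OF idT[of P]] by auto
    have "(u \<otimes> e) \<otimes> (v \<otimes> e) \<in> I" by (rule insert.prems(3)[OF mem1[OF uv(1)] mem1[OF uv(2)]])
    moreover have "(u \<otimes> e) \<otimes> (v \<otimes> e) = (u \<otimes> v) \<otimes> (e \<otimes> e)" using C c by algebra
    ultimately show "u \<otimes> v \<in> ?I1" using C by simp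
  qed
  have sub2: "pow_Inter Q (k + k) \<subseteq> ?I2"
  proof (rule insert.IH[OF Q id2])
    fix u v assume uv: "u \<in> pow_Inter Q k" "v \<in> pow_Inter Q k"
    then have C: "u \<in> carrier R" "v \<in> carrier R" by (auto simp: pow_Inter_def)
    have "(u \<otimes> ?f) \<otimes> (v \<otimes> ?f) \<in> I" by (rule insert.prems(3)[OF mem2[OF uv(1)] mem2[OF uv(2)]])
    moreover have "(u \<otimes> ?f) \<otimes> (v \<otimes> ?f) = (u \<otimes> v) \<otimes> (?f \<otimes> ?f)" using C fc by (simp add: m_ac)
    ultimately show "u \<otimes> v \<in> ?I2" using C by simp
  qed
  show ?case
  proof
    fix x assume x: "x \<in> pow_Inter (insert P Q) (k + k)"
    then have xc: "x \<in> carrier R" by (simp add: pow_Inter_def)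
    have "x \<in> ideal_pow P (k + k)" "x \<in> pow_Inter Q (k + k)" using x by (simp_all add: pow_Inter_def)
    then have z: "x \<otimes> (e \<otimes> e) \<in> I" "x \<otimes> (?f \<otimes> ?f) \<in> I" using sub1 sub2 by blast+
    \<comment> \<open>For e + f = 1 the coefficients give (1 + 2f) e^2 + (1 + 2e) f^2 = e^2 + f^2 +
      2ef(e + f) = (e + f)^2 = 1.\<close>
    have "(\<one> \<oplus> ?f \<oplus> ?f) \<otimes> (x \<otimes> (e \<otimes> e)) \<oplus> (\<one> \<oplus> e \<oplus> e) \<otimes> (x \<otimes> (?f \<otimes> ?f)) \<in> I"
      by (rule ideal_add[OF insert.prems(2) ideal_mult[OF insert.prems(2) z(1)] ideal_mult[OF insert.prems(2) z(2)]])
        (use c fc in simp_all)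
    moreover have "(\<one> \<oplus> ?f \<oplus> ?f) \<otimes> (x \<otimes> (e \<otimes> e)) \<oplus> (\<one> \<oplus> e \<oplus> e) \<otimes> (x \<otimes> (?f \<otimes> ?f)) = x"
      using c xc by algebra
    ultimately show "x \<in> I" by simp
  qed
qed

text \<open>Induction on the number of ideals above \<open>I\<close>. If \<open>I\<close> is neither
  the ring nor prime, pick \<open>a\<close>, \<open>b\<close> outside \<open>I\<close> with product
  in \<open>I\<close>: the larger ideals \<open>I + (a)\<close> and \<open>I + (b)\<close> multiply
  into \<open>I\<close>. An intersection of prime powers below both thus has all its products in
  \<open>I\<close>, and doubling the exponent puts it inside \<open>I\<close>.\<close>

lemma nonzero_ideal_contains_pow_Inter:
  assumes "I \<in> nonzero_ideals R"
  shows "\<exists>Q k. finite Q \<and> Q \<subseteq> nonzero_primes R \<and> pow_Inter Q k \<subseteq> I"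
  using assms
proof (induction "card {J. ideal J R \<and> I \<subseteq> J}" arbitrary: I rule: less_induct)
  case less
  have I: "ideal I R" using less.prems nonzero_idealsD by blast
  consider "I = carrier R" | "primeideal I R" | a b where "a \<in> carrier R" "b \<in> carrier R" "a \<otimes> b \<in> I" "a \<notin> I" "b \<notin> I"
    using I primeidealI[OF I is_cring] by blast
  then show ?case
  proof cases
    case 1
    then show ?thesis by (intro exI[of _ "{}"]) (auto simp: pow_Inter_def)
  next
    case 2
    then have "I \<in> nonzero_primes R" using less.prems by (simp add: nonzero_primes_def nonzero_ideals_def)
    then show ?thesis using ideal_pow_1[OF I]
      by (intro exI[of _ "{I}"] exI[of _ 1]) (auto simp: pow_Inter_def)
  next
    case 3
    have step: "\<exists>Q k. finite Q \<and> Q \<subseteq> nonzero_primes R \<and> pow_Inter Q k \<subseteq> I <+> PIdl c"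
      if c: "c \<in> carrier R" "c \<notin> I" for c
    proof (rule less.hyps)
      have idJ: "ideal (I <+> PIdl c) R" using add_ideals[OF I cgenideal_ideal[OF c(1)]] .
      have sub: "I \<subseteq> I <+> PIdl c"
      proof
        fix x assume x: "x \<in> I"
        then have "x = x \<oplus> \<zero>" using ideal_subset[OF I] by auto
        then show "x \<in> I <+> PIdl c" using x ideal_zero[OF cgenideal_ideal[OF c(1)]]
          unfolding set_add_def' by blast
      qed
      have "c \<in> I <+> PIdl c"
      proof -
        have "c = \<zero> \<oplus> c" using c by simp
        then show ?thesis using ideal_zero[OF I] cgenideal_self[OF c(1)] unfolding set_add_def' by blast
      qed
      then have "{J. ideal J R \<and> I <+> PIdl c \<subseteq> J} \<subset> {J. ideal J R \<and> I \<subseteq> J}" using sub I c(2) by blast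
      then show "card {J. ideal J R \<and> I <+> PIdl c \<subseteq> J} < card {J. ideal J R \<and> I \<subseteq> J}"
        by (rule psubset_card_mono[OF finite_overideals[OF less.prems]])
      obtain x where "x \<in> I" "x \<noteq> \<zero>" using nonzero_ideal_ex[OF less.prems] by blast
      then show "I <+> PIdl c \<in> nonzero_ideals R" using sub by (intro nonzero_idealsI[OF idJ, of x]) auto
    qed
    obtain Q1 k1 where 1: "finite Q1" "Q1 \<subseteq> nonzero_primes R" "pow_Inter Q1 k1 \<subseteq> I <+> PIdl a"
      using step[OF 3(1,4)] by blast
    obtain Q2 k2 where 2: "finite Q2" "Q2 \<subseteq> nonzero_primes R" "pow_Inter Q2 k2 \<subseteq> I <+> PIdl b"
      using step[OF 3(2,5)] by blast
    let ?Q = "Q1 \<union> Q2" and ?k = "max k1 k2"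
    have Qid: "\<forall>P\<in>Q1. ideal P R" "\<forall>P\<in>Q2. ideal P R" using 1(2) 2(2) nonzero_primes_ideal by blast+
    have "pow_Inter ?Q (?k + ?k) \<subseteq> I"
    proof (rule pow_Inter_double_subset)
      fix u v assume uv: "u \<in> pow_Inter ?Q ?k" "v \<in> pow_Inter ?Q ?k"
      have "u \<in> I <+> PIdl a" "v \<in> I <+> PIdl b"
        using uv 1(3) 2(3) pow_Inter_mono[of Q1 ?Q k1 ?k] pow_Inter_mono[of Q2 ?Q k2 ?k] Qid by auto
      then obtain i r j s where h: "i \<in> I" "r \<in> carrier R" "u = i \<oplus> r \<otimes> a" "j \<in> I" "s \<in> carrier R" "v = j \<oplus> s \<otimes> b"
        unfolding set_add_def' cgenideal_def by blast
      have C: "i \<in> carrier R" "j \<in> carrier R" using h ideal_subset[OF I] by auto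
      have "u \<otimes> v = (j \<oplus> s \<otimes> b) \<otimes> i \<oplus> ((r \<otimes> a) \<otimes> j \<oplus> (r \<otimes> s) \<otimes> (a \<otimes> b))" using C h 3(1,2) by algebra
      moreover have "(j \<oplus> s \<otimes> b) \<otimes> i \<oplus> ((r \<otimes> a) \<otimes> j \<oplus> (r \<otimes> s) \<otimes> (a \<otimes> b)) \<in> I"
        by (rule ideal_add[OF I ideal_mult[OF I h(1)]
              ideal_add[OF I ideal_mult[OF I h(4)] ideal_mult[OF I 3(3)]]]) (use C h 3 in simp_all)
      ultimately show "u \<otimes> v \<in> I" by simp
    qed (use 1 2 I in auto)
    then show ?thesis using 1 2 by (intro exI[of _ ?Q] exI[of _ "?k + ?k"]) auto
  qed
qed

end

section \<open>Completions as profinite groups\<close>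

lemma (in group_hom) kernel_coset:
  assumes x: "x \<in> carrier G" shows "kernel G H h #> x = {y \<in> carrier G. h y = h x}"
proof (intro equalityI subsetI)
  fix y assume "y \<in> kernel G H h #> x"
  then obtain k where "k \<in> carrier G" "h k = \<one>\<^bsub>H\<^esub>" "y = k \<otimes> x" by (auto simp: r_coset_def kernel_def)
  then show "y \<in> {y \<in> carrier G. h y = h x}" using x by simp
next
  fix y assume y: "y \<in> {y \<in> carrier G. h y = h x}"
  then have "y \<otimes> inv x \<in> kernel G H h" using x by (simp add: kernel_def)
  moreover have "y = (y \<otimes> inv x) \<otimes> x" using x y by (simp add: G.m_assoc)
  ultimately show "y \<in> kernel G H h #> x" by (auto simp: r_coset_def)
qed

text \<open>The target of \<open>proj_mod\<close> as a group, so that the levels are kernels and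
  their cosets are fibres.\<close>

definition quot_vec_group :: "('a, 'b) ring_scheme \<Rightarrow> nat \<Rightarrow> 'a set \<Rightarrow> (nat \<Rightarrow> 'a set) monoid" where
  "quot_vec_group D n I = product_group {..<n} (\<lambda>_. add_monoid (D Quot I))"

definition level_kernel ::
    "('a, 'b) ring_scheme \<Rightarrow> 'a set set \<Rightarrow> nat \<Rightarrow> 'a set \<Rightarrow> (nat \<Rightarrow> 'a set \<Rightarrow> 'a set) set" where
  "level_kernel D A n I = kernel (vec_group D A n) (quot_vec_group D n I) (proj_mod n I)"

context ring
begin

lemma carrier_Quot: "carrier (R Quot I) = (\<lambda>a. I +> a) ` carrier R"
  by (auto simp: FactRing_def A_RCOSETS_def')

lemma add_Quot: "add (R Quot I) = set_add R" and zero_Quot: "\<zero>\<^bsub>R Quot I\<^esub> = I"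
  by (simp_all add: FactRing_def)

lemma mem_coset_self: assumes "ideal I R" "a \<in> carrier R" shows "a \<in> I +> a"
proof -
  interpret ideal I R by fact
  show ?thesis using assms(2) by (rule a_rcos_self)
qed

lemma coset_repr:
  assumes "ideal I R" "b \<in> I +> a" "a \<in> carrier R" shows "I +> b = I +> a"
proof -
  interpret ideal I R by fact
  show ?thesis using a_repr_independence' assms by simp
qed

lemma coset_eq_self_iff: assumes "ideal I R" "a \<in> carrier R" shows "I +> a = I \<longleftrightarrow> a \<in> I"
proof -
  interpret ideal I R by fact
  show ?thesis using a_rcos_const a_rcos_self[OF assms(2)] by auto
qed

lemma coset_sum:
  assumes "ideal I R" "a \<in> carrier R" "b \<in> carrier R" shows "(I +> a) <+>\<^bsub>R\<^esub> (I +> b) = I +> (a \<oplus> b)"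
proof -
  interpret ideal I R by fact
  show ?thesis by (rule a_rcos_sum) fact+
qed

lemma coset_subset_coset: "I \<subseteq> J \<Longrightarrow> I +> a \<subseteq> J +> a"
  by (auto simp: a_r_coset_def')

lemma set_add_mono: "A \<subseteq> A' \<Longrightarrow> B \<subseteq> B' \<Longrightarrow> A <+>\<^bsub>R\<^esub> B \<subseteq> A' <+>\<^bsub>R\<^esub> B'"
  unfolding set_add_def' by blast

lemma comm_group_Quot: assumes "ideal I R" shows "comm_group (add_monoid (R Quot I))"
proof -
  interpret Q: ring "R Quot I" using assms by (rule ideal.quotient_is_ring)
  show ?thesis by (rule Q.a_comm_group)
qed

lemma Quot_inverse:
  assumes "ideal I R" "a \<in> carrier R" shows "inv\<^bsub>add_monoid (R Quot I)\<^esub> (I +> a) = I +> (\<ominus> a)"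
proof -
  interpret Q: comm_group "add_monoid (R Quot I)" by (rule comm_group_Quot[OF assms(1)])
  interpret ideal I R by fact
  show ?thesis
  proof (rule Q.inv_equality)
    show "(I +> (\<ominus> a)) \<otimes>\<^bsub>add_monoid (R Quot I)\<^esub> (I +> a) = \<one>\<^bsub>add_monoid (R Quot I)\<^esub>"
      using coset_sum[OF assms(1), of "\<ominus> a" a] assms(2) coset_eq_self_iff[OF assms(1), of \<zero>]
      by (simp add: add_Quot zero_Quot l_neg)
  qed (use assms(2) in \<open>auto simp: carrier_Quot\<close>)
qed

end

text \<open>A common setting for both completions: the system will be either all non-zero ideals or
  the powers of one prime.\<close>

locale ideal_system = finite_quotient_domain +
  fixes \<A> :: "'a set set"
  assumes levels: "\<A> \<subseteq> nonzero_ideals R" and levels_nonempty: "\<A> \<noteq> {}"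
    and directed: "I \<in> \<A> \<Longrightarrow> J \<in> \<A> \<Longrightarrow> \<exists>K\<in>\<A>. K \<subseteq> I \<inter> J"
begin

lemma level_ideal: "I \<in> \<A> \<Longrightarrow> ideal I R"
  using levels nonzero_idealsD by blast

lemma prolimD:
  assumes "x \<in> prolim R \<A>" "I \<in> \<A>"
  shows prolim_Quot: "x I \<in> carrier (R Quot I)"
    and prolim_coset: "\<exists>a\<in>carrier R. x I = I +> a"
    and prolim_mono: "J \<in> \<A> \<Longrightarrow> I \<subseteq> J \<Longrightarrow> x I \<subseteq> x J"
  using assms by (auto simp: prolim_def PiE_iff carrier_Quot image_iff)

lemma prolimI:
  assumes "x \<in> extensional \<A>" "\<And>I. I \<in> \<A> \<Longrightarrow> x I \<in> carrier (R Quot I)"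
    "\<And>I J. I \<in> \<A> \<Longrightarrow> J \<in> \<A> \<Longrightarrow> I \<subseteq> J \<Longrightarrow> x I \<subseteq> x J"
  shows "x \<in> prolim R \<A>"
  using assms by (auto simp: prolim_def PiE_iff)

text \<open>Compatibility is inclusion of cosets, so a representative of the smaller coset lies in
  the larger one and represents it as well.\<close>

lemma prolim_level_mono:
  assumes "x \<in> prolim R \<A>" "I \<in> \<A>" "J \<in> \<A>" "I \<subseteq> J" "a \<in> carrier R" "x I = I +> a"
  shows "x J = J +> a"
proof -
  obtain b where b: "b \<in> carrier R" "x J = J +> b" using prolim_coset[OF assms(1,3)] by blast
  have "a \<in> x J"
    using prolim_mono[OF assms(1,2,3,4)] mem_coset_self[OF level_ideal[OF assms(2)] assms(5)] assms(6) by blast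
  then show ?thesis using coset_repr[OF level_ideal[OF assms(3)]] b by metis
qed

lemma prolim_eq_mono:
  assumes "x \<in> prolim R \<A>" "y \<in> prolim R \<A>" "I \<in> \<A>" "J \<in> \<A>" "I \<subseteq> J" "x I = y I"
  shows "x J = y J"
proof -
  obtain a where "a \<in> carrier R" "x I = I +> a" using prolim_coset[OF assms(1,3)] by blast
  then show ?thesis using prolim_level_mono[OF assms(1,3-5)] prolim_level_mono[OF assms(2,3-5)] assms(6) by metis
qed

lemma constant_prolim: "d \<in> carrier R \<Longrightarrow> (\<lambda>I\<in>\<A>. I +> d) \<in> prolim R \<A>"
  by (rule prolimI) (auto simp: carrier_Quot intro: subsetD[OF coset_subset_coset])

lemma subgroup_prolim: "subgroup (prolim R \<A>) (product_group \<A> (\<lambda>I. add_monoid (R Quot I)))"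
  (is "subgroup _ ?G")
proof -
  have grp: "group (add_monoid (R Quot I))" if "I \<in> \<A>" for I
    using comm_group_Quot[OF level_ideal[OF that]] by (simp add: comm_group_def)
  then interpret group ?G by (rule product_group)
  show ?thesis
  proof (rule subgroupI)
    show "prolim R \<A> \<subseteq> carrier ?G" by (auto simp: prolim_def)
    show "prolim R \<A> \<noteq> {}" using constant_prolim[OF zero_closed] by blast
  next
    fix x assume x: "x \<in> prolim R \<A>"
    have xc: "x \<in> (\<Pi>\<^sub>E I\<in>\<A>. carrier (add_monoid (R Quot I)))" using x by (auto simp: prolim_def)
    have e: "inv\<^bsub>?G\<^esub> x = (\<lambda>I\<in>\<A>. inv\<^bsub>add_monoid (R Quot I)\<^esub> x I)"
      by (rule inv_product_group[OF xc grp])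
    show "inv\<^bsub>?G\<^esub> x \<in> prolim R \<A>"
      unfolding e
    proof (rule prolimI)
      fix I assume I: "I \<in> \<A>"
      obtain a where a: "a \<in> carrier R" "x I = I +> a" using prolim_coset[OF x I] by blast
      then show "(\<lambda>I\<in>\<A>. inv\<^bsub>add_monoid (R Quot I)\<^esub> x I) I \<in> carrier (R Quot I)"
        using I Quot_inverse[OF level_ideal[OF I] a(1)] by (simp add: carrier_Quot)
      fix J assume J: "J \<in> \<A>" "I \<subseteq> J"
      have "x J = J +> a" by (rule prolim_level_mono[OF x I J a])
      then show "(\<lambda>I\<in>\<A>. inv\<^bsub>add_monoid (R Quot I)\<^esub> x I) I \<subseteq> (\<lambda>I\<in>\<A>. inv\<^bsub>add_monoid (R Quot I)\<^esub> x I) J"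
        using I J a Quot_inverse[OF level_ideal[OF I] a(1)] Quot_inverse[OF level_ideal[OF J(1)] a(1)]
          coset_subset_coset[OF J(2)] by simp
    qed simp
  next
    fix x y assume x: "x \<in> prolim R \<A>" and y: "y \<in> prolim R \<A>"
    have e: "x \<otimes>\<^bsub>?G\<^esub> y = (\<lambda>I\<in>\<A>. x I <+>\<^bsub>R\<^esub> y I)" by (simp add: add_Quot)
    show "x \<otimes>\<^bsub>?G\<^esub> y \<in> prolim R \<A>"
      unfolding e
    proof (rule prolimI)
      fix I assume I: "I \<in> \<A>"
      obtain a b where a: "a \<in> carrier R" "x I = I +> a" "b \<in> carrier R" "y I = I +> b"
        using prolim_coset[OF x I] prolim_coset[OF y I] by blast
      then show "(\<lambda>I\<in>\<A>. x I <+>\<^bsub>R\<^esub> y I) I \<in> carrier (R Quot I)"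
        using I coset_sum[OF level_ideal[OF I] a(1,3)] by (simp add: carrier_Quot)
      fix J assume J: "J \<in> \<A>" "I \<subseteq> J"
      then show "(\<lambda>I\<in>\<A>. x I <+>\<^bsub>R\<^esub> y I) I \<subseteq> (\<lambda>I\<in>\<A>. x I <+>\<^bsub>R\<^esub> y I) J"
        using I set_add_mono[OF prolim_mono[OF x I J] prolim_mono[OF y I J]] by simp
    qed simp
  qed
qed

lemma carrier_prolim_group [simp]: "carrier (prolim_group R \<A>) = prolim R \<A>"
  by (simp add: prolim_group_def)

lemma mult_prolim_group: "x \<otimes>\<^bsub>prolim_group R \<A>\<^esub> y = (\<lambda>I\<in>\<A>. x I <+>\<^bsub>R\<^esub> y I)"
  by (simp add: prolim_group_def add_Quot)

lemma set_add_comm_Quot: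
  assumes "I \<in> \<A>" "A \<in> carrier (R Quot I)" "B \<in> carrier (R Quot I)" shows "A <+>\<^bsub>R\<^esub> B = B <+>\<^bsub>R\<^esub> A"
proof -
  interpret Q: comm_group "add_monoid (R Quot I)" by (rule comm_group_Quot[OF level_ideal[OF assms(1)]])
  show ?thesis using Q.m_comm[of A B] assms by (simp add: add_Quot)
qed

lemma comm_group_prolim_group: "comm_group (prolim_group R \<A>)"
proof -
  have grp: "group (add_monoid (R Quot I))" if "I \<in> \<A>" for I
    using comm_group_Quot[OF level_ideal[OF that]] by (simp add: comm_group_def)
  then have "group (product_group \<A> (\<lambda>I. add_monoid (R Quot I)))" by (rule product_group)
  then have "group (prolim_group R \<A>)"
    unfolding prolim_group_def by (rule subgroup.subgroup_is_group[OF subgroup_prolim])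
  then show ?thesis
  proof (rule group.group_comm_groupI)
    fix x y assume "x \<in> carrier (prolim_group R \<A>)" "y \<in> carrier (prolim_group R \<A>)"
    then have "x I <+>\<^bsub>R\<^esub> y I = y I <+>\<^bsub>R\<^esub> x I" if "I \<in> \<A>" for I
      using that prolim_Quot by (intro set_add_comm_Quot[OF that]) auto
    then show "x \<otimes>\<^bsub>prolim_group R \<A>\<^esub> y = y \<otimes>\<^bsub>prolim_group R \<A>\<^esub> x"
      unfolding mult_prolim_group by (rule restrict_ext)
  qed
qed

lemma carrier_vec_group: "carrier (vec_group R \<A> n) = (\<Pi>\<^sub>E i\<in>{..<n}. prolim R \<A>)"
  by (simp add: vec_group_def)

lemma mult_vec_group: "x \<otimes>\<^bsub>vec_group R \<A> n\<^esub> y = (\<lambda>i\<in>{..<n}. \<lambda>I\<in>\<A>. x i I <+>\<^bsub>R\<^esub> y i I)"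
  by (simp add: vec_group_def mult_prolim_group)

lemma comm_group_vec_group: "comm_group (vec_group R \<A> n)"
proof -
  interpret P: comm_group "prolim_group R \<A>" by (rule comm_group_prolim_group)
  have "group (vec_group R \<A> n)" unfolding vec_group_def by (rule product_group) (rule P.is_group)
  then show ?thesis
  proof (rule group.group_comm_groupI)
    fix x y assume xy: "x \<in> carrier (vec_group R \<A> n)" "y \<in> carrier (vec_group R \<A> n)"
    have "x i \<otimes>\<^bsub>prolim_group R \<A>\<^esub> y i = y i \<otimes>\<^bsub>prolim_group R \<A>\<^esub> x i" if "i \<in> {..<n}" for i
      using xy that by (intro P.m_comm) (auto simp: carrier_vec_group)
    then show "x \<otimes>\<^bsub>vec_group R \<A> n\<^esub> y = y \<otimes>\<^bsub>vec_group R \<A> n\<^esub> x"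
      unfolding vec_group_def mult_product_group by (rule restrict_ext)
  qed
qed

lemma group_hom_proj_mod:
  assumes "I \<in> \<A>" shows "group_hom (vec_group R \<A> n) (quot_vec_group R n I) (proj_mod n I)"
proof -
  have "group (add_monoid (R Quot I))"
    using comm_group_Quot[OF level_ideal[OF assms]] by (simp add: comm_group_def)
  then have "group (quot_vec_group R n I)" unfolding quot_vec_group_def by (intro product_group)
  moreover have "proj_mod n I \<in> hom (vec_group R \<A> n) (quot_vec_group R n I)"
    using prolim_Quot assms
    by (auto simp: hom_def carrier_vec_group quot_vec_group_def proj_mod_def mult_vec_group add_Quot PiE_iff
        intro!: restrict_ext)
  ultimately show ?thesis using comm_group_vec_group
    by (simp add: group_hom_def group_hom_axioms_def comm_group_def)
qed

lemma level_kernel_iff: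
  "x \<in> level_kernel R \<A> n I \<longleftrightarrow> x \<in> carrier (vec_group R \<A> n) \<and> (\<forall>i<n. x i I = I)"
  by (auto simp: level_kernel_def kernel_def quot_vec_group_def proj_mod_def zero_Quot fun_eq_iff restrict_def)

lemma proj_mod_eq_iff: "proj_mod n I x = proj_mod n I y \<longleftrightarrow> (\<forall>i<n. x i I = y i I)"
  by (auto simp: proj_mod_def fun_eq_iff restrict_def)

lemma level_kernel_coset:
  assumes "I \<in> \<A>" "x \<in> carrier (vec_group R \<A> n)"
  shows "level_kernel R \<A> n I #>\<^bsub>vec_group R \<A> n\<^esub> x
      = {y \<in> carrier (vec_group R \<A> n). proj_mod n I y = proj_mod n I x}"
  unfolding level_kernel_def by (rule group_hom.kernel_coset[OF group_hom_proj_mod[OF assms(1)] assms(2)])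

section \<open>Topology of the inverse limits\<close>

lemma topspace_prolim: "topspace (prolim_topology R \<A>) = prolim R \<A>"
  by (auto simp: prolim_topology_def prolim_def)

lemma topspace_vec: "topspace (vec_topology R \<A> n) = carrier (vec_group R \<A> n)"
  by (simp add: vec_topology_def topspace_prolim carrier_vec_group)

lemma directed_levels: "finite B \<Longrightarrow> B \<subseteq> \<A> \<Longrightarrow> \<exists>K\<in>\<A>. \<forall>I\<in>B. K \<subseteq> I"
proof (induction B rule: finite_induct)
  case empty then show ?case using levels_nonempty by blast
next
  case (insert I B)
  then obtain K where K: "K \<in> \<A>" "\<forall>I\<in>B. K \<subseteq> I" by auto
  obtain L where "L \<in> \<A>" "L \<subseteq> K \<inter> I" using directed[of K I] K(1) insert.prems by auto
  then show ?case using K(2) by (intro bexI[of _ L]) auto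
qed

abbreviation "discrete_product \<equiv> product_topology (\<lambda>I. discrete_topology (carrier (R Quot I))) \<A>"

text \<open>A family violates compatibility at some two coordinates, and fixing the values there is
  an open condition.\<close>

lemma closedin_prolim: "closedin discrete_product (prolim R \<A>)"
proof -
  let ?V = "\<lambda>I C. {x \<in> topspace discrete_product. x I \<in> {C}}"
  have V: "openin discrete_product (?V I C)" if "I \<in> \<A>" "C \<in> carrier (R Quot I)" for I C
    by (rule openin_continuous_map_preimage[OF continuous_map_product_projection[OF that(1)]]) (use that in simp)
  have "openin discrete_product (topspace discrete_product - prolim R \<A>)"
  proof (subst openin_subopen, intro ballI)
    fix x assume x: "x \<in> topspace discrete_product - prolim R \<A>"
    then have xc: "x \<in> (\<Pi>\<^sub>E I\<in>\<A>. carrier (R Quot I))" by simp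
    then obtain I J where IJ: "I \<in> \<A>" "J \<in> \<A>" "I \<subseteq> J" "\<not> x I \<subseteq> x J" using x by (auto simp: prolim_def)
    let ?W = "?V I (x I) \<inter> ?V J (x J)"
    have "openin discrete_product ?W"
      using V IJ(1,2) PiE_mem[OF xc] by (intro openin_Int) blast+
    moreover have "x \<in> ?W" using x by simp
    moreover have "?W \<subseteq> topspace discrete_product - prolim R \<A>"
    proof
      fix y assume y: "y \<in> ?W"
      then have "\<not> y I \<subseteq> y J" using IJ(4) by simp
      then have "y \<notin> prolim R \<A>" using IJ(1-3) prolim_mono by blast
      then show "y \<in> topspace discrete_product - prolim R \<A>" using y by blast
    qed
    ultimately show "\<exists>W. openin discrete_product W \<and> x \<in> W \<and> W \<subseteq> topspace discrete_product - prolim R \<A>"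
      by blast
  qed
  moreover have "prolim R \<A> \<subseteq> topspace discrete_product" by (auto simp: prolim_def)
  ultimately show ?thesis by (simp add: closedin_def)
qed

lemma compact_prolim: "compact_space (prolim_topology R \<A>)"
proof -
  have "compact_space (discrete_topology (carrier (R Quot I)))" if "I \<in> \<A>" for I
    using finite_quotient levels that by (simp add: compact_space_discrete_topology subset_iff)
  then have "compact_space discrete_product" by (simp add: compact_space_product_topology)
  then have "compactin discrete_product (prolim R \<A>)" by (rule closedin_compact_space) (rule closedin_prolim)
  then show ?thesis unfolding prolim_topology_def by (rule compact_space_subtopology)
qed

lemma hausdorff_prolim: "Hausdorff_space (prolim_topology R \<A>)"
  unfolding prolim_topology_def
  by (rule Hausdorff_space_subtopology) (simp add: Hausdorff_space_product_topology)

text \<open>A basic open set constrains finitely many coordinates; one level below all of them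
  controls them at once.\<close>

lemma openin_prolimE:
  assumes "openin (prolim_topology R \<A>) S" "x \<in> S"
  shows "\<exists>K\<in>\<A>. \<forall>y\<in>prolim R \<A>. y K = x K \<longrightarrow> y \<in> S"
proof -
  obtain W where W: "openin discrete_product W" "S = W \<inter> prolim R \<A>"
    using assms(1) unfolding prolim_topology_def openin_subtopology by blast
  then have "x \<in> W" using assms(2) by blast
  then obtain U where U: "finite {I \<in> \<A>. U I \<noteq> carrier (R Quot I)}" "x \<in> Pi\<^sub>E \<A> U" "Pi\<^sub>E \<A> U \<subseteq> W"
    using W(1) unfolding openin_product_topology_alt by auto
  obtain K where K: "K \<in> \<A>" "\<forall>I\<in>{I \<in> \<A>. U I \<noteq> carrier (R Quot I)}. K \<subseteq> I"
    using directed_levels[OF U(1)] by blast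
  have xp: "x \<in> prolim R \<A>" using assms(2) W(2) by blast
  have "y \<in> S" if y: "y \<in> prolim R \<A>" "y K = x K" for y
  proof -
    have "y I \<in> U I" if I: "I \<in> \<A>" for I
    proof (cases "U I = carrier (R Quot I)")
      case True then show ?thesis using prolim_Quot[OF y(1) I] by simp
    next
      case False
      then have "K \<subseteq> I" using K(2) I by blast
      then have "y I = x I" by (rule prolim_eq_mono[OF y(1) xp K(1) I _ y(2)])
      then show ?thesis using U(2) I by auto
    qed
    then have "y \<in> Pi\<^sub>E \<A> U" using y(1) by (auto simp: prolim_def PiE_iff)
    then show ?thesis using U(3) W(2) y(1) by blast
  qed
  then show ?thesis using K(1) by blast
qed

lemma openin_prolim_level:
  assumes "I \<in> \<A>" "x \<in> prolim R \<A>" shows "openin (prolim_topology R \<A>) {y \<in> prolim R \<A>. y I = x I}"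
proof -
  have "openin discrete_product {y \<in> topspace discrete_product. y I \<in> {x I}}"
    by (rule openin_continuous_map_preimage[OF continuous_map_product_projection[OF assms(1)]])
      (use prolim_Quot[OF assms(2,1)] in simp)
  moreover have "{y \<in> prolim R \<A>. y I = x I} = {y \<in> topspace discrete_product. y I \<in> {x I}} \<inter> prolim R \<A>"
    by (auto simp: prolim_def)
  ultimately show ?thesis unfolding prolim_topology_def openin_subtopology by blast
qed

text \<open>Each of the \<open>n\<close> entries comes with its own level, and directedness merges
  these finitely many into one. Hence the power needs no levels beyond those of the limit.\<close>

lemma openin_vec_iff:
  "openin (vec_topology R \<A> n) U \<longleftrightarrow> U \<subseteq> carrier (vec_group R \<A> n) \<and>
     (\<forall>x\<in>U. \<exists>I\<in>\<A>. {y \<in> carrier (vec_group R \<A> n). proj_mod n I y = proj_mod n I x} \<subseteq> U)"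
proof (intro iffI conjI ballI)
  assume U: "openin (vec_topology R \<A> n) U"
  then show Uc: "U \<subseteq> carrier (vec_group R \<A> n)" using openin_subset topspace_vec by blast
  fix x assume x: "x \<in> U"
  have xc: "x \<in> (\<Pi>\<^sub>E i\<in>{..<n}. prolim R \<A>)" using x Uc carrier_vec_group by blast
  obtain W where W: "\<And>i. i < n \<Longrightarrow> openin (prolim_topology R \<A>) (W i)" "x \<in> Pi\<^sub>E {..<n} W" "Pi\<^sub>E {..<n} W \<subseteq> U"
    using bspec[OF U[unfolded vec_topology_def openin_product_topology_alt] x] by auto
  have "\<exists>K\<in>\<A>. \<forall>y\<in>prolim R \<A>. y K = x i K \<longrightarrow> y \<in> W i" if "i < n" for i
    using openin_prolimE[OF W(1)[OF that], of "x i"] W(2) that by auto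
  then obtain f where f: "\<And>i. i < n \<Longrightarrow> f i \<in> \<A>"
    "\<And>i y. i < n \<Longrightarrow> y \<in> prolim R \<A> \<Longrightarrow> y (f i) = x i (f i) \<Longrightarrow> y \<in> W i" by metis
  obtain K where K: "K \<in> \<A>" "\<forall>I\<in>f ` {..<n}. K \<subseteq> I" using directed_levels[of "f ` {..<n}"] f(1) by blast
  have "y \<in> U" if y: "y \<in> carrier (vec_group R \<A> n)" "proj_mod n K y = proj_mod n K x" for y
  proof -
    have yc: "y \<in> (\<Pi>\<^sub>E i\<in>{..<n}. prolim R \<A>)" using y(1) carrier_vec_group by blast
    have "y i \<in> W i" if i: "i < n" for i
    proof (rule f(2)[OF i])
      show "y i \<in> prolim R \<A>" using yc i by auto
      show "y i (f i) = x i (f i)"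
      proof (rule prolim_eq_mono[OF _ _ K(1) f(1)[OF i]])
        show "y i \<in> prolim R \<A>" "x i \<in> prolim R \<A>" using yc xc i by auto
        show "K \<subseteq> f i" using K(2) i by blast
        show "y i K = x i K" using y(2) i by (simp add: proj_mod_eq_iff)
      qed
    qed
    then have "y \<in> Pi\<^sub>E {..<n} W" using yc by (auto simp: PiE_iff)
    then show ?thesis using W(3) by blast
  qed
  then show "\<exists>I\<in>\<A>. {y \<in> carrier (vec_group R \<A> n). proj_mod n I y = proj_mod n I x} \<subseteq> U" using K(1) by blast
next
  assume U: "U \<subseteq> carrier (vec_group R \<A> n) \<and>
     (\<forall>x\<in>U. \<exists>I\<in>\<A>. {y \<in> carrier (vec_group R \<A> n). proj_mod n I y = proj_mod n I x} \<subseteq> U)"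
  show "openin (vec_topology R \<A> n) U"
  proof (subst openin_subopen, intro ballI)
    fix x assume x: "x \<in> U"
    then obtain I where I: "I \<in> \<A>" "{y \<in> carrier (vec_group R \<A> n). proj_mod n I y = proj_mod n I x} \<subseteq> U"
      using U by blast
    have xc: "x \<in> carrier (vec_group R \<A> n)" using x U by blast
    let ?V = "{y \<in> carrier (vec_group R \<A> n). proj_mod n I y = proj_mod n I x}"
    have "?V = (\<Pi>\<^sub>E i\<in>{..<n}. {z \<in> prolim R \<A>. z I = x i I})"
      unfolding carrier_vec_group proj_mod_eq_iff PiE_def Pi_def by auto
    moreover have "openin (vec_topology R \<A> n) (\<Pi>\<^sub>E i\<in>{..<n}. {z \<in> prolim R \<A>. z I = x i I})"
      unfolding vec_topology_def openin_PiE[OF finite_lessThan]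
      using xc I(1) by (intro disjI2 ballI openin_prolim_level) (auto simp: carrier_vec_group)
    ultimately have "openin (vec_topology R \<A> n) ?V" by simp
    then show "\<exists>V. openin (vec_topology R \<A> n) V \<and> x \<in> V \<and> V \<subseteq> U" using I(2) xc by blast
  qed
qed

lemma level_kernel_mono:
  assumes K: "K \<in> \<A>" and L: "L \<in> \<A>" "K \<subseteq> L" shows "level_kernel R \<A> n K \<subseteq> level_kernel R \<A> n L"
proof
  fix x assume x: "x \<in> level_kernel R \<A> n K"
  have "x i L = L" if "i < n" for i
  proof -
    have xi: "x i \<in> prolim R \<A>" "x i K = K" using x that by (auto simp: level_kernel_iff carrier_vec_group)
    have "K +> \<zero> = K" "L +> \<zero> = L"
      using coset_eq_self_iff[OF level_ideal, of _ \<zero>] K L ideal_zero[OF level_ideal] by auto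
    then show ?thesis using prolim_level_mono[OF xi(1) K L zero_closed] xi(2) by simp
  qed
  then show "x \<in> level_kernel R \<A> n L" using x by (simp add: level_kernel_iff)
qed

lemma profinite_vec_group:
  "profinite_group (vec_group R \<A> n) (vec_topology R \<A> n) \<A> (level_kernel R \<A> n)"
proof -
  interpret G: comm_group "vec_group R \<A> n" by (rule comm_group_vec_group)
  show ?thesis
  proof (intro profinite_group.intro profinite_group_axioms.intro G.comm_group_axioms)
    show "topspace (vec_topology R \<A> n) = carrier (vec_group R \<A> n)" by (rule topspace_vec)
    show "compact_space (vec_topology R \<A> n)"
      unfolding vec_topology_def compact_space_product_topology using compact_prolim by blast
    show "Hausdorff_space (vec_topology R \<A> n)"
      unfolding vec_topology_def Hausdorff_space_product_topology using hausdorff_prolim by blast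
    show "countable \<A>" using countable_subset[OF levels countable_nonzero_ideals] .
    show "\<A> \<noteq> {}" by (rule levels_nonempty)
  next
    fix I J assume IJ: "I \<in> \<A>" "J \<in> \<A>"
    then obtain K where K: "K \<in> \<A>" "K \<subseteq> I \<inter> J" using directed by blast
    have "level_kernel R \<A> n K \<subseteq> level_kernel R \<A> n I \<inter> level_kernel R \<A> n J"
      using K level_kernel_mono[OF K(1) IJ(1)] level_kernel_mono[OF K(1) IJ(2)] by simp
    then show "\<exists>K\<in>\<A>. level_kernel R \<A> n K \<subseteq> level_kernel R \<A> n I \<inter> level_kernel R \<A> n J"
      using K(1) by (rule bexI)
  next
    fix I assume I: "I \<in> \<A>"
    show "subgroup (level_kernel R \<A> n I) (vec_group R \<A> n)"
      unfolding level_kernel_def by (rule group_hom.subgroup_kernel[OF group_hom_proj_mod[OF I]])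
  next
    fix U
    show "openin (vec_topology R \<A> n) U \<longleftrightarrow> U \<subseteq> carrier (vec_group R \<A> n) \<and>
        (\<forall>x\<in>U. \<exists>I\<in>\<A>. level_kernel R \<A> n I #>\<^bsub>vec_group R \<A> n\<^esub> x \<subseteq> U)"
      unfolding openin_vec_iff
    proof (rule conj_cong[OF refl], rule ball_cong[OF refl], rule bex_cong[OF refl])
      fix x I assume "U \<subseteq> carrier (vec_group R \<A> n)" "x \<in> U" "I \<in> \<A>"
      then show "({y \<in> carrier (vec_group R \<A> n). proj_mod n I y = proj_mod n I x} \<subseteq> U)
          = (level_kernel R \<A> n I #>\<^bsub>vec_group R \<A> n\<^esub> x \<subseteq> U)"
        using level_kernel_coset[of I x n] by (simp add: subset_iff)
    qed
  qed
qed

lemma proj_mod_image: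
  assumes I: "I \<in> \<A>" shows "proj_mod n I ` carrier (vec_group R \<A> n) = (\<Pi>\<^sub>E i\<in>{..<n}. carrier (R Quot I))"
proof (intro equalityI subsetI)
  fix s assume "s \<in> proj_mod n I ` carrier (vec_group R \<A> n)"
  then show "s \<in> (\<Pi>\<^sub>E i\<in>{..<n}. carrier (R Quot I))"
    using prolim_Quot[OF _ I] by (auto simp: proj_mod_def carrier_vec_group PiE_iff)
next
  fix s assume s: "s \<in> (\<Pi>\<^sub>E i\<in>{..<n}. carrier (R Quot I))"
  then have "\<forall>i<n. \<exists>d\<in>carrier R. s i = I +> d" by (auto simp: carrier_Quot PiE_iff image_iff)
  then obtain d where d: "\<And>i. i < n \<Longrightarrow> d i \<in> carrier R" "\<And>i. i < n \<Longrightarrow> s i = I +> d i" by metis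
  define x where "x = (\<lambda>i\<in>{..<n}. \<lambda>J\<in>\<A>. J +> d i)"
  have "x \<in> carrier (vec_group R \<A> n)" using constant_prolim d(1) by (simp add: x_def carrier_vec_group)
  moreover have "proj_mod n I x = s"
    using s d(2) I by (auto simp: proj_mod_def x_def PiE_iff extensional_def fun_eq_iff)
  ultimately show "s \<in> proj_mod n I ` carrier (vec_group R \<A> n)" by blast
qed

end

section \<open>The completion as a product of local completions\<close>

context finite_quotient_domain
begin

lemma ideal_system_nonzero_ideals: "ideal_system R (nonzero_ideals R)"
proof
  show "nonzero_ideals R \<noteq> {}" using carrier_nonzero_ideal by blast
  fix I J assume "I \<in> nonzero_ideals R" "J \<in> nonzero_ideals R"
  then show "\<exists>K\<in>nonzero_ideals R. K \<subseteq> I \<inter> J"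
    using ideal_prod_nonzero ideal_prod_inter nonzero_idealsD by (intro bexI[of _ "I \<cdot> J"]) auto
qed simp

lemma ideal_powersE:
  assumes "I \<in> ideal_powers R P" obtains k where "I = ideal_pow P k"
  using assms by (auto simp: ideal_powers_def)

lemma ideal_powersI: "ideal_pow P k \<in> ideal_powers R P"
  by (simp add: ideal_powers_def)

lemma ideal_powers_nonzero: "P \<in> nonzero_primes R \<Longrightarrow> ideal_powers R P \<subseteq> nonzero_ideals R"
  using ideal_pow_nonzero nonzero_primesD by (auto simp: ideal_powers_def)

lemma ideal_system_ideal_powers: assumes P: "P \<in> nonzero_primes R" shows "ideal_system R (ideal_powers R P)"
proof
  show "ideal_powers R P \<subseteq> nonzero_ideals R" by (rule ideal_powers_nonzero[OF P])
  show "ideal_powers R P \<noteq> {}" using ideal_powersI by blast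
  fix I J assume "I \<in> ideal_powers R P" "J \<in> ideal_powers R P"
  then obtain j k where jk: "I = ideal_pow P j" "J = ideal_pow P k" by (auto elim!: ideal_powersE)
  have "ideal_pow P (max j k) \<subseteq> I \<inter> J"
    using jk ideal_pow_antimono[OF nonzero_primes_ideal[OF P]] by simp
  then show "\<exists>K\<in>ideal_powers R P. K \<subseteq> I \<inter> J" using ideal_powersI by blast
qed

lemma coset_diff:
  assumes "ideal J R" "a \<in> carrier R" "d \<in> J +> a" "d' \<in> J +> a"
  shows "d \<ominus> d' \<in> J"
proof -
  have c: "d \<in> carrier R" "d' \<in> carrier R"
    using assms a_r_coset_subset_G[OF ideal_subset[OF assms(1)] assms(2)] by auto
  have "J +> d = J +> d'" using coset_repr[OF assms(1) _ assms(2)] assms(3,4) by simp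
  then show ?thesis using quotient_eq_iff_same_a_r_cos[OF assms(1) c] by simp
qed

text \<open>The value at \<open>I \<supseteq> P\<^sup>k \<inter> (\<Inter>Q\<in>\<Q>. Q\<^sup>k)\<close> is the class of any element that is congruent to \<open>g\<close> modulo
  \<open>P\<^sup>k\<close> and lies in the \<open>Q\<^sup>k\<close>.\<close>

lemma local_extension:
  assumes P: "P \<in> nonzero_primes R" and g: "g \<in> prolim R (ideal_powers R P)"
  shows "\<exists>l\<in>prolim R (nonzero_ideals R). (\<forall>k. l (ideal_pow P k) = g (ideal_pow P k)) \<and>
      (\<forall>Q\<in>nonzero_primes R - {P}. \<forall>k. l (ideal_pow Q k) = ideal_pow Q k)"
proof -
  interpret L: ideal_system R "ideal_powers R P" by (rule ideal_system_ideal_powers[OF P])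
  interpret N: ideal_system R "nonzero_ideals R" by (rule ideal_system_nonzero_ideals)
  note idP = nonzero_primes_ideal[OF P]
  \<comment> \<open>\<open>P\<close> is removed from \<open>\<Q>\<close> because the condition there
    is congruence to \<open>g\<close>, whereas the other primes demand congruence to 0.\<close>
  define good where "good d \<Q> k \<longleftrightarrow> d \<in> g (ideal_pow P k) \<and> d \<in> pow_Inter (\<Q> - {P}) k" for d \<Q> k
  have gk: "\<exists>a\<in>carrier R. g (ideal_pow P k) = ideal_pow P k +> a" for k
    by (rule L.prolim_coset[OF g ideal_powersI])
  have good_carrier: "d \<in> carrier R" if "good d \<Q> k" for d \<Q> k using that by (simp add: good_def pow_Inter_def)
  have good_ex: "\<exists>d. good d \<Q> k" if Q: "finite \<Q>" "\<Q> \<subseteq> nonzero_primes R" for \<Q> k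
  proof -
    obtain a where a: "a \<in> carrier R" "g (ideal_pow P k) = ideal_pow P k +> a" using gk by blast
    have Q': "finite (\<Q> - {P})" "\<Q> - {P} \<subseteq> nonzero_primes R" "P \<notin> \<Q> - {P}" using Q by auto
    obtain d where d: "d \<in> pow_Inter (\<Q> - {P}) k" "a \<ominus> d \<in> ideal_pow P k"
      using chinese_remainder[OF P Q' a(1), of k] by blast
    have dc: "d \<in> carrier R" using d(1) by (simp add: pow_Inter_def)
    have "ideal_pow P k +> a = ideal_pow P k +> d"
      using quotient_eq_iff_same_a_r_cos[OF ideal_ideal_pow[OF idP] a(1) dc] d(2) by blast
    then have "d \<in> g (ideal_pow P k)" using mem_coset_self[OF ideal_ideal_pow[OF idP] dc] a(2) by simp
    then show ?thesis using d(1) by (auto simp: good_def)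
  qed
  have good_mono: "good d \<Q> k" if h: "good d \<Q>' k'" "\<Q> \<subseteq> \<Q>'" "k \<le> k'" "\<Q>' \<subseteq> nonzero_primes R" for d \<Q> \<Q>' k k'
  proof -
    have "g (ideal_pow P k') \<subseteq> g (ideal_pow P k)"
      by (rule L.prolim_mono[OF g ideal_powersI ideal_powersI ideal_pow_antimono[OF idP h(3)]])
    moreover have "pow_Inter (\<Q>' - {P}) k' \<subseteq> pow_Inter (\<Q> - {P}) k"
      using h nonzero_primes_ideal by (intro pow_Inter_mono) auto
    ultimately show ?thesis using h(1) unfolding good_def by blast
  qed
  \<comment> \<open>Two good elements differ by a member of every \<open>k\<close>-th power
    involved, so they have the same class modulo \<open>I\<close>.\<close>
  have key: "I +> d = I +> d'"
    if h: "good d \<Q> k" "good d' \<Q> k" "\<Q> \<subseteq> nonzero_primes R" "pow_Inter (insert P \<Q>) k \<subseteq> I" "ideal I R" for I d d' \<Q> k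
  proof -
    obtain a where a: "a \<in> carrier R" "g (ideal_pow P k) = ideal_pow P k +> a" using gk by blast
    have c: "d \<in> carrier R" "d' \<in> carrier R" using good_carrier h(1,2) by auto
    have "d \<ominus> d' \<in> ideal_pow T k" if T: "T \<in> insert P \<Q>" for T
    proof (cases "T = P")
      case True
      have "d \<in> ideal_pow P k +> a" "d' \<in> ideal_pow P k +> a" using h(1,2) a(2) by (auto simp: good_def)
      then show ?thesis using coset_diff[OF ideal_ideal_pow[OF idP] a(1)] True by blast
    next
      case False
      then have m: "d \<in> ideal_pow T k" "d' \<in> ideal_pow T k" "T \<in> nonzero_primes R"
        using h(1,2,3) T by (auto simp: good_def pow_Inter_def)
      have idT: "ideal (ideal_pow T k) R" by (rule ideal_ideal_pow[OF nonzero_primes_ideal[OF m(3)]])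
      show ?thesis unfolding a_minus_def by (rule ideal_add[OF idT m(1) ideal_minus[OF idT m(2)]])
    qed
    then have "d \<ominus> d' \<in> I" using h(4) c by (auto simp: pow_Inter_def)
    then show ?thesis using quotient_eq_iff_same_a_r_cos[OF h(5) c] by blast
  qed
  have "\<exists>t. finite (fst t) \<and> fst t \<subseteq> nonzero_primes R \<and>
      pow_Inter (insert P (fst t)) (fst (snd t)) \<subseteq> I \<and> good (snd (snd t)) (fst t) (fst (snd t))"
    if I: "I \<in> nonzero_ideals R" for I
  proof -
    obtain \<Q> k where Q: "finite \<Q>" "\<Q> \<subseteq> nonzero_primes R" "pow_Inter \<Q> k \<subseteq> I"
      using nonzero_ideal_contains_pow_Inter[OF I] by blast
    obtain d where d: "good d \<Q> k" using good_ex[OF Q(1,2)] by blast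
    have "pow_Inter (insert P \<Q>) k \<subseteq> I" using Q(3) by (auto simp: pow_Inter_def)
    then show ?thesis using Q(1,2) d by (intro exI[of _ "(\<Q>, k, d)"]) simp
  qed
  then obtain t where t: "\<And>I. I \<in> nonzero_ideals R \<Longrightarrow> finite (fst (t I)) \<and> fst (t I) \<subseteq> nonzero_primes R \<and>
      pow_Inter (insert P (fst (t I))) (fst (snd (t I))) \<subseteq> I \<and> good (snd (snd (t I))) (fst (t I)) (fst (snd (t I)))"
    by metis
  define \<Q>f where "\<Q>f I = fst (t I)" for I
  define kf where "kf I = fst (snd (t I))" for I
  define df where "df I = snd (snd (t I))" for I
  have f: "finite (\<Q>f I)" "\<Q>f I \<subseteq> nonzero_primes R" "pow_Inter (insert P (\<Q>f I)) (kf I) \<subseteq> I" "good (df I) (\<Q>f I) (kf I)"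
    if "I \<in> nonzero_ideals R" for I
    using t[OF that] by (simp_all add: \<Q>f_def kf_def df_def)
  define l where "l = (\<lambda>I\<in>nonzero_ideals R. I +> df I)"
  \<comment> \<open>Independence of the choices in \<open>t\<close>: an element good for the union
    of both prime sets and the larger exponent is comparable with either side.\<close>
  have l_eq: "l I = I +> d"
    if I: "I \<in> nonzero_ideals R" and Q: "finite \<Q>" "\<Q> \<subseteq> nonzero_primes R" "pow_Inter (insert P \<Q>) k \<subseteq> I"
      and d: "good d \<Q> k" for I \<Q> k d
  proof -
    let ?Q = "\<Q> \<union> \<Q>f I" and ?k = "max k (kf I)"
    have Qp: "?Q \<subseteq> nonzero_primes R" using Q(2) f(2)[OF I] by blast
    have "finite ?Q" using Q(1) f(1)[OF I] by blast
    then obtain e where e: "good e ?Q ?k" using good_ex[OF _ Qp] by blast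
    have "good e \<Q> k" by (rule good_mono[OF e _ _ Qp]) auto
    then have 1: "I +> e = I +> d" by (rule key[OF _ d Q(2,3) nonzero_idealsD[OF I]])
    have "good e (\<Q>f I) (kf I)" by (rule good_mono[OF e _ _ Qp]) auto
    then have "I +> e = I +> df I" by (rule key[OF _ f(4)[OF I] f(2)[OF I] f(3)[OF I] nonzero_idealsD[OF I]])
    then show ?thesis using 1 I by (simp add: l_def)
  qed
  have l: "l \<in> prolim R (nonzero_ideals R)"
  proof (rule N.prolimI)
    fix I assume I: "I \<in> nonzero_ideals R"
    show "l I \<in> carrier (R Quot I)" using I good_carrier[OF f(4)[OF I]] by (simp add: l_def carrier_Quot)
    fix J assume J: "J \<in> nonzero_ideals R" "I \<subseteq> J"
    \<comment> \<open>The data chosen for \<open>I\<close> are admissible for the larger ideal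
      \<open>J\<close> too, so one representative serves both.\<close>
    have "l J = J +> df I"
      using f(3)[OF I] J(2) by (intro l_eq[OF J(1) f(1)[OF I] f(2)[OF I] _ f(4)[OF I]]) blast
    then show "l I \<subseteq> l J" using I coset_subset_coset[OF J(2)] by (simp add: l_def)
  qed (simp add: l_def)
  moreover have "l (ideal_pow P k) = g (ideal_pow P k)" for k
  proof -
    obtain d where d: "good d {} k" using good_ex[of "{}"] by blast
    obtain a where a: "a \<in> carrier R" "g (ideal_pow P k) = ideal_pow P k +> a" using gk by blast
    have "l (ideal_pow P k) = ideal_pow P k +> d"
      by (rule l_eq[OF ideal_pow_nonzero[OF nonzero_primesD[OF P]] _ _ _ d]) (auto simp: pow_Inter_def)
    also have "\<dots> = ideal_pow P k +> a"
      using d a by (intro coset_repr[OF ideal_ideal_pow[OF idP]]) (auto simp: good_def)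
    finally show ?thesis using a(2) by simp
  qed
  moreover have "l (ideal_pow Q k) = ideal_pow Q k" if Q: "Q \<in> nonzero_primes R - {P}" for Q k
  proof -
    have Q': "{Q} \<subseteq> nonzero_primes R" "Q \<in> nonzero_primes R" using Q by auto
    obtain d where d: "good d {Q} k" using good_ex[of "{Q}"] Q' by blast
    have "d \<in> ideal_pow Q k" using d Q by (auto simp: good_def pow_Inter_def)
    moreover have "l (ideal_pow Q k) = ideal_pow Q k +> d"
      by (rule l_eq[OF ideal_pow_nonzero[OF nonzero_primesD[OF Q'(2)]] _ Q'(1) _ d]) (auto simp: pow_Inter_def)
    ultimately show ?thesis
      using coset_eq_self_iff[OF ideal_ideal_pow[OF nonzero_primes_ideal[OF Q'(2)]] good_carrier[OF d]] by simp
  qed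
  ultimately show ?thesis by blast
qed

lemma proj_prime_mem:
  assumes P: "P \<in> nonzero_primes R" and x: "x \<in> carrier (vec_group R (nonzero_ideals R) n)"
  shows "proj_prime R n P x \<in> carrier (vec_group R (ideal_powers R P) n)"
proof -
  interpret L: ideal_system R "ideal_powers R P" by (rule ideal_system_ideal_powers[OF P])
  interpret N: ideal_system R "nonzero_ideals R" by (rule ideal_system_nonzero_ideals)
  have "restrict (x i) (ideal_powers R P) \<in> prolim R (ideal_powers R P)" if "i < n" for i
  proof -
    have xi: "x i \<in> prolim R (nonzero_ideals R)" using x that by (auto simp: N.carrier_vec_group)
    show ?thesis
    proof (rule L.prolimI)
      fix I assume I: "I \<in> ideal_powers R P"
      then have IN: "I \<in> nonzero_ideals R" using ideal_powers_nonzero[OF P] by blast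
      show "restrict (x i) (ideal_powers R P) I \<in> carrier (R Quot I)" using I N.prolim_Quot[OF xi IN] by simp
      fix J assume J: "J \<in> ideal_powers R P" "I \<subseteq> J"
      then have "J \<in> nonzero_ideals R" using ideal_powers_nonzero[OF P] by blast
      then show "restrict (x i) (ideal_powers R P) I \<subseteq> restrict (x i) (ideal_powers R P) J"
        using I J N.prolim_mono[OF xi IN] by simp
    qed simp
  qed
  then show ?thesis by (simp add: L.carrier_vec_group proj_prime_def)
qed

lemma proj_prime_hom:
  assumes P: "P \<in> nonzero_primes R"
  shows "proj_prime R n P \<in> hom (vec_group R (nonzero_ideals R) n) (vec_group R (ideal_powers R P) n)"
proof (rule homI)
  interpret L: ideal_system R "ideal_powers R P" by (rule ideal_system_ideal_powers[OF P])
  interpret N: ideal_system R "nonzero_ideals R" by (rule ideal_system_nonzero_ideals)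
  fix x y
  have "I \<in> nonzero_ideals R" if "I \<in> ideal_powers R P" for I using that ideal_powers_nonzero[OF P] by blast
  then show "proj_prime R n P (x \<otimes>\<^bsub>vec_group R (nonzero_ideals R) n\<^esub> y) =
      proj_prime R n P x \<otimes>\<^bsub>vec_group R (ideal_powers R P) n\<^esub> proj_prime R n P y"
    unfolding N.mult_vec_group L.mult_vec_group proj_prime_def by (intro restrict_ext) auto
qed (rule proj_prime_mem[OF P])

text \<open>\<open>cont\<close> holds with the prime power itself as global level,
  \<open>cofinal\<close> is the containment of an intersection of prime powers in \<open>I\<close>,
  and \<open>split\<close> applies \<open>local_extension\<close> to each entry.\<close>

lemma local_global_completion:
  "local_global (vec_group R (nonzero_ideals R) n) (vec_topology R (nonzero_ideals R) n)
     (nonzero_ideals R) (level_kernel R (nonzero_ideals R) n) (nonzero_primes R)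
     (\<lambda>P. vec_group R (ideal_powers R P) n) (\<lambda>P. vec_topology R (ideal_powers R P) n)
     (ideal_powers R) (\<lambda>P. level_kernel R (ideal_powers R P) n) (proj_prime R n)"
proof -
  interpret N: ideal_system R "nonzero_ideals R" by (rule ideal_system_nonzero_ideals)
  have loc: "ideal_system R (ideal_powers R P)" if "P \<in> nonzero_primes R" for P
    by (rule ideal_system_ideal_powers[OF that])
  show ?thesis
  proof (rule local_global.intro[OF N.profinite_vec_group], rule local_global_axioms.intro)
    fix P assume P: "P \<in> nonzero_primes R"
    show "profinite_group (vec_group R (ideal_powers R P) n) (vec_topology R (ideal_powers R P) n)
        (ideal_powers R P) (level_kernel R (ideal_powers R P) n)"
      by (rule ideal_system.profinite_vec_group[OF loc[OF P]])
    show "proj_prime R n P \<in> hom (vec_group R (nonzero_ideals R) n) (vec_group R (ideal_powers R P) n)"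
      by (rule proj_prime_hom[OF P])
  next
    fix P I assume P: "P \<in> nonzero_primes R" and I: "I \<in> ideal_powers R P"
    interpret L: ideal_system R "ideal_powers R P" by (rule loc[OF P])
    have IN: "I \<in> nonzero_ideals R" using I ideal_powers_nonzero[OF P] by blast
    have "proj_prime R n P x \<in> level_kernel R (ideal_powers R P) n I"
      if "x \<in> level_kernel R (nonzero_ideals R) n I" for x
      using that proj_prime_mem[OF P, of x n] I
      by (simp add: L.level_kernel_iff N.level_kernel_iff) (simp add: proj_prime_def)
    then show "\<exists>J\<in>nonzero_ideals R. proj_prime R n P ` level_kernel R (nonzero_ideals R) n J
        \<subseteq> level_kernel R (ideal_powers R P) n I" using IN by blast
  next
    fix I assume I: "I \<in> nonzero_ideals R"
    obtain \<Q> k where Q: "finite \<Q>" "\<Q> \<subseteq> nonzero_primes R" "pow_Inter \<Q> k \<subseteq> I"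
      using nonzero_ideal_contains_pow_Inter[OF I] by blast
    have QN: "ideal_pow P k \<in> nonzero_ideals R" if "P \<in> \<Q>" for P
      using that Q(2) ideal_pow_nonzero nonzero_primesD by blast
    \<comment> \<open>A single \<open>J\<close> below \<open>I\<close> and all the prime powers
      gives one representative that is valid at all these levels.\<close>
    have "\<exists>J\<in>nonzero_ideals R. \<forall>I\<in>insert I ((\<lambda>P. ideal_pow P k) ` \<Q>). J \<subseteq> I"
      using Q(1) QN I by (intro N.directed_levels) auto
    then obtain J where J: "J \<in> nonzero_ideals R" "J \<subseteq> I" "\<And>P. P \<in> \<Q> \<Longrightarrow> J \<subseteq> ideal_pow P k" by blast
    have "x \<in> level_kernel R (nonzero_ideals R) n I"
      if x: "x \<in> carrier (vec_group R (nonzero_ideals R) n)"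
        and xQ: "\<And>P. P \<in> \<Q> \<Longrightarrow> proj_prime R n P x \<in> level_kernel R (ideal_powers R P) n (ideal_pow P k)" for x
    proof -
      have "x i I = I" if i: "i < n" for i
      proof -
        have xi: "x i \<in> prolim R (nonzero_ideals R)" using x i by (auto simp: N.carrier_vec_group)
        obtain a where a: "a \<in> carrier R" "x i J = J +> a" using N.prolim_coset[OF xi J(1)] by blast
        have "a \<in> ideal_pow P k" if P: "P \<in> \<Q>" for P
        proof -
          have PN: "P \<in> nonzero_primes R" using P Q(2) by blast
          interpret L: ideal_system R "ideal_powers R P" by (rule loc[OF PN])
          have "proj_prime R n P x i (ideal_pow P k) = ideal_pow P k"
            using xQ[OF P] i by (simp add: L.level_kernel_iff)
          then have "x i (ideal_pow P k) = ideal_pow P k" using i ideal_powersI by (simp add: proj_prime_def)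
          moreover have "x i (ideal_pow P k) = ideal_pow P k +> a"
            by (rule N.prolim_level_mono[OF xi J(1) QN[OF P] J(3)[OF P] a])
          ultimately show ?thesis using coset_eq_self_iff[OF nonzero_idealsD[OF QN[OF P]] a(1)] by simp
        qed
        then have "a \<in> I" using Q(3) a(1) by (auto simp: pow_Inter_def)
        moreover have "x i I = I +> a" by (rule N.prolim_level_mono[OF xi J(1) I J(2) a])
        ultimately show ?thesis using coset_eq_self_iff[OF nonzero_idealsD[OF I] a(1)] by simp
      qed
      then show ?thesis using x by (simp add: N.level_kernel_iff)
    qed
    then show "\<exists>\<Q> f. finite \<Q> \<and> \<Q> \<subseteq> nonzero_primes R \<and> (\<forall>P\<in>\<Q>. f P \<in> ideal_powers R P) \<and>
        {x \<in> carrier (vec_group R (nonzero_ideals R) n).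
           \<forall>P\<in>\<Q>. proj_prime R n P x \<in> level_kernel R (ideal_powers R P) n (f P)}
        \<subseteq> level_kernel R (nonzero_ideals R) n I"
      using Q(1,2) ideal_powersI by (intro exI[of _ \<Q>] exI[of _ "\<lambda>P. ideal_pow P k"]) auto
  next
    fix P g assume P: "P \<in> nonzero_primes R" and g: "g \<in> carrier (vec_group R (ideal_powers R P) n)"
    interpret L: ideal_system R "ideal_powers R P" by (rule loc[OF P])
    have "\<exists>l. l \<in> prolim R (nonzero_ideals R) \<and> (\<forall>k. l (ideal_pow P k) = g i (ideal_pow P k)) \<and>
      (\<forall>Q\<in>nonzero_primes R - {P}. \<forall>k. l (ideal_pow Q k) = ideal_pow Q k)" if "i < n" for i
    proof -
      have "g i \<in> prolim R (ideal_powers R P)" using g that by (auto simp: L.carrier_vec_group)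
      from local_extension[OF P this] show ?thesis by blast
    qed
    then obtain l where l: "\<And>i. i < n \<Longrightarrow> l i \<in> prolim R (nonzero_ideals R)"
      "\<And>i k. i < n \<Longrightarrow> l i (ideal_pow P k) = g i (ideal_pow P k)"
      "\<And>i Q k. i < n \<Longrightarrow> Q \<in> nonzero_primes R - {P} \<Longrightarrow> l i (ideal_pow Q k) = ideal_pow Q k" by metis
    define x where "x = (\<lambda>i\<in>{..<n}. l i)"
    have xc: "x \<in> carrier (vec_group R (nonzero_ideals R) n)" using l(1) by (simp add: x_def N.carrier_vec_group)
    have "proj_prime R n P x = g"
    proof
      fix i
      show "proj_prime R n P x i = g i"
      proof (cases "i < n")
        case True
        then have gi: "g i \<in> extensional (ideal_powers R P)"
          using g by (auto simp: L.carrier_vec_group prolim_def PiE_iff)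
        have "restrict (l i) (ideal_powers R P) = g i"
        proof (rule extensionalityI[OF restrict_extensional gi])
          fix I assume I: "I \<in> ideal_powers R P"
          then obtain k where "I = ideal_pow P k" by (rule ideal_powersE)
          then show "restrict (l i) (ideal_powers R P) I = g i I" using I l(2)[OF True] by simp
        qed
        then show ?thesis using True by (simp add: proj_prime_def x_def)
      next
        case False
        then show ?thesis using g by (simp add: proj_prime_def L.carrier_vec_group PiE_iff extensional_def)
      qed
    qed
    moreover have "proj_prime R n Q x = \<one>\<^bsub>vec_group R (ideal_powers R Q) n\<^esub>" if Q: "Q \<in> nonzero_primes R - {P}" for Q
    proof -
      have eq: "restrict (l i) (ideal_powers R Q) = (\<lambda>I\<in>ideal_powers R Q. I)" if i: "i < n" for i
      proof (rule restrict_ext)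
        fix I assume "I \<in> ideal_powers R Q"
        then obtain k where "I = ideal_pow Q k" by (rule ideal_powersE)
        then show "l i I = I" using l(3)[OF i Q] by simp
      qed
      have "proj_prime R n Q x = (\<lambda>i\<in>{..<n}. restrict (l i) (ideal_powers R Q))"
        unfolding proj_prime_def x_def by (rule restrict_ext) simp
      also have "\<dots> = (\<lambda>i\<in>{..<n}. \<lambda>I\<in>ideal_powers R Q. I)"
        by (rule restrict_ext, rule eq) simp
      also have "\<dots> = \<one>\<^bsub>vec_group R (ideal_powers R Q) n\<^esub>"
        by (simp add: vec_group_def prolim_group_def zero_Quot)
      finally show ?thesis .
    qed
    ultimately show "\<exists>x\<in>carrier (vec_group R (nonzero_ideals R) n). proj_prime R n P x = g \<and>
        (\<forall>Q\<in>nonzero_primes R - {P}. proj_prime R n Q x = \<one>\<^bsub>vec_group R (ideal_powers R Q) n\<^esub>)"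
      using xc by blast
  qed
qed

end

section \<open>Procounting measures of openly Eulerian sets\<close>

lemma emeasure_density_scaled_indicator:
  assumes "W \<in> sets M" "U \<in> sets M"
  shows "emeasure (density M (\<lambda>x. c * indicator W x)) U = c * emeasure M (W \<inter> U)"
proof -
  have "emeasure (density M (\<lambda>x. c * indicator W x)) U = (\<integral>\<^sup>+ x. c * indicator W x * indicator U x \<partial>M)"
    using assms by (intro emeasure_density) auto
  also have "\<dots> = (\<integral>\<^sup>+ x. c * indicator (W \<inter> U) x \<partial>M)"
    by (intro nn_integral_cong) (simp add: indicator_def)
  also have "\<dots> = c * emeasure M (W \<inter> U)" using assms by (intro nn_integral_cmult_indicator) auto
  finally show ?thesis .
qed

context ideal_system
begin

text \<open>The set is a disjoint union of fibres of \<open>proj_mod\<close>. These are cosets of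
  the level kernel, of mass 1/index each, and by surjectivity of \<open>proj_mod\<close> the index
  is the cardinality of the \<open>n\<close>-th power of the quotient.\<close>

lemma haar_preimage_proj_mod:
  assumes I: "I \<in> \<A>" and S: "S \<subseteq> carrier (vec_group R \<A> n)"
  shows "emeasure (vec_haar R \<A> n) {y \<in> carrier (vec_group R \<A> n). proj_mod n I y \<in> proj_mod n I ` S} =
      ennreal (real (card (proj_mod n I ` S)) / real (card (carrier (R Quot I))) ^ n)"
proof -
  let ?G = "vec_group R \<A> n" and ?\<mu> = "vec_haar R \<A> n"
  interpret V: profinite_group ?G "vec_topology R \<A> n" \<A> "level_kernel R \<A> n" by (rule profinite_vec_group)
  define fibre where "fibre s = {y \<in> carrier ?G. proj_mod n I y = s}" for s
  have coset: "level_kernel R \<A> n I #>\<^bsub>?G\<^esub> x = fibre (proj_mod n I x)" if "x \<in> carrier ?G" for x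
    unfolding fibre_def by (rule level_kernel_coset[OF I that])
  have fin: "finite (\<Pi>\<^sub>E i\<in>{..<n}. carrier (R Quot I))"
    using finite_quotient levels I by (intro finite_PiE) auto
  have "rcosets\<^bsub>?G\<^esub> (level_kernel R \<A> n I) = fibre ` proj_mod n I ` carrier ?G"
    using coset by (auto simp: RCOSETS_def)
  moreover have "inj_on fibre (proj_mod n I ` carrier ?G)"
  proof (rule inj_onI)
    fix s t assume h: "s \<in> proj_mod n I ` carrier ?G" "fibre s = fibre t"
    then obtain x where "x \<in> fibre s" "proj_mod n I x = s" by (auto simp: fibre_def)
    moreover from this have "x \<in> fibre t" using h(2) by simp
    ultimately show "s = t" by (simp add: fibre_def)
  qed
  ultimately have "V.index I = card (proj_mod n I ` carrier ?G)" by (simp add: V.index_def card_image)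
  also have "\<dots> = card (carrier (R Quot I)) ^ n" unfolding proj_mod_image[OF I] by (simp add: card_PiE)
  finally have index: "V.index I = card (carrier (R Quot I)) ^ n" .
  have fibre_clopen: "fibre s \<in> V.clopens" and fibre_haar: "emeasure ?\<mu> (fibre s) = ennreal (1 / V.index I)"
    if s: "s \<in> proj_mod n I ` S" for s
  proof -
    obtain x where x: "x \<in> carrier ?G" "s = proj_mod n I x" using s S by blast
    show "fibre s \<in> V.clopens" using V.coset_clopen[OF I x(1)] coset[OF x(1)] x(2) by simp
    show "emeasure ?\<mu> (fibre s) = ennreal (1 / V.index I)"
      using V.haar_coset[OF V.normalized_haar I x(1)] coset[OF x(1)] x(2) by (simp add: vec_haar_def)
  qed
  have fin_im: "finite (proj_mod n I ` S)"
    using finite_subset[OF image_mono[OF S, of "proj_mod n I"]] fin unfolding proj_mod_image[OF I] by blast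
  have "{y \<in> carrier ?G. proj_mod n I y \<in> proj_mod n I ` S} = (\<Union>s\<in>proj_mod n I ` S. fibre s)"
    by (auto simp: fibre_def)
  also have "emeasure ?\<mu> \<dots> = (\<Sum>s\<in>proj_mod n I ` S. emeasure ?\<mu> (fibre s))"
  proof (rule sum_emeasure[symmetric])
    show "fibre ` proj_mod n I ` S \<subseteq> sets ?\<mu>"
      using V.clopen_sets[OF fibre_clopen] V.sets_haar by (auto simp: vec_haar_def)
    show "disjoint_family_on fibre (proj_mod n I ` S)" by (auto simp: disjoint_family_on_def fibre_def)
  qed (rule fin_im)
  also have "\<dots> = (\<Sum>s\<in>proj_mod n I ` S. ennreal (1 / V.index I))" by (rule sum.cong[OF refl fibre_haar])
  also have "\<dots> = ennreal (\<Sum>s\<in>proj_mod n I ` S. 1 / V.index I)" by (rule sum_ennreal) simp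
  also have "(\<Sum>s\<in>proj_mod n I ` S. 1 / real (V.index I)) = card (proj_mod n I ` S) / V.index I" by simp
  also have "real (V.index I) = real (card (carrier (R Quot I))) ^ n" by (simp add: index)
  finally show ?thesis .
qed

end

section \<open>The net of ideals, the approximating measures and their limit\<close>

context finite_quotient_domain
begin

text \<open>To divide is to contain: this makes the net, ordered by divisibility, eventually finer
  than every level.\<close>

lemma divides_imp_subset:
  assumes "ideal J R" "J divides\<^bsub>ideals_set R\<^esub> I" shows "I \<subseteq> J"
  using assms ideal_prod_inter by (auto simp: factor_def ideals_set_def)

lemma eventually_ideals_to_zero:
  assumes "J \<in> nonzero_ideals R" shows "eventually (\<lambda>I. I \<in> nonzero_ideals R \<and> I \<subseteq> J) (ideals_to_zero R)"
  unfolding ideals_to_zero_def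
  by (rule eventually_INF1[OF assms])
    (use divides_imp_subset[OF nonzero_idealsD[OF assms]] in \<open>auto simp: eventually_principal\<close>)

text \<open>The sets of multiples form a filter base, since a multiple of a product is a multiple of
  both factors; none is empty, since every ideal divides itself.\<close>

lemma ideals_to_zero_nontrivial: "ideals_to_zero R \<noteq> bot"
proof -
  let ?F = "\<lambda>J. {I \<in> nonzero_ideals R. J divides\<^bsub>ideals_set R\<^esub> I}"
  have "\<exists>K\<in>nonzero_ideals R. principal (?F K) \<le> inf (principal (?F I)) (principal (?F J))"
    if I: "I \<in> nonzero_ideals R" and J: "J \<in> nonzero_ideals R" for I J
  proof (rule bexI)
    show "I \<cdot> J \<in> nonzero_ideals R" by (rule ideal_prod_nonzero[OF I J])
    have id: "ideal I R" "ideal J R" using I J nonzero_idealsD by auto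
    have "I divides\<^bsub>ideals_set R\<^esub> L \<and> J divides\<^bsub>ideals_set R\<^esub> L" if L: "(I \<cdot> J) divides\<^bsub>ideals_set R\<^esub> L" for L
    proof -
      obtain C where C: "ideal C R" "L = I \<cdot> J \<cdot> C" using L by (auto simp: factor_def ideals_set_def)
      have "L = I \<cdot> (J \<cdot> C)" using ideal_prod_assoc[OF id C(1)] C(2) by simp
      moreover have "L = J \<cdot> (I \<cdot> C)"
        using ideal_prod_assoc[OF id(2,1) C(1)] C(2) ideal_prod_commute[OF id] by simp
      ultimately show ?thesis using ideal_prod_is_ideal id C(1)
        unfolding factor_def ideals_set_def by auto
    qed
    then show "principal (?F (I \<cdot> J)) \<le> inf (principal (?F I)) (principal (?F J))" by auto
  qed
  then have "ideals_to_zero R = bot \<longleftrightarrow> (\<exists>J\<in>nonzero_ideals R. principal (?F J) = bot)"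
    unfolding ideals_to_zero_def by (rule INF_filter_bot_base)
  moreover have "principal (?F J) \<noteq> bot" if J: "J \<in> nonzero_ideals R" for J
  proof -
    have "J = J \<cdot> carrier R" using ideal_prod_one[OF nonzero_idealsD[OF J]] by simp
    then have "J divides\<^bsub>ideals_set R\<^esub> J" using oneideal by (auto simp: factor_def ideals_set_def)
    then show ?thesis using J by (auto simp: principal_eq_bot_iff)
  qed
  ultimately show ?thesis by blast
qed

lemma openly_eulerian_set_completion:
  assumes A: "A \<subseteq> carrier (vec_group R (nonzero_ideals R) n)" "A \<noteq> {}" and E: "openly_Eulerian R n A"
  shows "openly_eulerian_set (vec_group R (nonzero_ideals R) n) (vec_topology R (nonzero_ideals R) n)
     (nonzero_ideals R) (level_kernel R (nonzero_ideals R) n) (nonzero_primes R)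
     (\<lambda>P. vec_group R (ideal_powers R P) n) (\<lambda>P. vec_topology R (ideal_powers R P) n)
     (ideal_powers R) (\<lambda>P. level_kernel R (ideal_powers R P) n) (proj_prime R n) A (local_closure R n A)"
proof (rule openly_eulerian_set.intro[OF local_global_completion], rule openly_eulerian_set_axioms.intro)
  show "(\<lambda>x. \<lambda>P\<in>nonzero_primes R. proj_prime R n P x) `
      (vec_topology R (nonzero_ideals R) n closure_of A) = (\<Pi>\<^sub>E P\<in>nonzero_primes R. local_closure R n A P)"
    using E unfolding openly_Eulerian_def Eulerian_def local_components_def by blast
qed (use A E in \<open>auto simp: openly_Eulerian_def local_closure_def\<close>)

text \<open>The scaling constant is the reciprocal of the Haar mass of \<open>W\<close>, so the
  approximating measure is Haar measure conditioned on \<open>W\<close>.\<close>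

lemma emeasure_procounting_approx:
  assumes A: "A \<subseteq> carrier (vec_group R (nonzero_ideals R) n)" "A \<noteq> {}"
    and I: "I \<in> nonzero_ideals R" and U: "U \<in> sets (borel_of (vec_topology R (nonzero_ideals R) n))"
    and W: "W = {y \<in> carrier (vec_group R (nonzero_ideals R) n). proj_mod n I y \<in> proj_mod n I ` A}"
      "W \<in> sets (borel_of (vec_topology R (nonzero_ideals R) n))"
  shows "emeasure (procounting_approx R n A I) U =
    emeasure (vec_haar R (nonzero_ideals R) n) (W \<inter> U) / emeasure (vec_haar R (nonzero_ideals R) n) W"
proof -
  interpret N: ideal_system R "nonzero_ideals R" by (rule ideal_system_nonzero_ideals)
  interpret V: profinite_group "vec_group R (nonzero_ideals R) n" "vec_topology R (nonzero_ideals R) n"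
    "nonzero_ideals R" "level_kernel R (nonzero_ideals R) n" by (rule N.profinite_vec_group)
  let ?\<mu> = "vec_haar R (nonzero_ideals R) n"
  let ?a = "real (card (proj_mod n I ` A))" and ?b = "real (card (carrier (R Quot I))) ^ n"
  have sets: "sets ?\<mu> = sets (borel_of (vec_topology R (nonzero_ideals R) n))"
    using V.sets_haar by (simp add: vec_haar_def)
  have "finite (\<Pi>\<^sub>E i\<in>{..<n}. carrier (R Quot I))" using finite_quotient[OF I] by (intro finite_PiE) auto
  then have "finite (proj_mod n I ` A)"
    using finite_subset[OF image_mono[OF A(1), of "proj_mod n I"]] unfolding N.proj_mod_image[OF I] by blast
  then have a: "?a > 0" using A(2) by (simp add: card_gt_0_iff)
  have "carrier (R Quot I) \<noteq> {}" by (auto simp: carrier_Quot)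
  then have b: "?b > 0" using finite_quotient[OF I] by (simp add: card_gt_0_iff)
  have \<mu>W: "emeasure ?\<mu> W = ennreal (?a / ?b)" unfolding W(1) by (rule N.haar_preimage_proj_mod[OF I A(1)])
  have "emeasure (procounting_approx R n A I) U = ennreal (?b / ?a) * emeasure ?\<mu> (W \<inter> U)"
    unfolding procounting_approx_def W(1)[symmetric]
    by (rule emeasure_density_scaled_indicator) (use U W(2) sets in auto)
  also have "ennreal (?b / ?a) = inverse (emeasure ?\<mu> W)" using a b by (simp add: \<mu>W inverse_ennreal)
  finally show ?thesis by (simp add: divide_ennreal_def mult.commute)
qed

text \<open>Both sides of the equation being definite descriptions, one measure is shown to satisfy
  both defining properties, and each property is shown to have one solution: by clopen sets on the
  procounting side, by boxes on the product side.\<close>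

theorem openly_Eulerian_procounting_measure:
  assumes A: "A \<subseteq> carrier (vec_group R (nonzero_ideals R) n)" "A \<noteq> {}" and E: "openly_Eulerian R n A"
  shows "(\<exists>!\<nu>. is_procounting_measure R n A \<nu>) \<and>
         procounting_measure R n A =
           local_product_measure R n
             (\<lambda>P. density (vec_haar R (ideal_powers R P) n)
                (\<lambda>x. 1 / emeasure (vec_haar R (ideal_powers R P) n) (local_closure R n A P) *
                      indicator (local_closure R n A P) x))"
proof -
  let ?N = "nonzero_ideals R" and ?Pr = "nonzero_primes R"
  let ?G = "vec_group R ?N n" and ?T = "vec_topology R ?N n"
  let ?TL = "\<lambda>P. vec_topology R (ideal_powers R P) n"
  let ?X = "local_closure R n A"
  let ?loc = "\<lambda>P. density (vec_haar R (ideal_powers R P) n)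
                (\<lambda>x. 1 / emeasure (vec_haar R (ideal_powers R P) n) (?X P) * indicator (?X P) x)"
  interpret N: ideal_system R ?N by (rule ideal_system_nonzero_ideals)
  interpret S: openly_eulerian_set ?G ?T ?N "level_kernel R ?N n" ?Pr
     "\<lambda>P. vec_group R (ideal_powers R P) n" ?TL "ideal_powers R" "\<lambda>P. level_kernel R (ideal_powers R P) n"
     "proj_prime R n" A ?X
    by (rule openly_eulerian_set_completion[OF A E])
  let ?\<mu> = "vec_haar R ?N n"
  have \<mu>: "?\<mu> = normalized_haar ?G ?T" by (simp add: vec_haar_def)
  \<comment> \<open>The abstract thickening is the set on which the density in
    \<open>procounting_approx\<close> is supported.\<close>
  have thick: "S.thickening I = {y \<in> carrier ?G. proj_mod n I y \<in> proj_mod n I ` A}" if I: "I \<in> ?N" for I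
  proof -
    have "S.thickening I = (\<Union>a\<in>A. {y \<in> carrier ?G. proj_mod n I y = proj_mod n I a})"
      unfolding S.thickening_def
      by (rule SUP_cong[OF refl]) (use N.level_kernel_coset[OF I] subsetD[OF A(1)] in simp)
    then show ?thesis by auto
  qed
  have approx: "emeasure (procounting_approx R n A I) U =
      emeasure (normalized_haar ?G ?T) (S.thickening I \<inter> U) / emeasure (normalized_haar ?G ?T) (S.thickening I)"
    if "I \<in> ?N" "U \<in> S.clopens" for I U
    using emeasure_procounting_approx[OF A that(1) S.clopen_sets[OF that(2)] thick[OF that(1)]
        S.clopen_sets[OF S.thickening_clopen[OF that(1)]]]
    unfolding \<mu> .
  have sets_approx: "sets (procounting_approx R n A I) = sets (borel_of ?T)" for I
    by (simp add: procounting_approx_def \<mu> S.sets_haar)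
  have ev: "eventually (\<lambda>I. I \<in> ?N \<and> level_kernel R ?N n I \<subseteq> level_kernel R ?N n J) (ideals_to_zero R)"
    if J: "J \<in> ?N" for J
    by (rule eventually_mono[OF eventually_ideals_to_zero[OF J]]) (use N.level_kernel_mono[OF _ J] in blast)
  obtain \<nu> where \<nu>: "sets \<nu> = sets (borel_of ?T)"
    "\<And>U. U \<in> S.clopens \<Longrightarrow>
       eventually (\<lambda>I. emeasure (procounting_approx R n A I) U = emeasure \<nu> U) (ideals_to_zero R)"
    "\<And>Q U. finite Q \<Longrightarrow> Q \<subseteq> ?Pr \<Longrightarrow> (\<And>P. P \<in> Q \<Longrightarrow> openin (?TL P) (U P) \<and> closedin (?TL P) (U P))
       \<Longrightarrow> emeasure \<nu> (S.box Q U) = S.local_prod Q U"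
    by (rule S.limit_measure[OF ev ideals_to_zero_nontrivial sets_approx approx]) blast+
  \<comment> \<open>The carrier is the box without conditions, whose mass is an empty
    product.\<close>
  have fin: "emeasure \<nu> (carrier ?G) \<noteq> \<infinity>"
    using \<nu>(3)[of "{}"] by (simp add: S.box_empty S.local_prod_def)
  have pc: "is_procounting_measure R n A \<nu>"
    unfolding is_procounting_measure_def
  proof (intro conjI allI impI \<nu>(1))
    fix U assume "compactin ?T U \<and> openin ?T U"
    then have "U \<in> S.clopens" by (simp add: S.clopen_iff)
    then show "((\<lambda>I. emeasure (procounting_approx R n A I) U) \<longlongrightarrow> emeasure \<nu> U) (ideals_to_zero R)"
      by (rule tendsto_eventually[OF \<nu>(2)])
  qed
  have pc_unique: "\<nu>' = \<nu>" if "is_procounting_measure R n A \<nu>'" for \<nu>'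
  proof (rule S.clopens_measure_eqI[symmetric])
    show "sets \<nu>' = sets (borel_of ?T)" using that by (simp add: is_procounting_measure_def)
    fix U assume "U \<in> S.clopens"
    then have "compactin ?T U \<and> openin ?T U" by (simp add: S.clopen_iff)
    then have "((\<lambda>I. emeasure (procounting_approx R n A I) U) \<longlongrightarrow> emeasure \<nu> U) (ideals_to_zero R)"
      "((\<lambda>I. emeasure (procounting_approx R n A I) U) \<longlongrightarrow> emeasure \<nu>' U) (ideals_to_zero R)"
      using pc that unfolding is_procounting_measure_def by blast+
    then show "emeasure \<nu> U = emeasure \<nu>' U" by (rule tendsto_unique[OF ideals_to_zero_nontrivial])
  qed (use \<nu>(1) fin in auto)
  have loc: "emeasure (?loc P) U = emeasure (normalized_haar (vec_group R (ideal_powers R P) n) (?TL P)) (U \<inter> ?X P) /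
      emeasure (normalized_haar (vec_group R (ideal_powers R P) n) (?TL P)) (?X P)"
    if P: "P \<in> ?Pr" and U: "openin (?TL P) U" for P U
  proof -
    interpret L: profinite_group "vec_group R (ideal_powers R P) n" "?TL P" "ideal_powers R P"
      "level_kernel R (ideal_powers R P) n" by (rule S.loc[OF P])
    have "emeasure (?loc P) U = 1 / emeasure (vec_haar R (ideal_powers R P) n) (?X P) *
        emeasure (vec_haar R (ideal_powers R P) n) (?X P \<inter> U)"
      using borel_of_open[OF U] borel_of_open[OF S.XL_openin[OF P]]
      by (intro emeasure_density_scaled_indicator) (simp_all add: vec_haar_def L.sets_haar)
    then show ?thesis by (simp add: vec_haar_def Int_commute ennreal_divide_times)
  qed
  have carrier_local: "topspace (?TL P) = carrier (vec_group R (ideal_powers R P) n)" if "P \<in> ?Pr" for P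
    by (rule ideal_system.topspace_vec[OF ideal_system_ideal_powers[OF that]])
  \<comment> \<open>A coordinate where \<open>U P\<close> is the whole space imposes no condition,
    so only the others are recorded.\<close>
  have boxes: "{x \<in> carrier ?G. local_components R n x \<in> (\<Pi>\<^sub>E P\<in>?Pr. U P)} =
      S.box {P \<in> ?Pr. U P \<noteq> topspace (?TL P)} U" for U
  proof -
    have "proj_prime R n P x \<in> U P" if "x \<in> carrier ?G" "P \<in> ?Pr" "U P = topspace (?TL P)" for x P
      using proj_prime_mem[OF that(2,1)] carrier_local[OF that(2)] that(3) by simp
    then show ?thesis unfolding S.box_def local_components_def by (auto simp: PiE_iff)
  qed
  have lp: "is_local_product_measure R n ?loc \<nu>"
    unfolding is_local_product_measure_def
  proof (intro conjI allI impI \<nu>(1))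
    fix U assume U: "(\<forall>P\<in>?Pr. compactin (?TL P) (U P) \<and> openin (?TL P) (U P)) \<and>
        finite {P \<in> ?Pr. U P \<noteq> topspace (?TL P)}"
    let ?Q = "{P \<in> ?Pr. U P \<noteq> topspace (?TL P)}"
    have clopen: "openin (?TL P) (U P) \<and> closedin (?TL P) (U P)" if P: "P \<in> ?Pr" for P
    proof -
      interpret L: profinite_group "vec_group R (ideal_powers R P) n" "?TL P" "ideal_powers R P"
        "level_kernel R (ideal_powers R P) n" by (rule S.loc[OF P])
      have "U P \<in> L.clopens" using U P by (simp add: L.clopen_iff)
      then show ?thesis by (simp add: L.clopens_def)
    qed
    have "emeasure \<nu> (S.box ?Q U) = S.local_prod ?Q U" using U clopen by (intro \<nu>(3)) auto
    also have "\<dots> = (\<Prod>P\<in>?Q. emeasure (?loc P) (U P))"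
      unfolding S.local_prod_def using loc clopen by (intro prod.cong) auto
    finally show "emeasure \<nu> {x \<in> carrier ?G. local_components R n x \<in> (\<Pi>\<^sub>E P\<in>?Pr. U P)} =
        (\<Prod>P\<in>?Q. emeasure (?loc P) (U P))"
      unfolding boxes .
  qed
  have lp_unique: "\<nu>' = \<nu>" if lp': "is_local_product_measure R n ?loc \<nu>'" for \<nu>'
  proof (rule S.measure_eqI_boxes[symmetric])
    show "sets \<nu>' = sets (borel_of ?T)" using lp' by (simp add: is_local_product_measure_def)
    fix Q U assume Q: "finite Q" "Q \<subseteq> ?Pr" and U: "\<And>P. P \<in> Q \<Longrightarrow> openin (?TL P) (U P) \<and> closedin (?TL P) (U P)"
    \<comment> \<open>Padding with whole spaces turns a box into a set of the kind that the
      definition of the product measure speaks about. The \<open>?Q\<close> below can be smaller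
      than \<open>Q\<close>, as some \<open>U P\<close> may itself be the whole space.\<close>
    define V where "V P = (if P \<in> Q then U P else topspace (?TL P))" for P
    have V: "compactin (?TL P) (V P) \<and> openin (?TL P) (V P)" if P: "P \<in> ?Pr" for P
    proof -
      interpret L: profinite_group "vec_group R (ideal_powers R P) n" "?TL P" "ideal_powers R P"
        "level_kernel R (ideal_powers R P) n" by (rule S.loc[OF P])
      have "V P \<in> L.clopens" using U by (auto simp: L.clopens_def V_def)
      then show ?thesis by (simp add: L.clopen_iff)
    qed
    let ?Q = "{P \<in> ?Pr. V P \<noteq> topspace (?TL P)}"
    have "?Q \<subseteq> Q" by (auto simp: V_def)
    then have fQ: "finite ?Q" using Q(1) by (rule finite_subset)
    have "S.box Q U = S.box ?Q V"
    proof -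
      have "proj_prime R n P x \<in> U P" if "x \<in> carrier ?G" "P \<in> Q" "V P = topspace (?TL P)" for x P
        using proj_prime_mem[of P x n] carrier_local[of P] that Q(2) by (auto simp: V_def)
      then show ?thesis using Q(2) unfolding S.box_def V_def by auto
    qed
    also have "\<dots> = {x \<in> carrier ?G. local_components R n x \<in> (\<Pi>\<^sub>E P\<in>?Pr. V P)}" by (rule boxes[symmetric])
    finally have box: "S.box Q U = {x \<in> carrier ?G. local_components R n x \<in> (\<Pi>\<^sub>E P\<in>?Pr. V P)}" .
    have "emeasure \<rho> (S.box Q U) = (\<Prod>P\<in>?Q. emeasure (?loc P) (V P))"
      if "is_local_product_measure R n ?loc \<rho>" for \<rho>
      unfolding box using that V fQ unfolding is_local_product_measure_def by blast
    from this[OF lp] this[OF lp'] show "emeasure \<nu> (S.box Q U) = emeasure \<nu>' (S.box Q U)" by simp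
  qed (use \<nu>(1) fin in auto)
  have pm: "procounting_measure R n A = \<nu>"
    unfolding procounting_measure_def by (rule the_equality, rule pc, rule pc_unique)
  have lpm: "local_product_measure R n ?loc = \<nu>"
    unfolding local_product_measure_def by (rule the_equality, rule lp, rule lp_unique)
  show ?thesis
  proof
    show "\<exists>!\<nu>. is_procounting_measure R n A \<nu>" by (rule ex1I, rule pc, rule pc_unique)
    show "procounting_measure R n A = local_product_measure R n ?loc" by (rule trans[OF pm lpm[symmetric]])
  qed
qed

end

section \<open>Rings of S-integers\<close>

text \<open>Compare squares: |1|^2 = |1| with |1| non-zero, and |-x|^2 = |x|^2 with non-negative
  values.\<close>

lemma nontrivial_abs_value:
  assumes F: "field F" and v: "v \<in> nontrivial_abs_values F"
  shows nontrivial_abs_value_one: "v \<one>\<^bsub>F\<^esub> = 1"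
    and nontrivial_abs_value_minus: "x \<in> carrier F \<Longrightarrow> v (\<ominus>\<^bsub>F\<^esub> x) = v x"
proof -
  interpret field F by (rule F)
  have nonneg: "0 \<le> v x" and zero: "v x = 0 \<longleftrightarrow> x = \<zero>\<^bsub>F\<^esub>" if "x \<in> carrier F" for x
    using v that by (auto simp: nontrivial_abs_values_def)
  have mult: "v (x \<otimes>\<^bsub>F\<^esub> y) = v x * v y" if "x \<in> carrier F" "y \<in> carrier F" for x y
    using v that by (auto simp: nontrivial_abs_values_def)
  have "v \<one>\<^bsub>F\<^esub> * v \<one>\<^bsub>F\<^esub> = v \<one>\<^bsub>F\<^esub>" using mult[of "\<one>\<^bsub>F\<^esub>" "\<one>\<^bsub>F\<^esub>"] by simp
  moreover have "v \<one>\<^bsub>F\<^esub> \<noteq> 0" using zero[of "\<one>\<^bsub>F\<^esub>"] by simp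
  ultimately show one: "v \<one>\<^bsub>F\<^esub> = 1" by simp
  assume x: "x \<in> carrier F"
  have "v (\<ominus>\<^bsub>F\<^esub> x) * v (\<ominus>\<^bsub>F\<^esub> x) = v (\<ominus>\<^bsub>F\<^esub> x \<otimes>\<^bsub>F\<^esub> \<ominus>\<^bsub>F\<^esub> x)" using mult x by simp
  also have "\<ominus>\<^bsub>F\<^esub> x \<otimes>\<^bsub>F\<^esub> \<ominus>\<^bsub>F\<^esub> x = x \<otimes>\<^bsub>F\<^esub> x" using x by algebra
  also have "v (x \<otimes>\<^bsub>F\<^esub> x) = v x * v x" using mult x by simp
  finally have "(v (\<ominus>\<^bsub>F\<^esub> x))\<^sup>2 = (v x)\<^sup>2" by (simp add: power2_eq_square)
  then show "v (\<ominus>\<^bsub>F\<^esub> x) = v x" using nonneg x by (simp add: power2_eq_iff_nonneg)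
qed

text \<open>Places outside \<open>S\<close> are nonarchimedean, and the ultrametric inequality keeps
  the condition \<open>v x \<le> 1\<close> stable under sums.\<close>

lemma S_integers_subring:
  assumes F: "field F" and arch: "archimedean_places F \<subseteq> S"
  shows "subring {x \<in> carrier F. \<forall>P\<in>places F - S. \<forall>v\<in>P. v x \<le> 1} F"
proof -
  interpret field F by (rule F)
  have nat: "v \<in> nontrivial_abs_values F" "nonarchimedean F v" if "P \<in> places F - S" "v \<in> P" for P v
  proof -
    show "v \<in> nontrivial_abs_values F"
      using that by (auto simp: places_def quotient_def abs_value_equiv_def)
    show "nonarchimedean F v" using that arch by (auto simp: archimedean_places_def)
  qed
  show ?thesis
  proof (rule subringI)
    have "v \<one>\<^bsub>F\<^esub> \<le> 1" if "P \<in> places F - S" "v \<in> P" for P v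
      using nontrivial_abs_value_one[OF F nat(1)[OF that]] by simp
    then show "\<one>\<^bsub>F\<^esub> \<in> {x \<in> carrier F. \<forall>P\<in>places F - S. \<forall>v\<in>P. v x \<le> 1}" by blast
  next
    fix x assume x: "x \<in> {x \<in> carrier F. \<forall>P\<in>places F - S. \<forall>v\<in>P. v x \<le> 1}"
    then have xc: "x \<in> carrier F" by simp
    have "v (\<ominus>\<^bsub>F\<^esub> x) \<le> 1" if "P \<in> places F - S" "v \<in> P" for P v
      using nontrivial_abs_value_minus[OF F nat(1)[OF that] xc] x that by auto
    then show "\<ominus>\<^bsub>F\<^esub> x \<in> {x \<in> carrier F. \<forall>P\<in>places F - S. \<forall>v\<in>P. v x \<le> 1}"
      using xc by blast
  next
    fix x y
    assume x: "x \<in> {x \<in> carrier F. \<forall>P\<in>places F - S. \<forall>v\<in>P. v x \<le> 1}"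
      and y: "y \<in> {x \<in> carrier F. \<forall>P\<in>places F - S. \<forall>v\<in>P. v x \<le> 1}"
    have c: "x \<in> carrier F" "y \<in> carrier F" using x y by auto
    have "v (x \<otimes>\<^bsub>F\<^esub> y) \<le> 1 \<and> v (x \<oplus>\<^bsub>F\<^esub> y) \<le> 1" if v: "P \<in> places F - S" "v \<in> P" for P v
    proof -
      have le: "v x \<le> 1" "v y \<le> 1" using x y v by auto
      have "0 \<le> v y" "v (x \<otimes>\<^bsub>F\<^esub> y) = v x * v y" "0 \<le> v x"
        using nat(1)[OF v] c by (auto simp: nontrivial_abs_values_def)
      then have "v (x \<otimes>\<^bsub>F\<^esub> y) \<le> 1" using le by (simp add: mult_le_one)
      moreover have "v (x \<oplus>\<^bsub>F\<^esub> y) \<le> max (v x) (v y)"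
        using nat(2)[OF v] c by (simp add: nonarchimedean_def)
      ultimately show ?thesis using le by simp
    qed
    then show "x \<otimes>\<^bsub>F\<^esub> y \<in> {x \<in> carrier F. \<forall>P\<in>places F - S. \<forall>v\<in>P. v x \<le> 1}"
      "x \<oplus>\<^bsub>F\<^esub> y \<in> {x \<in> carrier F. \<forall>P\<in>places F - S. \<forall>v\<in>P. v x \<le> 1}"
      using c by auto
  qed auto
qed

text \<open>The filtration lives on the field \<open>F\<close>; its counting bound and its
  countability pass to the subring of S-integers.\<close>

lemma S_integers_finite_quotient_domain:
  assumes F: "global_field F" and arch: "archimedean_places F \<subseteq> S"
  shows "finite_quotient_domain (S_integers F S)"
proof -
  interpret field F using F by (auto simp: global_field_def number_field_def global_function_field_def)
  obtain B c K us where "filtered_field F B c K us" using global_field_filtration[OF F] by blast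
  then interpret filtered_field F B c K us .
  define D where "D = {x \<in> carrier F. \<forall>P\<in>places F - S. \<forall>v\<in>P. v x \<le> 1}"
  have D: "subring D F" unfolding D_def by (rule S_integers_subring[OF field_axioms arch])
  have eq: "S_integers F S = F\<lparr>carrier := D\<rparr>" by (simp add: S_integers_def D_def)
  have "D \<subseteq> carrier F" by (auto simp: D_def)
  then have dom: "domain (F\<lparr>carrier := D\<rparr>)"
    using subdomain_iff[of D] subdomainI'[OF D] by simp
  show ?thesis
    unfolding eq
  proof (rule finite_quotient_domain.intro[OF dom], rule finite_quotient_domain_axioms.intro)
    fix I assume "I \<in> nonzero_ideals (F\<lparr>carrier := D\<rparr>)"
    then show "finite (carrier (F\<lparr>carrier := D\<rparr> Quot I))"
      by (intro finite_Quot[OF D]) (simp_all add: nonzero_ideals_def)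
  next
    show "countable (carrier (F\<lparr>carrier := D\<rparr>))"
      using countable_subset[OF \<open>D \<subseteq> carrier F\<close> countable_carrier] by simp
  qed
qed

theorem theorem3p3:
  fixes F D :: "('a, 'b) ring_scheme"
    and S :: "('a \<Rightarrow> real) set set"
    and n :: nat
    and A :: "(nat \<Rightarrow> 'a set \<Rightarrow> 'a set) set"
  assumes "global_field F"
    and "S \<subseteq> places F" and "finite S" and "S \<noteq> {}" and "archimedean_places F \<subseteq> S"
    and "D = S_integers F S"
    and "A \<subseteq> carrier (vec_group D (nonzero_ideals D) n)" and "A \<noteq> {}"
    and "openly_Eulerian D n A"
  shows "(\<exists>!\<nu>. is_procounting_measure D n A \<nu>) \<and>
         procounting_measure D n A =
           local_product_measure D n
             (\<lambda>P. density (vec_haar D (ideal_powers D P) n)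
                (\<lambda>x. 1 / emeasure (vec_haar D (ideal_powers D P) n) (local_closure D n A P) *
                      indicator (local_closure D n A P) x))"
proof -
  interpret finite_quotient_domain D
    unfolding assms(6) by (rule S_integers_finite_quotient_domain[OF assms(1,5)])
  show ?thesis by (rule openly_Eulerian_procounting_measure[OF assms(7-9)])
qed

end
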